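(* Let $X$ be a hyperbolic proper geodesic metric space on which $\mathrm{Isom}(X)$ acts cocompactly. Then any countable group $\Gamma$ admitting a proper non-elementary isometric action on $X$ is in $\mathcal{C}_{\mathrm{reg}}$.
   Context: Hyperbolic means Gromov-hyperbolic; a metric space is proper if all closed balls are compact. $\mathrm{Isom}(X)$ is the isometry group with the compact-open topology (a locally compact group). $\Gamma$ is considered as a discrete group: an action is proper if the kernel of $\Gamma\to\mathrm{Isom}(X)$ is finite and its image is discrete. A subgroup $H<\mathrm{Isom}(X)$ is elementary if it preserves a (non-empty) compact set in $X$, or a point of the Gromov boundary $\partial X$, or a pair of points of $\partial X$; an isometric action is non-elementary if the image of the group in $\mathrm{Isom}(X)$ is not elementary. $\mathcal{C}_{\mathrm{reg}}$ is the class of countable groups $\Gamma$ for which the bounded cohomology $\mathrm{H}_{\mathrm b}^2(\Gamma,\ell^2(\Gamma))$ is non-trivial, where $\mathrm{H}_{\mathrm b}^n(\Gamma,V)$ is the cohomology of the complex of $\Gamma$-equivariant bounded functions $\Gamma^{n+1}\to V$ with the homogeneous coboundary and $\ell^2(\Gamma)$ carries the left regular representation. *)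

theory Defs
  imports "HOL-Analysis.Analysis" "HOL-Algebra.Coset" "HOL-Library.Function_Algebras"
begin

section \<open>Hyperbolic spaces and their boundary\<close>

definition Gromov_product :: "'x::metric_space \<Rightarrow> 'x \<Rightarrow> 'x \<Rightarrow> real" where
  "Gromov_product p x y = (dist p x + dist p y - dist x y) / 2"

definition Gromov_hyperbolic :: "'x::metric_space itself \<Rightarrow> bool" where
  "Gromov_hyperbolic _ \<longleftrightarrow>
     (\<exists>\<delta>. \<forall>p x y z :: 'x.
        Gromov_product p x z \<ge> min (Gromov_product p x y) (Gromov_product p y z) - \<delta>)"

definition geodesic_space :: "'x::metric_space itself \<Rightarrow> bool" where
  "geodesic_space _ \<longleftrightarrow>
     (\<forall>x y :: 'x. \<exists>\<gamma> :: real \<Rightarrow> 'x. \<gamma> 0 = x \<and> \<gamma> (dist x y) = y \<and>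
        (\<forall>s\<in>{0..dist x y}. \<forall>t\<in>{0..dist x y}. dist (\<gamma> s) (\<gamma> t) = \<bar>s - t\<bar>))"

definition proper_space :: "'x::metric_space itself \<Rightarrow> bool" where
  "proper_space _ \<longleftrightarrow> (\<forall>(x::'x) r. compact (cball x r))"

text \<open>
  The Gromov boundary is the set of classes of sequences converging to infinity.
  The condition on \<open>p\<close> in \<open>asymptotic\<close> holds for all base points as soon as it holds for one,
  and \<open>boundary_rel\<close> is an equivalence relation when the space is hyperbolic.
\<close>

definition asymptotic :: "(nat \<Rightarrow> 'x::metric_space) \<Rightarrow> (nat \<Rightarrow> 'x) \<Rightarrow> bool" where
  "asymptotic u v \<longleftrightarrow>
     (\<forall>p. filterlim (\<lambda>(i, j). Gromov_product p (u i) (v j)) at_top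
            (sequentially \<times>\<^sub>F sequentially))"

definition sequences_to_infinity :: "(nat \<Rightarrow> 'x::metric_space) set" where
  "sequences_to_infinity = {u. asymptotic u u}"

definition boundary_rel :: "((nat \<Rightarrow> 'x::metric_space) \<times> (nat \<Rightarrow> 'x)) set" where
  "boundary_rel =
     {(u, v). u \<in> sequences_to_infinity \<and> v \<in> sequences_to_infinity \<and> asymptotic u v}"

definition Gromov_boundary :: "(nat \<Rightarrow> 'x::metric_space) set set" where
  "Gromov_boundary = sequences_to_infinity // boundary_rel"

definition boundary_map ::
    "('x \<Rightarrow> 'x) \<Rightarrow> (nat \<Rightarrow> 'x::metric_space) set \<Rightarrow> (nat \<Rightarrow> 'x) set" where
  "boundary_map f \<xi> = (\<lambda>u. f \<circ> u) ` \<xi>"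

section \<open>The isometry group\<close>

definition isometries :: "('x::metric_space \<Rightarrow> 'x) set" where
  "isometries = {f. bij f \<and> (\<forall>x y. dist (f x) (f y) = dist x y)}"

definition Isom :: "('x::metric_space \<Rightarrow> 'x) monoid" where
  "Isom = \<lparr>carrier = isometries, mult = (\<circ>), one = id\<rparr>"

lemma group_Isom: "group Isom"
proof (rule groupI)
  fix f :: "'x::metric_space \<Rightarrow> 'x"
  assume "f \<in> carrier Isom"
  then have f: "bij f" "\<And>x y. dist (f x) (f y) = dist x y"
    by (auto simp: Isom_def isometries_def)
  then have "dist (inv_into UNIV f x) (inv_into UNIV f y) = dist x y" for x y
    by (metis bij_inv_eq_iff)
  with f have "inv_into UNIV f \<in> carrier Isom"
    by (simp add: Isom_def isometries_def bij_imp_bij_inv)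
  moreover have "inv_into UNIV f \<circ> f = id"
    using f(1) by (simp add: bij_is_inj)
  ultimately show "\<exists>g\<in>carrier Isom. g \<otimes>\<^bsub>Isom\<^esub> f = \<one>\<^bsub>Isom\<^esub>"
    by (auto simp: Isom_def)
qed (auto simp: Isom_def isometries_def bij_comp o_assoc)

definition compact_open_topology :: "('x::metric_space \<Rightarrow> 'x) topology" where
  "compact_open_topology =
     topology_generated_by {{f. f ` K \<subseteq> U} | K U. compact K \<and> open U}"

definition Isom_topology :: "('x::metric_space \<Rightarrow> 'x) topology" where
  "Isom_topology = subtopology compact_open_topology isometries"

definition Isom_cocompact :: "'x::metric_space itself \<Rightarrow> bool" where
  "Isom_cocompact _ \<longleftrightarrow>
     (\<exists>K::'x set. compact K \<and> (\<Union>f\<in>carrier Isom. f ` K) = UNIV)"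

definition elementary :: "('x::metric_space \<Rightarrow> 'x) set \<Rightarrow> bool" where
  "elementary H \<longleftrightarrow>
     (\<exists>K. K \<noteq> {} \<and> compact K \<and> (\<forall>h\<in>H. h ` K = K)) \<or>
     (\<exists>\<xi>\<in>Gromov_boundary. \<forall>h\<in>H. boundary_map h \<xi> = \<xi>) \<or>
     (\<exists>\<xi>\<in>Gromov_boundary. \<exists>\<eta>\<in>Gromov_boundary. \<xi> \<noteq> \<eta> \<and>
        (\<forall>h\<in>H. boundary_map h ` {\<xi>, \<eta>} = {\<xi>, \<eta>}))"

section \<open>Isometric actions\<close>

definition isometric_action ::
    "('g, 'm) monoid_scheme \<Rightarrow> ('g \<Rightarrow> 'x::metric_space \<Rightarrow> 'x) \<Rightarrow> bool" where
  "isometric_action G \<rho> \<longleftrightarrow> \<rho> \<in> hom G Isom"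

definition proper_action ::
    "('g, 'm) monoid_scheme \<Rightarrow> ('g \<Rightarrow> 'x::metric_space \<Rightarrow> 'x) \<Rightarrow> bool" where
  "proper_action G \<rho> \<longleftrightarrow>
     finite (kernel G Isom \<rho>) \<and>
     subtopology Isom_topology (\<rho> ` carrier G) = discrete_topology (\<rho> ` carrier G)"

definition nonelementary_action ::
    "('g, 'm) monoid_scheme \<Rightarrow> ('g \<Rightarrow> 'x::metric_space \<Rightarrow> 'x) \<Rightarrow> bool" where
  "nonelementary_action G \<rho> \<longleftrightarrow> \<not> elementary (\<rho> ` carrier G)"

section \<open>Bounded cohomology\<close>

text \<open>
  Coefficients are given by a carrier \<open>V\<close>, a norm \<open>N\<close> on it and an action \<open>\<pi>\<close>.
  Points of \<open>\<Gamma>\<^sup>n\<^sup>+\<^sup>1\<close> are lists of length \<open>n + 1\<close> over the carrier of the group;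
  cochains vanish on all other lists, so that they are determined by their values on tuples.
\<close>

definition tuples :: "('g, 'm) monoid_scheme \<Rightarrow> nat \<Rightarrow> 'g list set" where
  "tuples G n = {t. set t \<subseteq> carrier G \<and> length t = Suc n}"

definition bounded_cochains ::
    "('g, 'm) monoid_scheme \<Rightarrow> 'v::ab_group_add set \<Rightarrow> ('v \<Rightarrow> real) \<Rightarrow> ('g \<Rightarrow> 'v \<Rightarrow> 'v)
      \<Rightarrow> nat \<Rightarrow> ('g list \<Rightarrow> 'v) set" where
  "bounded_cochains G V N \<pi> n =
     {f. (\<forall>t. t \<notin> tuples G n \<longrightarrow> f t = 0) \<and>
         (\<forall>t\<in>tuples G n. f t \<in> V) \<and>
         (\<exists>C. \<forall>t\<in>tuples G n. N (f t) \<le> C) \<and>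
         (\<forall>g\<in>carrier G. \<forall>t\<in>tuples G n. f (map (\<lambda>x. g \<otimes>\<^bsub>G\<^esub> x) t) = \<pi> g (f t))}"

definition coboundary ::
    "('g, 'm) monoid_scheme \<Rightarrow> nat \<Rightarrow> ('g list \<Rightarrow> 'v::ab_group_add) \<Rightarrow> 'g list \<Rightarrow> 'v" where
  "coboundary G n f t =
     (if t \<in> tuples G (Suc n)
      then \<Sum>i\<le>Suc n. (if even i then id else uminus) (f (take i t @ drop (Suc i) t))
      else 0)"

definition bounded_cocycles ::
    "('g, 'm) monoid_scheme \<Rightarrow> 'v::ab_group_add set \<Rightarrow> ('v \<Rightarrow> real) \<Rightarrow> ('g \<Rightarrow> 'v \<Rightarrow> 'v)
      \<Rightarrow> nat \<Rightarrow> ('g list \<Rightarrow> 'v) set" where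
  "bounded_cocycles G V N \<pi> n = {f \<in> bounded_cochains G V N \<pi> n. coboundary G n f = 0}"

definition bounded_coboundaries ::
    "('g, 'm) monoid_scheme \<Rightarrow> 'v::ab_group_add set \<Rightarrow> ('v \<Rightarrow> real) \<Rightarrow> ('g \<Rightarrow> 'v \<Rightarrow> 'v)
      \<Rightarrow> nat \<Rightarrow> ('g list \<Rightarrow> 'v) set" where
  "bounded_coboundaries G V N \<pi> n =
     (case n of 0 \<Rightarrow> {0} | Suc m \<Rightarrow> coboundary G m ` bounded_cochains G V N \<pi> m)"

definition bounded_cohomology ::
    "('g, 'm) monoid_scheme \<Rightarrow> 'v::ab_group_add set \<Rightarrow> ('v \<Rightarrow> real) \<Rightarrow> ('g \<Rightarrow> 'v \<Rightarrow> 'v)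
      \<Rightarrow> nat \<Rightarrow> ('g list \<Rightarrow> 'v) set monoid" where
  "bounded_cohomology G V N \<pi> n =
     \<lparr>carrier = bounded_cocycles G V N \<pi> n, mult = (+), one = 0\<rparr>
       Mod bounded_coboundaries G V N \<pi> n"

section \<open>The regular representation\<close>

text \<open>Elements of \<open>\<ell>\<^sup>2(\<Gamma>)\<close> are extended by zero outside the carrier.\<close>

definition ell2 :: "('g, 'm) monoid_scheme \<Rightarrow> ('g \<Rightarrow> complex) set" where
  "ell2 G = {v. (\<forall>x. x \<notin> carrier G \<longrightarrow> v x = 0) \<and>
                (\<lambda>x. (cmod (v x))\<^sup>2) summable_on carrier G}"

definition ell2_norm :: "('g, 'm) monoid_scheme \<Rightarrow> ('g \<Rightarrow> complex) \<Rightarrow> real" where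
  "ell2_norm G v = sqrt (\<Sum>\<^sub>\<infinity>x\<in>carrier G. (cmod (v x))\<^sup>2)"

definition left_regular ::
    "('g, 'm) monoid_scheme \<Rightarrow> 'g \<Rightarrow> ('g \<Rightarrow> complex) \<Rightarrow> 'g \<Rightarrow> complex" where
  "left_regular G g v x = (if x \<in> carrier G then v (inv\<^bsub>G\<^esub> g \<otimes>\<^bsub>G\<^esub> x) else 0)"

definition class_C_reg :: "('g, 'm) monoid_scheme \<Rightarrow> bool" where
  "class_C_reg G \<longleftrightarrow> group G \<and> countable (carrier G) \<and>
     (let H = bounded_cohomology G (ell2 G) (ell2_norm G) (left_regular G) 2
      in carrier H \<noteq> {\<one>\<^bsub>H\<^esub>})"

end

theory Submission
  imports Defs
begin

text \<open>
  Let \<open>d x y\<close> be the distance of the orbit points \<open>x p\<close> and \<open>y p\<close>: a hyperbolic left-invariant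
  pseudometric on the group with finite balls. Let \<open>f\<close> and \<open>k\<close> be bump functions on disjoint shadows,
  Hoelder for the visual metric seen from \<open>1\<close>, and put \<open>\<phi> x y = f x * k y - f y * k x\<close>. The map sending
  \<open>(x, y)\<close> to the function \<open>g \<mapsto> \<phi> (inv g * x) (inv g * y)\<close> is equivariant, and its coboundary is bounded in
  square norm: at \<open>g\<close> it vanishes unless \<open>g\<close> is near a side of the triangle \<open>xyz\<close>, and it decays
  exponentially with the distance of \<open>g\<close> from the centre.

  If this 2-cocycle were the coboundary of a bounded cochain, there would be \<open>F\<close> on the group such that
  the sum over \<open>x\<close> of \<open>|\<phi> x (x h) - F x + F (x h)|\<^sup>2\<close> is bounded uniformly in \<open>h\<close>. A non-elementary group
  contains a loxodromic \<open>a\<close> and a conjugate \<open>b\<close> of \<open>a\<close> without common endpoints; centre \<open>f\<close> at the repelling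
  point of \<open>a\<close> and \<open>k\<close> at the attracting point of \<open>b\<close>. By discreteness \<open>\<phi>\<close> vanishes on all pairs
  \<open>(z, z a^n)\<close> once the shadows are small, so \<open>F\<close> has the same limit at both ends of \<open>a\<close>, and
  likewise for \<open>b\<close>. Evaluating along \<open>h = (A^n b^n)^k\<close> for \<open>A = a\<close> and \<open>A = inv a\<close> shows that \<open>\<phi>\<close> at the
  repelling point of \<open>a\<close> and at the attracting one, paired with the attracting point of \<open>b\<close>, must both equal
  the difference of the two limits; but the first value is positive and the second is zero.
\<close>

section \<open>Hyperbolic pseudometrics\<close>

text \<open>Only a pseudometric, since different group elements may move the base point alike; and
  on the whole type, since the orbit distance makes sense for every element of it. Positivity of
  \<open>\<delta>\<close> allows dividing by it in \<open>closeness\<close>.\<close>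

locale hyperbolic_pseudometric =
  fixes d :: "'a \<Rightarrow> 'a \<Rightarrow> real" and \<delta> :: real
  assumes d_self [simp]: "d x x = 0"
    and d_sym: "d x y = d y x"
    and d_triangle: "d x z \<le> d x y + d y z"
    and delta_pos: "\<delta> > 0"
    and hyperbolic: "min ((d p x + d p y - d x y) / 2) ((d p y + d p z - d y z) / 2)
                       \<le> (d p x + d p z - d x z) / 2 + \<delta>"
begin

definition gp :: "'a \<Rightarrow> 'a \<Rightarrow> 'a \<Rightarrow> real" where
  "gp p x y = (d p x + d p y - d x y) / 2"

lemma d_nonneg: "0 \<le> d x y"
  using d_triangle[of x x y] d_sym[of x y] by simp

lemma gp_commute: "gp p x y = gp p y x"
  by (simp add: gp_def d_sym[of x y])

lemma gp_nonneg: "0 \<le> gp p x y"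
  using d_triangle[of x y p] d_sym[of x p] by (simp add: gp_def)

lemma gp_le_dist: "gp p x y \<le> d p x"
  using d_triangle[of p y x] by (simp add: gp_def)

lemma gp_le_dist2: "gp p x y \<le> d p y"
  using gp_le_dist[of p y x] gp_commute by simp

lemma gp_add: "gp x y z + gp y x z = d x y"
  by (simp add: gp_def d_sym[of y x] field_simps)

lemma gp_hyp: "min (gp p x y) (gp p y z) \<le> gp p x z + \<delta>"
  using hyperbolic[of p x y z] by (simp add: gp_def)

lemma gp_hypD: "gp p x y \<le> gp p x z + \<delta> \<or> gp p y z \<le> gp p x z + \<delta>"
  using gp_hyp[of p x y z] by linarith

lemma gp_base: "gp p x y \<le> gp q x y + d p q"
  using d_triangle[of p x q] d_triangle[of p y q] by (simp add: gp_def field_simps)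

lemma gp_lipschitz: "gp p x y \<le> gp p x' y + d x x'"
  using d_triangle[of p x x'] d_triangle[of x' y x] d_sym[of x x'] by (simp add: gp_def field_simps)

lemma gp_lipschitz2: "gp p y x \<le> gp p y x' + d x x'"
  using gp_lipschitz[of p x y x'] by (simp add: gp_commute)

section \<open>Points near the centre or a side of a triangle\<close>

lemma centre_unique:
  assumes "gp q x y \<le> D" "gp q y z \<le> D" "gp q x z \<le> D"
    and "gp q' x y \<le> D" "gp q' y z \<le> D" "gp q' x z \<le> D"
  shows "d q q' \<le> 2 * D + 2 * \<delta>"
proof -
  \<comment> \<open>At \<open>q\<close> at most one of the products of \<open>q'\<close> with
    \<open>x\<close>, \<open>y\<close>, \<open>z\<close> exceeds \<open>D + \<delta>\<close>, and
    likewise at \<open>q'\<close> for \<open>q\<close>. So some vertex has both products small, and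
    these two add up to \<open>d q q'\<close>.\<close>
  note q = gp_hypD[of q x q' y] gp_hypD[of q y q' z] gp_hypD[of q x q' z]
  note q' = gp_hypD[of q' x q y] gp_hypD[of q' y q z] gp_hypD[of q' x q z]
  show ?thesis
    using q q' assms gp_add[of q q' x] gp_add[of q q' y] gp_add[of q q' z]
      gp_commute[of q q'] gp_commute[of q' q]
    by (smt (verit))
qed

text \<open>If \<open>gp q x q'\<close> or \<open>gp q' x q\<close> is at most
  \<open>D + \<delta>\<close>, the nearly equal distances from \<open>x\<close> bound
  \<open>d q q'\<close>. Otherwise hyperbolicity makes both products with \<open>y\<close> small,
  and these add up to \<open>d q q'\<close>.\<close>

lemma side_point_unique:
  assumes "gp q x y \<le> D" "gp q' x y \<le> D" "\<bar>d x q - d x q'\<bar> \<le> l"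
  shows "d q q' \<le> l + 2 * D + 2 * \<delta>"
proof -
  have "2 * gp q x q' = d x q + d q q' - d x q'" "2 * gp q' x q = d x q' + d q q' - d x q"
    by (simp_all add: gp_def d_sym)
  moreover have "0 \<le> D" "0 \<le> l"
    using assms gp_nonneg[of q x y] by linarith+
  ultimately show ?thesis
    using gp_hypD[of q x q' y] gp_hypD[of q' x q y] assms gp_add[of q q' y]
      gp_commute[of q q' y] gp_commute[of q' q y] delta_pos
    by linarith
qed

text \<open>
  A point close to the side \<open>xy\<close> of a triangle is determined, up to bounded error, by its
  distance to the centre, which \<open>gp q x z\<close> measures on the half of the side next to \<open>y\<close>.
\<close>

lemma side_point_unique_centre:
  assumes q: "gp q x y \<le> D" "n \<le> gp q x z" "gp q x z \<le> n + 1" "gp q y z \<le> gp q x z"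
    and q': "gp q' x y \<le> D" "n \<le> gp q' x z" "gp q' x z \<le> n + 1" "gp q' y z \<le> gp q' x z"
    and D: "0 \<le> D"
  shows "d q q' \<le> 2 * D + 10 * \<delta> + 2"
\<comment> \<open>For small \<open>n\<close> all three products at both points are at most
  \<open>D + 3 * \<delta> + 1\<close>, so both points are near the centre.\<close>
proof (cases "n \<le> D + 3 * \<delta>")
  case True
  with assms have "d q q' \<le> 2 * (D + 3 * \<delta> + 1) + 2 * \<delta>"
    using delta_pos by (intro centre_unique[of q x y _ z q']) linarith+
  then show ?thesis
    using delta_pos by simp
next
  case False
  \<comment> \<open>A large \<open>gp s x z\<close> and a small \<open>gp s x s'\<close> force a
    small \<open>gp s s' z\<close>. Moving from \<open>s\<close> to \<open>s'\<close> then adds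
    nearly all of \<open>d s s'\<close> to the product of \<open>x\<close> and \<open>z\<close>,
    which may grow by at most 1.\<close>
  have key: "d s s' \<le> 2 * D + 3 * \<delta> + 1"
    if "gp s x s' \<le> D + \<delta>" "n \<le> gp s x z" "gp s' x z \<le> n + 1" for s s'
  proof -
    have "gp s s' z \<le> D + 2 * \<delta>"
      using gp_hypD[of s x z s'] that False delta_pos gp_commute[of s] by (smt (verit))
    moreover have "gp s' x z = gp s x z + d s s' - gp s x s' - gp s s' z"
      by (simp add: gp_def d_sym field_simps)
    ultimately show ?thesis
      using that by linarith
  qed
  consider "gp q x q' \<le> D + \<delta>" | "gp q' x q \<le> D + \<delta>"
    | "gp q q' y \<le> D + \<delta>" "gp q' q y \<le> D + \<delta>"
    using gp_hypD[of q x q' y] gp_hypD[of q' x q y] q q' by linarith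
  then have "d q q' \<le> 2 * D + 3 * \<delta> + 1"
    using key[of q q'] key[of q' q] q q' gp_add[of q q' y] delta_pos d_sym[of q q']
    by cases linarith+
  then show ?thesis
    using delta_pos by linarith
qed

text \<open>A discrete intermediate value argument: distances from \<open>x 0\<close> grow by at
  most \<open>l\<close> per step, so some \<open>x m\<close> is as far from \<open>x 0\<close> as
  \<open>q\<close> is, up to \<open>l\<close>, and \<open>side_point_unique\<close> compares the
  two.\<close>

lemma quasigeodesic_passes_near:
  fixes x :: "nat \<Rightarrow> 'a"
  assumes step: "\<And>m. d (x m) (x (Suc m)) \<le> l"
    and qg: "\<And>m. m \<le> n \<Longrightarrow> gp (x m) (x 0) (x n) \<le> D"
    and q: "gp q (x 0) (x n) \<le> D"
  shows "\<exists>m\<le>n. d q (x m) \<le> l + 2 * D + 2 * \<delta>"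
proof (cases "d (x 0) q \<le> d (x 0) (x n)")
  case False
  have "d q (x n) \<le> 2 * D"
    using q False d_sym by (simp add: gp_def field_simps)
  moreover have "0 \<le> l"
    using step[of 0] d_nonneg[of "x 0" "x (Suc 0)"] by linarith
  ultimately show ?thesis
    using delta_pos by (intro exI[of _ n]) simp
next
  case True
  define m where "m = (LEAST m. d (x 0) q \<le> d (x 0) (x m))"
  have m: "d (x 0) q \<le> d (x 0) (x m)" "m \<le> n"
    unfolding m_def using True by (auto intro: LeastI Least_le)
  have "\<bar>d (x 0) q - d (x 0) (x m)\<bar> \<le> l"
  proof (cases m)
    case 0
    then show ?thesis
      using m step[of 0] d_nonneg[of "x 0" "x (Suc 0)"] d_nonneg[of "x 0" q] by simp
  next
    case (Suc i)
    then have "\<not> d (x 0) q \<le> d (x 0) (x i)"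
      using not_less_Least[of i "\<lambda>m. d (x 0) q \<le> d (x 0) (x m)"] m_def by simp
    then show ?thesis
      using m Suc step[of i] d_triangle[of "x 0" "x m" "x i"] by simp
  qed
  then show ?thesis
    using side_point_unique[OF q qg[OF m(2)]] m(2) by auto
qed

section \<open>Local-to-global principle for chains of points\<close>

context
  fixes x :: "nat \<Rightarrow> 'a" and C l :: real
  assumes joint: "\<And>i. gp (x (Suc i)) (x i) (x (Suc (Suc i))) \<le> C"
    and long: "\<And>i. l \<le> d (x i) (x (Suc i))"
    and large: "2 * C + 3 * \<delta> < l"
begin

lemma chain_C_nonneg: "0 \<le> C"
  using joint[of 0] gp_nonneg[of "x (Suc 0)" "x 0" "x (Suc (Suc 0))"] by linarith

text \<open>Looking back from \<open>x (Suc j)\<close>, the points \<open>x j\<close> and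
  \<open>x i\<close> lie in the same direction because the last step is long. So the bound at the
  joint passes from \<open>x j\<close> to \<open>x i\<close> at the cost of one
  \<open>\<delta>\<close>, and this cost does not accumulate.\<close>

lemma chain_forward: "i \<le> j \<Longrightarrow> gp (x j) (x i) (x (Suc j)) \<le> C + \<delta>"
proof (induction j rule: dec_induct)
  case base
  then show ?case
    using chain_C_nonneg delta_pos by (simp add: gp_def)
next
  case (step j)
  have "gp (x (Suc j)) (x j) (x i) = d (x j) (x (Suc j)) - gp (x j) (x i) (x (Suc j))"
    by (simp add: gp_def d_sym field_simps)
  then have "gp (x (Suc j)) (x j) (x i) > C + \<delta>"
    using step.IH long[of j] large delta_pos by linarith
  then show ?case
    using gp_hypD[of "x (Suc j)" "x j" "x i" "x (Suc (Suc j))"] joint[of j] by linarith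
qed

lemma chain_dist: "d (x i) (x (i + n)) \<ge> n * (l - 2 * C - 2 * \<delta>)"
proof (induction n)
  case (Suc n)
  have "d (x i) (x (Suc (i + n)))
      = d (x i) (x (i + n)) + d (x (i + n)) (x (Suc (i + n))) - 2 * gp (x (i + n)) (x i) (x (Suc (i + n)))"
    by (simp add: gp_def d_sym field_simps)
  then show ?case
    using Suc long[of "i + n"] chain_forward[of i "i + n"] by (simp add: algebra_simps)
qed simp

lemma chain_backward: "i < k \<Longrightarrow> gp (x (Suc i)) (x i) (x k) \<le> C + \<delta>"
proof (induction i rule: strict_inc_induct)
  case (base i)
  then show ?case
    using chain_C_nonneg delta_pos by (simp add: gp_def d_sym)
next
  case (step i)
  have "gp (x (Suc i)) (x (Suc (Suc i))) (x k)
      = d (x (Suc i)) (x (Suc (Suc i))) - gp (x (Suc (Suc i))) (x (Suc i)) (x k)"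
    by (simp add: gp_def d_sym field_simps)
  then have "gp (x (Suc i)) (x (Suc (Suc i))) (x k) > C + \<delta>"
    using step.IH long[of "Suc i"] large delta_pos by linarith
  then show ?case
    using gp_hypD[of "x (Suc i)" "x i" "x k" "x (Suc (Suc i))"] joint[of i]
      gp_commute[of "x (Suc i)" "x k" "x (Suc (Suc i))"] by linarith
qed

text \<open>Seen from \<open>x j\<close>, the point \<open>x k\<close> lies in the direction of
  \<open>x (Suc j)\<close>, to which \<open>chain_forward\<close> applies.\<close>

lemma chain_quasigeodesic:
  assumes "i \<le> j" "j \<le> k"
  shows "gp (x j) (x i) (x k) \<le> C + 2 * \<delta>"
proof (cases "j = k")
  case True
  then show ?thesis
    using chain_C_nonneg delta_pos by (simp add: gp_def d_sym)
next
  case False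
  have "gp (x j) (x k) (x (Suc j)) = d (x j) (x (Suc j)) - gp (x (Suc j)) (x j) (x k)"
    by (simp add: gp_def d_sym field_simps)
  then have "gp (x j) (x k) (x (Suc j)) > C + 2 * \<delta>"
    using chain_backward[of j k] False assms long[of j] large by linarith
  then show ?thesis
    using gp_hypD[of "x j" "x i" "x k" "x (Suc j)"] chain_forward[of i j] assms
    by (smt (verit))
qed

end

section \<open>Frink's chain metric and bump functions on shadows\<close>

lemma frink_chain:
  fixes q :: "'b \<Rightarrow> 'b \<Rightarrow> real" and w :: "nat \<Rightarrow> 'b"
  assumes pos: "\<And>x y. 0 < q x y"
    and ultra: "\<And>x y z. q x z \<le> sqrt 2 * max (q x y) (q y z)"
  shows "i < j \<Longrightarrow> q (w i) (w j) \<le> 2 * (\<Sum>l=i..<j. q (w l) (w (Suc l)))"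
proof (induction "j - i" arbitrary: i j rule: less_induct)
  case less
  let ?s = "\<lambda>i j. \<Sum>l=i..<j. q (w l) (w (Suc l))"
  define S where "S = ?s i j"
  have S: "0 < S"
    unfolding S_def using less.prems pos by (intro sum_pos) auto
  \<comment> \<open>\<open>m\<close> is the first index at which the partial sum exceeds half of
    \<open>S\<close>. The parts before and after the edge from \<open>w m\<close> to
    \<open>w (Suc m)\<close> carry at most \<open>S / 2\<close> each, so by induction
    \<open>q\<close> is at most \<open>S\<close> on each of the three pieces. Joining them uses
    \<open>ultra\<close> twice, which costs the factor 2.\<close>
  define P where "P = (\<lambda>m. i \<le> m \<and> S / 2 < ?s i (Suc m))"
  define m where "m = (LEAST m. P m)"
  have "P (j - 1)"
    using less.prems S by (auto simp: S_def P_def simp del: sum.op_ivl_Suc)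
  then have "P m" "m \<le> j - 1"
    unfolding m_def by (auto intro: LeastI Least_le)
  then have m: "i \<le> m" "S / 2 < ?s i (Suc m)" and mj: "m < j"
    using less.prems by (auto simp: P_def simp del: sum.op_ivl_Suc)
  have split: "S = ?s i m + q (w m) (w (Suc m)) + ?s (Suc m) j"
  proof -
    have "S = ?s i m + ?s m j"
      using m(1) mj unfolding S_def by (intro sum.atLeastLessThan_concat[symmetric]) auto
    also have "?s m j = q (w m) (w (Suc m)) + ?s (Suc m) j"
      using mj by (intro sum.atLeast_Suc_lessThan)
    finally show ?thesis by simp
  qed
  have nonneg: "0 \<le> ?s a b" for a b
    using pos by (intro sum_nonneg) (auto intro: less_imp_le)
  have left: "q (w i) (w m) \<le> S" if "i < m"
  proof -
    obtain m' where m': "m = Suc m'" using \<open>i < m\<close> by (cases m) auto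
    have "\<not> S / 2 < ?s i (Suc m')"
      using not_less_Least[of m' P, folded m_def] m' that by (auto simp: P_def simp del: sum.op_ivl_Suc)
    moreover have "q (w i) (w m) \<le> 2 * ?s i m"
      using that mj by (intro less.hyps) auto
    ultimately show ?thesis by (simp add: m')
  qed
  have right: "q (w (Suc m)) (w j) \<le> S" if "Suc m < j"
  proof -
    have "q (w (Suc m)) (w j) \<le> 2 * ?s (Suc m) j"
      using that m by (intro less.hyps) auto
    moreover have "?s i (Suc m) = ?s i m + q (w m) (w (Suc m))"
      using m(1) by simp
    ultimately show ?thesis using m(2) split by linarith
  qed
  have mid: "q (w m) (w (Suc m)) \<le> S"
    using split nonneg[of i m] nonneg[of "Suc m" j] by linarith
  have one: "x \<le> sqrt 2 * S" if "x \<le> S" for x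
    using that S mult_right_mono[of 1 "sqrt 2" S] by (simp add: order_trans)
  have "q (w i) (w (Suc m)) \<le> sqrt 2 * S"
  proof (cases "i = m")
    case False
    then have "max (q (w i) (w m)) (q (w m) (w (Suc m))) \<le> S"
      using left mid m(1) by auto
    then show ?thesis
      using ultra[of "w i" "w (Suc m)" "w m"] by (meson mult_left_mono order_trans real_sqrt_ge_zero zero_le_numeral)
  qed (use mid one in auto)
  moreover have "q (w i) (w j) \<le> sqrt 2 * (sqrt 2 * S)" if "Suc m < j"
  proof -
    have "max (q (w i) (w (Suc m))) (q (w (Suc m)) (w j)) \<le> sqrt 2 * S"
      using calculation right[OF that] one by auto
    then show ?thesis
      using ultra[of "w i" "w j" "w (Suc m)"] by (meson mult_left_mono order_trans real_sqrt_ge_zero zero_le_numeral)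
  qed
  moreover have "sqrt 2 * (sqrt 2 * S) = 2 * S" "sqrt 2 * S \<le> 2 * S"
    using S by (simp_all add: sqrt2_less_2 less_imp_le)
  ultimately have "q (w i) (w j) \<le> 2 * S"
    using mj by (cases "Suc m = j") auto
  then show ?case by (simp add: S_def)
qed

text \<open>The visual quasimetric seen from \<open>p\<close>. With the denominator
  \<open>2 * \<delta>\<close> an error \<open>\<delta>\<close> in \<open>gp\<close> costs the factor
  \<open>sqrt 2\<close>, the constant of \<open>frink_chain\<close>. The value is positive even for
  \<open>x = y\<close>.\<close>

definition closeness :: "'a \<Rightarrow> 'a \<Rightarrow> 'a \<Rightarrow> real" where
  "closeness p x y = 2 powr (- gp p x y / (2 * \<delta>))"

lemma closeness_ultra: "closeness p x z \<le> sqrt 2 * max (closeness p x y) (closeness p y z)"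
proof -
  have *: "2 powr (- c / (2 * \<delta>)) \<le> sqrt 2 * 2 powr (- b / (2 * \<delta>))" if "b \<le> c + \<delta>" for b c
  proof -
    have "- c / (2 * \<delta>) \<le> 1 / 2 + - b / (2 * \<delta>)"
      using that delta_pos by (simp add: field_simps)
    then have "2 powr (- c / (2 * \<delta>)) \<le> 2 powr (1 / 2 + - b / (2 * \<delta>))"
      by (intro powr_mono) simp_all
    also have "\<dots> = sqrt 2 * 2 powr (- b / (2 * \<delta>))"
      by (simp only: powr_add) (simp add: powr_half_sqrt)
    finally show ?thesis .
  qed
  show ?thesis
    using gp_hypD[of p x y z]
  proof
    assume "gp p x y \<le> gp p x z + \<delta>"
    from *[OF this] show ?thesis
      unfolding closeness_def by (rule order_trans) simp
  next
    assume "gp p y z \<le> gp p x z + \<delta>"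
    from *[OF this] show ?thesis
      unfolding closeness_def by (rule order_trans) simp
  qed
qed

text \<open>
  Shadows \<open>{x. T \<le> gp p x u}\<close> have no continuous indicator functions, since \<open>gp\<close> is only
  coarsely continuous; the chain pseudometric of \<open>closeness\<close> replaces it.
\<close>

lemma shadow_bump:
  obtains f :: "'a \<Rightarrow> real" and C
  where "\<And>x. 0 \<le> f x" "\<And>x. f x \<le> 1" "\<And>x y. \<bar>f x - f y\<bar> \<le> C * closeness p x y"
    "\<And>x. T \<le> gp p x u \<Longrightarrow> 1 / 2 \<le> f x" "\<And>x. f x \<noteq> 0 \<Longrightarrow> T - 4 * \<delta> < gp p x u" "0 \<le> C"
proof -
  let ?q = "closeness p"
  \<comment> \<open>The condition \<open>0 < n\<close> excludes the empty chain at
    \<open>x = u\<close>, whose sum 0 would violate \<open>lower\<close>.\<close>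
  define chain_sums where "chain_sums = (\<lambda>x. {(\<Sum>l<n. ?q (w l) (w (Suc l))) | w n. w 0 = x \<and> w n = u \<and> 0 < n})"
  define D where "D x = Inf (chain_sums x)" for x
  \<comment> \<open>The factor 2 makes \<open>f\<close> at least \<open>1 / 2\<close> on the shadow
    of depth \<open>T\<close>. On the support \<open>closeness\<close> is below
    \<open>2 * r\<close>, four times its value at depth \<open>T\<close>; this is the loss of
    \<open>4 * \<delta>\<close>.\<close>
  define r where "r = 2 * 2 powr (- T / (2 * \<delta>))"
  have r: "0 < r" by (simp add: r_def)
  have pos: "0 < ?q x y" for x y by (simp add: closeness_def)
  have lower: "?q x u / 2 \<le> s" if "s \<in> chain_sums x" for s x
  proof -
    from that obtain w n where "w 0 = x" "w n = u" "0 < n" "s = (\<Sum>l<n. ?q (w l) (w (Suc l)))"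
      by (auto simp: chain_sums_def)
    then show ?thesis
      using frink_chain[of ?q 0 n w, OF pos closeness_ultra] by (simp add: atLeast0LessThan)
  qed
  have bdd: "bdd_below (chain_sums x)" for x
    using lower by (rule bdd_belowI)
  have direct: "?q x u \<in> chain_sums x" for x
    unfolding chain_sums_def by (rule CollectI, rule exI[of _ "\<lambda>n. if n = 0 then x else u"], rule exI[of _ 1]) simp
  have upper: "D x \<le> ?q x u" for x
    unfolding D_def by (rule cInf_lower[OF direct bdd])
  have half: "?q x u / 2 \<le> D x" for x
    unfolding D_def using direct lower by (intro cInf_greatest) auto
  have "D x - ?q x y \<le> D y" for x y
    unfolding D_def[of y]
  proof (rule cInf_greatest)
    fix s assume "s \<in> chain_sums y"
    then obtain w n where w: "w 0 = y" "w n = u" "s = (\<Sum>l<n. ?q (w l) (w (Suc l)))"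
      by (auto simp: chain_sums_def)
    \<comment> \<open>Prepending \<open>x\<close> to chains from \<open>y\<close> shows that
      \<open>D\<close> changes by at most \<open>closeness p x y\<close>.\<close>
    have "(\<Sum>l<Suc n. ?q (case_nat x w l) (case_nat x w (Suc l))) \<in> chain_sums x"
      unfolding chain_sums_def using w by (intro CollectI exI[of _ "case_nat x w"] exI[of _ "Suc n"]) simp
    moreover have "(\<Sum>l<Suc n. ?q (case_nat x w l) (case_nat x w (Suc l))) = ?q x y + s"
      using w by (simp add: sum.lessThan_Suc_shift del: sum.lessThan_Suc)
    ultimately have "D x \<le> ?q x y + s"
      unfolding D_def using cInf_lower[OF _ bdd] by metis
    then show "D x - ?q x y \<le> s" by simp
  qed (use direct in auto)
  then have lip: "\<bar>D x - D y\<bar> \<le> ?q x y" for x y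
    by (smt (verit) closeness_def gp_commute)
  define f where "f x = max 0 (1 - D x / r)" for x
  show thesis
  proof (rule that[of f "1 / r"])
    fix x y
    have "\<bar>f x - f y\<bar> \<le> \<bar>D x / r - D y / r\<bar>"
      by (simp add: f_def)
    also have "\<dots> = \<bar>D x - D y\<bar> / r"
      using r by (simp add: diff_divide_distrib[symmetric])
    also have "\<dots> \<le> ?q x y / r"
      using lip r by (intro divide_right_mono) auto
    finally show "\<bar>f x - f y\<bar> \<le> 1 / r * ?q x y" by simp
  next
    fix x
    have "0 \<le> D x" using half[of x] pos[of x u] by linarith
    then show "f x \<le> 1" using r by (simp add: f_def)
  next
    fix x assume "T \<le> gp p x u"
    then have "?q x u \<le> r / 2"
      using delta_pos by (simp add: closeness_def r_def divide_right_mono)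
    then have "D x / r \<le> 1 / 2" using upper[of x] r by (simp add: field_simps)
    then show "1 / 2 \<le> f x" unfolding f_def by linarith
  next
    fix x assume "f x \<noteq> 0"
    then have "D x < r" using r by (auto simp: f_def max_def field_simps split: if_splits)
    then have "?q x u < 2 * r" using half[of x] by linarith
    also have "2 * r = 2 powr (- (T - 4 * \<delta>) / (2 * \<delta>))"
    proof -
      have "- (T - 4 * \<delta>) / (2 * \<delta>) = 2 + - T / (2 * \<delta>)"
        using delta_pos by (simp add: field_simps)
      then have "2 powr (- (T - 4 * \<delta>) / (2 * \<delta>)) = 2 powr 2 * 2 powr (- T / (2 * \<delta>))"
        by (simp only: powr_add)
      then show ?thesis by (simp add: r_def)
    qed
    finally have "- gp p x u / (2 * \<delta>) < - (T - 4 * \<delta>) / (2 * \<delta>)"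
      unfolding closeness_def by (subst (asm) powr_less_cancel_iff) auto
    then show "T - 4 * \<delta> < gp p x u"
      using delta_pos by (simp only: divide_less_cancel) linarith
  qed (use r in \<open>auto simp: f_def\<close>)
qed

section \<open>Sequences with a common limit at infinity\<close>

definition coterminal :: "'a \<Rightarrow> (nat \<Rightarrow> 'a) \<Rightarrow> (nat \<Rightarrow> 'a) \<Rightarrow> bool" where
  "coterminal p u v \<longleftrightarrow> (\<forall>R. \<exists>N. \<forall>i\<ge>N. \<forall>j\<ge>N. R \<le> gp p (u i) (v j))"

lemma coterminal_sym: "coterminal p u v \<Longrightarrow> coterminal p v u"
  unfolding coterminal_def by (subst gp_commute) blast

lemma coterminal_trans:
  assumes "coterminal p u v" "coterminal p v w"
  shows "coterminal p u w"
  unfolding coterminal_def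
proof
  fix R
  obtain N N' where N: "\<And>i j. N \<le> i \<Longrightarrow> N \<le> j \<Longrightarrow> R + \<delta> \<le> gp p (u i) (v j)"
      "\<And>i j. N' \<le> i \<Longrightarrow> N' \<le> j \<Longrightarrow> R + \<delta> \<le> gp p (v i) (w j)"
    using assms unfolding coterminal_def by meson
  have "R \<le> gp p (u i) (w j)" if "i \<ge> max N N'" "j \<ge> max N N'" for i j
    using gp_hypD[of p "u i" "v (max N N')" "w j"] N(1)[of i "max N N'"] N(2)[of "max N N'" j] that
    by auto
  then show "\<exists>N. \<forall>i\<ge>N. \<forall>j\<ge>N. R \<le> gp p (u i) (w j)"
    by blast
qed

lemma coterminal_close:
  assumes "coterminal p u v" and close: "\<And>n. d (u n) (u' n) \<le> K"
  shows "coterminal p u' v"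
  unfolding coterminal_def
proof
  fix R
  obtain N where "\<And>i j. N \<le> i \<Longrightarrow> N \<le> j \<Longrightarrow> R + K \<le> gp p (u i) (v j)"
    using assms(1) unfolding coterminal_def by meson
  then have "R \<le> gp p (u' i) (v j)" if "N \<le> i" "N \<le> j" for i j
    using gp_lipschitz[of p "u i" "v j" "u' i"] close[of i] that by fastforce
  then show "\<exists>N. \<forall>i\<ge>N. \<forall>j\<ge>N. R \<le> gp p (u' i) (v j)"
    by blast
qed

text \<open>\<open>coterminal p u u\<close> says that \<open>u\<close> converges to a boundary
  point. One pair far out with small product is enough: convergence of both sequences carries the
  bound to all pairs beyond \<open>M\<close>, and a product with an earlier point is bounded by the
  distance of that point from \<open>p\<close>.\<close>

lemma not_coterminal_bound:
  assumes u: "coterminal p u u" and v: "coterminal p v v" and "\<not> coterminal p u v"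
  obtains B where "\<And>i j. gp p (u i) (v j) \<le> B"
proof -
  obtain R where R: "\<And>N. \<exists>i\<ge>N. \<exists>j\<ge>N. gp p (u i) (v j) < R"
    using assms(3) unfolding coterminal_def by (meson not_le)
  obtain N N' where N: "\<And>i j. N \<le> i \<Longrightarrow> N \<le> j \<Longrightarrow> R + 3 * \<delta> \<le> gp p (u i) (u j)"
      "\<And>i j. N' \<le> i \<Longrightarrow> N' \<le> j \<Longrightarrow> R + 3 * \<delta> \<le> gp p (v i) (v j)"
    using u v unfolding coterminal_def by meson
  define M where "M = max N N'"
  obtain k l where kl: "k \<ge> M" "l \<ge> M" "gp p (u k) (v l) < R"
    using R by blast
  have far: "gp p (u i) (v j) \<le> R + 2 * \<delta>" if "M \<le> i" "M \<le> j" for i j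
    using gp_hypD[of p "u k" "u i" "v l"] gp_hypD[of p "u i" "v j" "v l"]
      N(1)[of k i] N(2)[of j l] kl that delta_pos unfolding M_def by fastforce
  define B where "B = \<bar>R\<bar> + 2 * \<delta> + (\<Sum>i<M. d p (u i)) + (\<Sum>i<M. d p (v i))"
  have nonneg: "0 \<le> (\<Sum>i<M. d p (w i))" for w
    by (simp add: sum_nonneg d_nonneg)
  have near: "d p (w i) \<le> (\<Sum>i<M. d p (w i))" if "i < M" for i and w :: "nat \<Rightarrow> 'a"
    using that by (intro member_le_sum) (auto simp: d_nonneg)
  have "gp p (u i) (v j) \<le> B" for i j
    using far[of i j] near[of i u] near[of j v] nonneg[of u] nonneg[of v]
      gp_le_dist[of p "u i" "v j"] gp_le_dist2[of p "u i" "v j"] delta_pos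
    unfolding B_def by (smt (verit) not_le)
  then show thesis by (rule that)
qed

end

section \<open>Groups with a hyperbolic left-invariant pseudometric\<close>

context group
begin

text \<open>The prefixes of the word \<open>P Q P Q ...\<close> form the chain to which the
  local-to-global principle is applied. Prefixes of odd length are used as well as the powers of
  \<open>P \<otimes> Q\<close>.\<close>

primrec alternating :: "'a \<Rightarrow> 'a \<Rightarrow> nat \<Rightarrow> 'a" where
  "alternating P Q 0 = \<one>"
| "alternating P Q (Suc n) = alternating P Q n \<otimes> (if even n then P else Q)"

lemma alternating_closed [simp]:
  "P \<in> carrier G \<Longrightarrow> Q \<in> carrier G \<Longrightarrow> alternating P Q n \<in> carrier G"
  by (induction n) auto

lemma alternating_Suc_left:
  assumes "P \<in> carrier G" "Q \<in> carrier G"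
  shows "alternating P Q (Suc n) = P \<otimes> alternating Q P n"
  using assms by (induction n) (simp_all add: m_assoc)

lemma alternating_add:
  assumes "P \<in> carrier G" "Q \<in> carrier G"
  shows "alternating P Q (m + n)
    = alternating P Q m \<otimes> (if even m then alternating P Q n else alternating Q P n)"
  using assms by (induction n) (simp_all add: m_assoc)

lemma inv_alternating:
  assumes "P \<in> carrier G" "Q \<in> carrier G"
  shows "inv (alternating P Q n)
    = (if odd n then alternating (inv P) (inv Q) n else alternating (inv Q) (inv P) n)"
proof (induction n)
  case (Suc n)
  have "inv (alternating P Q (Suc n)) = inv (if even n then P else Q) \<otimes> inv (alternating P Q n)"
    using assms by (simp add: inv_mult_group)
  then show ?case
    using assms Suc by (simp add: alternating_Suc_left del: alternating.simps(2))
qed simp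

lemma alternating_double:
  assumes "P \<in> carrier G" "Q \<in> carrier G"
  shows "alternating P Q (2 * n) = (P \<otimes> Q) [^] n"
  using assms by (induction n) (simp_all add: m_assoc)

lemma conj_pow:
  assumes "y \<in> carrier G" "a \<in> carrier G"
  shows "(y \<otimes> a \<otimes> inv y) [^] (n :: nat) = y \<otimes> a [^] n \<otimes> inv y"
proof (induction n)
  case (Suc n)
  have "y \<otimes> a [^] n \<otimes> inv y \<otimes> (y \<otimes> a \<otimes> inv y) = y \<otimes> a [^] n \<otimes> (inv y \<otimes> y) \<otimes> a \<otimes> inv y"
    using assms by (simp only: m_assoc m_closed inv_closed nat_pow_closed)
  then show ?case
    using Suc assms by (simp add: m_assoc)
qed (use assms in simp)

end

locale hyperbolic_group = group G + hyperbolic_pseudometric d \<delta>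
  for G :: "('g, 'm) monoid_scheme" (structure) and d :: "'g \<Rightarrow> 'g \<Rightarrow> real" and \<delta> +
  assumes d_left: "\<lbrakk>g \<in> carrier G; x \<in> carrier G; y \<in> carrier G\<rbrakk> \<Longrightarrow> d (g \<otimes> x) (g \<otimes> y) = d x y"
    and finite_ball: "finite {x \<in> carrier G. d \<one> x \<le> R}"
begin

lemma gp_left:
  "\<lbrakk>g \<in> carrier G; p \<in> carrier G; x \<in> carrier G; y \<in> carrier G\<rbrakk>
    \<Longrightarrow> gp (g \<otimes> p) (g \<otimes> x) (g \<otimes> y) = gp p x y"
  by (simp add: gp_def d_left)

lemma gp_one:
  "\<lbrakk>g \<in> carrier G; x \<in> carrier G; y \<in> carrier G\<rbrakk> \<Longrightarrow> gp g x y = gp \<one> (inv g \<otimes> x) (inv g \<otimes> y)"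
  using gp_left[of "inv g" g x y] by simp

lemma d_mult: "\<lbrakk>x \<in> carrier G; y \<in> carrier G\<rbrakk> \<Longrightarrow> d x (x \<otimes> y) = d \<one> y"
  using d_left[of x \<one> y] by simp

lemma d_one_inv: "x \<in> carrier G \<Longrightarrow> d \<one> (inv x) = d \<one> x"
  using d_mult[of x "inv x"] d_sym[of x \<one>] by simp

text \<open>A coarse axis, without a rate of divergence: backward and forward powers stay apart and
  run off to infinity, so they converge to two different boundary points.\<close>

definition loxodromic :: "'g \<Rightarrow> bool" where
  "loxodromic a \<longleftrightarrow> a \<in> carrier G
     \<and> (\<exists>D. \<forall>(m :: nat) (n :: nat). gp \<one> (inv a [^] m) (a [^] n) \<le> D)
     \<and> (\<forall>R. \<exists>N. \<forall>n\<ge>N. R \<le> d \<one> (a [^] (n :: nat)))"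

lemma loxodromic_closed [simp]: "loxodromic a \<Longrightarrow> a \<in> carrier G"
  by (simp add: loxodromic_def)

lemma loxodromic_bound:
  assumes "loxodromic a"
  obtains D where "\<And>(m :: nat) (n :: nat). gp \<one> (inv a [^] m) (a [^] n) \<le> D"
  using assms loxodromic_def by blast

lemma loxodromic_far: "loxodromic a \<Longrightarrow> \<exists>N. \<forall>n\<ge>N. R \<le> d \<one> (a [^] (n :: nat))"
  using loxodromic_def by blast

lemma loxodromic_inv: "loxodromic a \<Longrightarrow> loxodromic (inv a)"
proof -
  assume a: "loxodromic a"
  then obtain D where "\<And>(m :: nat) (n :: nat). gp \<one> (inv a [^] m) (a [^] n) \<le> D"
    using loxodromic_bound by blast
  then have "gp \<one> (inv (inv a) [^] m) (inv a [^] n) \<le> D" for m n :: nat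
    using a gp_commute[of \<one> "a [^] m" "inv a [^] n"] by simp
  then have "\<exists>D. \<forall>(m :: nat) (n :: nat). gp \<one> (inv (inv a) [^] m) (inv a [^] n) \<le> D"
    by blast
  moreover have "\<exists>N. \<forall>n\<ge>N. R \<le> d \<one> (inv a [^] (n :: nat))" for R
    using loxodromic_far[OF a, of R] a by (simp add: nat_pow_inv d_one_inv)
  ultimately show ?thesis
    using a unfolding loxodromic_def[of "inv a"] by simp
qed

lemma loxodromic_conj:
  assumes a: "loxodromic a" and y: "y \<in> carrier G"
  shows "loxodromic (y \<otimes> a \<otimes> inv y)"
proof -
  have [simp]: "a \<in> carrier G" using a by simp
  have close: "d (y \<otimes> g \<otimes> inv y) (y \<otimes> g) = d \<one> y" if "g \<in> carrier G" for g
    using d_mult[of "y \<otimes> g" "inv y"] that y d_one_inv[OF y] by (simp add: d_sym)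
  obtain D where D: "\<And>(m :: nat) (n :: nat). gp \<one> (inv a [^] m) (a [^] n) \<le> D"
    using loxodromic_bound[OF a] by blast
  have inv: "inv (y \<otimes> a \<otimes> inv y) = y \<otimes> inv a \<otimes> inv y"
    using y by (simp add: inv_mult_group m_assoc)
  \<comment> \<open>One \<open>d \<one> y\<close> for each of the two endpoints and one for the base
    point.\<close>
  have "gp \<one> (y \<otimes> inv a [^] m \<otimes> inv y) (y \<otimes> a [^] n \<otimes> inv y) \<le> D + 3 * d \<one> y" for m n :: nat
    using gp_lipschitz[of \<one> "y \<otimes> inv a [^] m \<otimes> inv y" "y \<otimes> a [^] n \<otimes> inv y" "y \<otimes> inv a [^] m"]
      gp_lipschitz2[of \<one> "y \<otimes> inv a [^] m" "y \<otimes> a [^] n \<otimes> inv y" "y \<otimes> a [^] n"]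
      gp_base[of \<one> "y \<otimes> inv a [^] m" "y \<otimes> a [^] n" y] gp_left[of y \<one> "inv a [^] m" "a [^] n"]
      D[of m n] close[of "a [^] n"] close[of "inv a [^] m"] y
    by simp
  then have "\<exists>D. \<forall>(m :: nat) (n :: nat). gp \<one> (y \<otimes> inv a [^] m \<otimes> inv y) (y \<otimes> a [^] n \<otimes> inv y) \<le> D"
    by blast
  moreover have "\<exists>N. \<forall>n\<ge>N. R \<le> d \<one> (y \<otimes> a [^] (n :: nat) \<otimes> inv y)" for R
  proof -
    obtain N where "\<And>n :: nat. n \<ge> N \<Longrightarrow> R + 2 * d \<one> y \<le> d \<one> (a [^] n)"
      using loxodromic_far[OF a] by meson
    moreover have "d \<one> (a [^] n) \<le> d \<one> (y \<otimes> a [^] n \<otimes> inv y) + 2 * d \<one> y" for n :: nat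
      using d_left[of y \<one> "a [^] n"] d_triangle[of y "y \<otimes> a [^] n" \<one>] y close[of "a [^] n"]
        d_triangle[of \<one> "y \<otimes> a [^] n" "y \<otimes> a [^] n \<otimes> inv y"] d_sym[of y \<one>]
      by simp
    ultimately show ?thesis
      by (meson add_le_cancel_right order_trans)
  qed
  ultimately show ?thesis
    using y unfolding loxodromic_def inv by (simp add: conj_pow)
qed

lemma inv_pow_mult_pow:
  assumes "a \<in> carrier G" "i \<le> j"
  shows "inv (a [^] (i :: nat)) \<otimes> a [^] j = a [^] (j - i)"
proof -
  have "a [^] j = a [^] i \<otimes> a [^] (j - i)"
    using assms by (simp add: nat_pow_mult)
  then show ?thesis
    using assms by (simp add: m_assoc[symmetric])
qed

lemma inv_pow_mult_pow2:
  assumes "a \<in> carrier G" "i \<le> j"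
  shows "inv (a [^] (j :: nat)) \<otimes> a [^] i = inv a [^] (j - i)"
proof -
  have "inv (inv (a [^] i) \<otimes> a [^] j) = inv (a [^] (j - i))"
    using inv_pow_mult_pow[OF assms] by simp
  then show ?thesis
    using assms by (simp add: inv_mult_group nat_pow_inv)
qed

text \<open>Left translation by \<open>inv (a [^] j)\<close> moves the middle point to
  \<open>\<one>\<close> and the outer ones to a backward and a forward power.\<close>

lemma loxodromic_middle:
  assumes a: "a \<in> carrier G" and D: "\<And>(m :: nat) (n :: nat). gp \<one> (inv a [^] m) (a [^] n) \<le> D"
    and "(i :: nat) \<le> j" "j \<le> k"
  shows "gp (a [^] j) (a [^] i) (a [^] k) \<le> D"
  using gp_one[of "a [^] j" "a [^] i" "a [^] k"] assms
  by (simp add: inv_pow_mult_pow inv_pow_mult_pow2)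

lemma loxodromic_gp_ge:
  assumes a: "a \<in> carrier G" and D: "\<And>(m :: nat) (n :: nat). gp \<one> (inv a [^] m) (a [^] n) \<le> D"
    and "(i :: nat) \<le> j"
  shows "d \<one> (a [^] i) - D \<le> gp \<one> (a [^] i) (a [^] j)"
  using loxodromic_middle[OF a D, of 0 i j] gp_add[of \<one> "a [^] i" "a [^] j"] assms by simp

lemma loxodromic_coterminal:
  assumes "loxodromic a"
  shows "coterminal \<one> (\<lambda>n. a [^] n) (\<lambda>n. a [^] n)"
  unfolding coterminal_def
proof
  fix R
  obtain D where D: "\<And>(m :: nat) (n :: nat). gp \<one> (inv a [^] m) (a [^] n) \<le> D"
    using loxodromic_bound[OF assms] by blast
  obtain N where N: "\<And>n :: nat. n \<ge> N \<Longrightarrow> R + D \<le> d \<one> (a [^] n)"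
    using loxodromic_far[OF assms] by meson
  have "R \<le> gp \<one> (a [^] i) (a [^] j)" if "i \<ge> N" "j \<ge> N" for i j
    using loxodromic_gp_ge[OF _ D, of i j] loxodromic_gp_ge[OF _ D, of j i] assms N[of i] N[of j] that
      gp_commute[of \<one> "a [^] i" "a [^] j"]
    by (cases "i \<le> j") auto
  then show "\<exists>N :: nat. \<forall>i\<ge>N. \<forall>j\<ge>N. R \<le> gp \<one> (a [^] i) (a [^] j)"
    by blast
qed

lemma coterminal_left_iff:
  assumes "z \<in> carrier G" "range u \<subseteq> carrier G" "range v \<subseteq> carrier G"
  shows "coterminal \<one> (\<lambda>n. z \<otimes> u n) (\<lambda>n. z \<otimes> v n) \<longleftrightarrow> coterminal \<one> u v"
proof -
  have *: "coterminal \<one> (\<lambda>n. z \<otimes> u n) (\<lambda>n. z \<otimes> v n)"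
    if "z \<in> carrier G" "range u \<subseteq> carrier G" "range v \<subseteq> carrier G" and uv: "coterminal \<one> u v" for z u v
    unfolding coterminal_def
  proof
    fix R
    obtain N where "\<And>i j. N \<le> i \<Longrightarrow> N \<le> j \<Longrightarrow> R + d \<one> z \<le> gp \<one> (u i) (v j)"
      using uv unfolding coterminal_def by meson
    moreover have "gp \<one> (u i) (v j) \<le> gp \<one> (z \<otimes> u i) (z \<otimes> v j) + d \<one> z" for i j
      using gp_left[of z \<one> "u i" "v j"] gp_base[of z "z \<otimes> u i" "z \<otimes> v j" \<one>] that d_sym[of z]
      by (auto simp: image_subset_iff)
    ultimately show "\<exists>N. \<forall>i\<ge>N. \<forall>j\<ge>N. R \<le> gp \<one> (z \<otimes> u i) (z \<otimes> v j)"
      by (meson add_le_cancel_right order_trans)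
  qed
  show ?thesis
    using *[OF assms] *[of "inv z" "\<lambda>n. z \<otimes> u n" "\<lambda>n. z \<otimes> v n"] assms
    by (auto simp: image_subset_iff m_assoc[symmetric])
qed

text \<open>Right multiplication by \<open>y\<close> moves every point by the same distance
  \<open>d \<one> y\<close>.\<close>

lemma coterminal_right:
  assumes "coterminal \<one> u v" "range u \<subseteq> carrier G" "y \<in> carrier G"
  shows "coterminal \<one> (\<lambda>n. u n \<otimes> y) v"
  using assms by (intro coterminal_close[OF assms(1), of _ "d \<one> y"]) (auto simp: d_mult image_subset_iff)

text \<open>
  Along the common ray, \<open>c\<close> moves points a bounded amount, so finiteness of balls gives
  coinciding conjugates of \<open>c\<close> by powers of \<open>a\<close>: some power of \<open>a\<close> commutes with \<open>c\<close>.
\<close>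

lemma loxodromic_shared_endpoint:
  assumes a: "loxodromic a" and c: "loxodromic c" and ac: "coterminal \<one> (\<lambda>n. a [^] n) (\<lambda>n. c [^] n)"
  shows "coterminal \<one> (\<lambda>n. inv a [^] n) (\<lambda>n. inv c [^] n)"
proof (rule ccontr)
  assume not: "\<not> ?thesis"
  have [simp]: "a \<in> carrier G" "c \<in> carrier G" using a c by simp_all
  obtain Da where Da: "\<And>(m :: nat) (n :: nat). gp \<one> (inv a [^] m) (a [^] n) \<le> Da"
    using loxodromic_bound[OF a] by blast
  obtain Dc where Dc: "\<And>(m :: nat) (n :: nat). gp \<one> (inv c [^] m) (c [^] n) \<le> Dc"
    using loxodromic_bound[OF c] by blast
  define D where "D = max (Da + \<delta>) Dc"
  define R where "R = d \<one> c + 2 * D + 2 * \<delta>"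
  \<comment> \<open>Seen from \<open>a [^] n\<close>, a far power of \<open>c\<close> lies in the
    direction of a far power of \<open>a\<close>, hence away from \<open>\<one>\<close>. So
    \<open>a [^] n\<close> is near the quasigeodesic formed by the powers of
    \<open>c\<close>.\<close>
  have "\<exists>m :: nat. d (a [^] n) (c [^] m) \<le> R" for n :: nat
  proof -
    obtain M :: nat where M: "\<And>i j. M \<le> i \<Longrightarrow> M \<le> j \<Longrightarrow> Da + 2 * \<delta> + d \<one> (a [^] n) \<le> gp \<one> (a [^] i) (c [^] j)"
      using ac unfolding coterminal_def by meson
    define N where "N = max M n"
    have "Da + 2 * \<delta> \<le> gp (a [^] n) (c [^] M) (a [^] N)"
      using M[of N M] gp_base[of \<one> "a [^] N" "c [^] M" "a [^] n"] gp_commute N_def by fastforce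
    moreover have "gp (a [^] n) \<one> (a [^] N) \<le> Da"
      using loxodromic_middle[OF _ Da, of 0 n N] by (simp add: N_def)
    ultimately have "gp (a [^] n) (c [^] (0 :: nat)) (c [^] M) \<le> D"
      using gp_hypD[of "a [^] n" \<one> "c [^] M" "a [^] N"] delta_pos by (simp add: D_def)
    moreover have "gp (c [^] m) (c [^] (0 :: nat)) (c [^] M) \<le> D" if "m \<le> M" for m
      using loxodromic_middle[OF _ Dc, of 0 m M] that by (simp add: D_def)
    moreover have "d (c [^] m) (c [^] Suc m) \<le> d \<one> c" for m :: nat
      by (simp add: d_mult)
    ultimately show ?thesis
      using quasigeodesic_passes_near[of "\<lambda>m. c [^] m" "d \<one> c" M D "a [^] n"] by (auto simp: R_def)
  qed
  then obtain m :: "nat \<Rightarrow> nat" where m: "\<And>n :: nat. d (a [^] n) (c [^] m n) \<le> R"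
    by metis
  \<comment> \<open>\<open>c\<close> moves each of its own powers by \<open>d \<one> c\<close>, and
    \<open>a [^] n\<close> is within \<open>R\<close> of one of them, so the conjugates
    \<open>w n\<close> stay in a finite ball.\<close>
  define w where "w n = inv (a [^] n) \<otimes> c \<otimes> a [^] n" for n :: nat
  have "d \<one> (w n) \<le> d \<one> c + 2 * R" for n
  proof -
    have "d \<one> (w n) = d (a [^] n) (c \<otimes> a [^] n)"
      using d_left[of "a [^] n" \<one> "w n"] by (simp add: w_def m_assoc[symmetric])
    moreover have "d (c [^] m n) (c \<otimes> c [^] m n) = d \<one> c"
      using d_mult[of "c [^] m n" c] by (simp add: nat_pow_Suc2[symmetric])
    moreover have "d (c \<otimes> c [^] m n) (c \<otimes> a [^] n) \<le> R"
      using m[of n] d_sym by (simp add: d_left)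
    ultimately show ?thesis
      using m[of n] d_triangle[of "a [^] n" "c \<otimes> a [^] n" "c [^] m n"]
        d_triangle[of "c [^] m n" "c \<otimes> a [^] n" "c \<otimes> c [^] m n"] by linarith
  qed
  then have "range w \<subseteq> {x \<in> carrier G. d \<one> x \<le> d \<one> c + 2 * R}"
    by (auto simp: w_def)
  then have "finite (range w)"
    using finite_ball finite_subset by blast
  then have "\<not> inj w"
    using finite_imageD infinite_UNIV_nat by blast
  then obtain i j where ij: "i < j" "w i = w j"
    by (metis injI linorder_neqE_nat)
  define k where "k = j - i"
  have j: "a [^] j = a [^] i \<otimes> a [^] k" "0 < k"
    using ij by (simp_all add: k_def nat_pow_mult)
  have "a [^] j \<otimes> w i = c \<otimes> a [^] j"
    unfolding ij(2) by (simp add: w_def m_assoc[symmetric])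
  moreover have "a [^] j = a [^] k \<otimes> a [^] i"
    using ij by (simp add: k_def nat_pow_mult)
  moreover have "a [^] k \<otimes> a [^] i \<otimes> w i = a [^] k \<otimes> c \<otimes> a [^] i"
    by (simp add: w_def m_assoc[symmetric]) (simp add: m_assoc)
  ultimately have "a [^] k \<otimes> c \<otimes> a [^] i = c \<otimes> a [^] k \<otimes> a [^] i"
    by (simp add: m_assoc)
  then have comm: "a [^] k \<otimes> c = c \<otimes> a [^] k"
    by simp
  have comm2: "a [^] (k * n) \<otimes> c [^] q = c [^] q \<otimes> a [^] (k * n)" for n q :: nat
    using group_commutes_pow[of "a [^] k" c n] group_commutes_pow[of c "(a [^] k) [^] n" q] comm
    by (simp add: nat_pow_pow)
  obtain B where B: "\<And>(i :: nat) (j :: nat). gp \<one> (inv a [^] i) (inv c [^] j) \<le> B"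
    using not_coterminal_bound[OF loxodromic_coterminal[OF loxodromic_inv[OF a]] loxodromic_coterminal[OF loxodromic_inv[OF c]] not]
    by blast
  obtain N where N: "\<And>n :: nat. n \<ge> N \<Longrightarrow> R + B + 1 \<le> d \<one> (a [^] n)"
    using loxodromic_far[OF a] by meson
  let ?a = "a [^] (k * N)" and ?c = "c [^] m (k * N)"
  \<comment> \<open>Commuting elements are as far apart as their inverses. So the backward rays also
    contain far points that are close to each other, against the bound \<open>B\<close>.\<close>
  have "d (inv ?a) (inv ?c) = d (?c \<otimes> ?a \<otimes> inv ?a) (?c \<otimes> ?a \<otimes> inv ?c)"
    by (simp add: d_left)
  also have "?c \<otimes> ?a \<otimes> inv ?c = ?a"
    by (simp only: comm2[symmetric]) (simp add: m_assoc)
  also have "?c \<otimes> ?a \<otimes> inv ?a = ?c"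
    by (simp add: m_assoc)
  finally have "d (inv ?a) (inv ?c) \<le> R"
    using m[of "k * N"] d_sym by simp
  then have "d \<one> ?a - R \<le> gp \<one> (inv ?a) (inv ?c)"
  proof -
    have "gp \<one> (inv ?a) (inv ?a) = d \<one> ?a"
      by (simp add: gp_def d_one_inv)
    then show ?thesis
      using gp_lipschitz2[of \<one> "inv ?a" "inv ?a" "inv ?c"]
        \<open>d (inv ?a) (inv ?c) \<le> R\<close> by linarith
  qed
  moreover have "k * N \<ge> N"
    using j(2) by simp
  ultimately show False
    using N[of "k * N"] B[of "k * N" "m (k * N)"] by (simp add: nat_pow_inv)
qed

section \<open>Words with long letters and small turns\<close>

context
  fixes P Q :: 'g and C l :: real
  assumes PQ: "P \<in> carrier G" "Q \<in> carrier G"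
    and turn: "gp \<one> (inv P) Q \<le> C" "gp \<one> (inv Q) P \<le> C"
    and long: "l \<le> d \<one> P" "l \<le> d \<one> Q"
    and large: "2 * C + 3 * \<delta> < l"
begin

lemma alternating_joint:
  "gp (alternating P Q (Suc i)) (alternating P Q i) (alternating P Q (Suc (Suc i))) \<le> C"
proof -
  let ?x = "alternating P Q"
  define A where "A = (if even i then P else Q)"
  define B where "B = (if even i then Q else P)"
  have [simp]: "A \<in> carrier G" "B \<in> carrier G"
    using PQ by (simp_all add: A_def B_def)
  have x: "?x (Suc i) = ?x i \<otimes> A" "?x (Suc (Suc i)) = ?x (Suc i) \<otimes> B" "?x i \<in> carrier G"
    using PQ by (simp_all add: A_def B_def)
  have "?x i = ?x (Suc i) \<otimes> inv A"
    using x by (simp add: m_assoc)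
  then have "gp (?x (Suc i)) (?x i) (?x (Suc (Suc i))) = gp \<one> (inv A) B"
    using gp_left[of "?x (Suc i)" \<one> "inv A" B] x by simp
  then show ?thesis
    using turn by (simp add: A_def B_def split: if_splits)
qed

lemma alternating_long: "l \<le> d (alternating P Q i) (alternating P Q (Suc i))"
  using long PQ by (simp add: d_mult)

lemmas alternating_chain = alternating_joint alternating_long large

lemma alternating_dist:
  "n * (l - 2 * C - 2 * \<delta>) \<le> d (alternating P Q i) (alternating P Q (i + n))"
  using chain_dist[where x = "alternating P Q", OF alternating_chain] .

lemma alternating_inj: "inj (alternating P Q)"
proof (rule injI, rule ccontr)
  have *: "alternating P Q i \<noteq> alternating P Q j" if "i < j" for i j
  proof
    assume "alternating P Q i = alternating P Q j"
    moreover have "0 < (j - i) * (l - 2 * C - 2 * \<delta>)"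
      using that large delta_pos by simp
    ultimately show False
      using alternating_dist[of "j - i" i] that by simp
  qed
  fix i j assume "alternating P Q i = alternating P Q j" "i \<noteq> j"
  then show False
    using *[of i j] *[of j i] by (cases "i < j") auto
qed

lemma alternating_far: "0 < n \<Longrightarrow> l - 2 * C - 2 * \<delta> \<le> d \<one> (alternating P Q n)"
proof -
  assume "0 < n"
  then have "1 * (l - 2 * C - 2 * \<delta>) \<le> n * (l - 2 * C - 2 * \<delta>)"
    using large delta_pos by (intro mult_right_mono) auto
  then show ?thesis
    using alternating_dist[of n 0] by simp
qed

text \<open>The first prefix \<open>P\<close> lies coarsely between \<open>\<one>\<close> and every
  later one, so their product is nearly the whole length of \<open>P\<close>.\<close>

lemma alternating_direction:
  assumes "0 < n"
  shows "l - C - 2 * \<delta> \<le> gp \<one> P (alternating P Q n)"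
  using chain_quasigeodesic[where x = "alternating P Q", OF alternating_chain, of 0 1 n] assms
    gp_add[of \<one> P "alternating P Q n"] PQ long by simp

text \<open>The powers of \<open>P \<otimes> Q\<close> are the even prefixes of a quasigeodesic
  chain. Translating an inner one to \<open>\<one>\<close> gives the bound, and
  \<open>alternating_dist\<close> gives the divergence.\<close>

lemma loxodromic_mult: "loxodromic (P \<otimes> Q)"
proof -
  let ?a = "P \<otimes> Q" and ?x = "alternating P Q"
  have "gp \<one> (inv ?a [^] m) (?a [^] n) \<le> C + 2 * \<delta>" for m n :: nat
  proof -
    have "gp (?x (2 * m)) (?x 0) (?x (2 * (m + n))) \<le> C + 2 * \<delta>"
      using chain_quasigeodesic[where x = ?x, OF alternating_chain, of 0 "2 * m" "2 * (m + n)"] by simp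
    then have "gp (?a [^] m) \<one> (?a [^] (m + n)) \<le> C + 2 * \<delta>"
      using PQ by (simp only: alternating_double) simp
    then show ?thesis
      using gp_one[of "?a [^] m" \<one> "?a [^] (m + n)"] inv_pow_mult_pow[of ?a m "m + n"] PQ
      by (simp add: nat_pow_inv)
  qed
  moreover have "\<exists>N. \<forall>n\<ge>N. R \<le> d \<one> (?a [^] (n :: nat))" for R
  proof -
    obtain N :: nat where N: "R < N * (l - 2 * C - 2 * \<delta>)"
      using reals_Archimedean3[of "l - 2 * C - 2 * \<delta>"] large delta_pos by auto
    have "R \<le> d \<one> (?a [^] n)" if "n \<ge> N" for n :: nat
    proof -
      have "N * (l - 2 * C - 2 * \<delta>) \<le> (2 * n) * (l - 2 * C - 2 * \<delta>)"
        using that large delta_pos by (intro mult_right_mono) auto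
      then show ?thesis
        using N alternating_dist[of "2 * n" 0] alternating_double[OF PQ, of n] by simp
    qed
    then show ?thesis by blast
  qed
  ultimately show ?thesis
    using PQ unfolding loxodromic_def by blast
qed

end

text \<open>In the second case every sequence in \<open>G\<close> tending to infinity tends to the same boundary point.\<close>

lemma loxodromic_or_parabolic:
  "(\<exists>a. loxodromic a) \<or>
    (\<forall>g\<in>carrier G. \<forall>h\<in>carrier G. min (d \<one> g) (d \<one> h) / 2 - 3 * \<delta> \<le> gp \<one> g h)"
proof (cases "\<exists>a. loxodromic a")
  case False
  \<comment> \<open>Since \<open>g \<otimes> g\<close> is not loxodromic, the choice
    \<open>P = Q = g\<close> must violate the condition \<open>large\<close>.\<close>
  have inv_near: "d \<one> g / 2 - 3 / 2 * \<delta> \<le> gp \<one> (inv g) g" if "g \<in> carrier G" for g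
    using loxodromic_mult[of g g "gp \<one> (inv g) g" "d \<one> g"] that False by force
  have "min (d \<one> g) (d \<one> h) / 2 - 3 * \<delta> \<le> gp \<one> g h" if gh: "g \<in> carrier G" "h \<in> carrier G" for g h
  proof (rule ccontr)
    define m where "m = min (d \<one> g) (d \<one> h)"
    assume "\<not> ?thesis"
    then have m: "gp \<one> g h < m / 2 - 3 * \<delta>" "m \<le> d \<one> g" "m \<le> d \<one> h"
      by (auto simp: m_def)
    \<comment> \<open>By \<open>inv_near\<close> each of \<open>g\<close>, \<open>h\<close> lies in
      the direction of its inverse, so a small product of \<open>g\<close> and \<open>h\<close>
      makes the turns of the word \<open>g h\<close> small. With
      \<open>C = m / 2 - 2 * \<delta>\<close> the threshold \<open>2 * C + 3 * \<delta>\<close> is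
      \<open>m - \<delta>\<close>, just below both lengths.\<close>
    have "gp \<one> (inv g) h \<le> m / 2 - 2 * \<delta>"
      using gp_hypD[of \<one> g "inv g" h] inv_near[of g] gh m delta_pos gp_commute[of \<one> g "inv g"] by linarith
    moreover have "gp \<one> (inv h) g \<le> m / 2 - 2 * \<delta>"
      using gp_hypD[of \<one> h "inv h" g] inv_near[of h] gh m delta_pos
        gp_commute[of \<one> h "inv h"] gp_commute[of \<one> h g] by linarith
    ultimately show False
      using loxodromic_mult[of g h "m / 2 - 2 * \<delta>" m] gh m False delta_pos by force
  qed
  then show ?thesis by blast
qed blast

end

section \<open>The cocycle of a pair of bump functions\<close>

definition wedge :: "('a \<Rightarrow> real) \<Rightarrow> ('a \<Rightarrow> real) \<Rightarrow> 'a \<Rightarrow> 'a \<Rightarrow> real" where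
  "wedge f k x y = f x * k y - f y * k x"

definition d_wedge :: "('a \<Rightarrow> real) \<Rightarrow> ('a \<Rightarrow> real) \<Rightarrow> 'a \<Rightarrow> 'a \<Rightarrow> 'a \<Rightarrow> real" where
  "d_wedge f k x y z = wedge f k y z - wedge f k x z + wedge f k x y"

context hyperbolic_group
begin

lemma card_bounded_set:
  assumes "A \<subseteq> carrier G" and close: "\<And>g h. g \<in> A \<Longrightarrow> h \<in> A \<Longrightarrow> d g h \<le> R"
  shows "card A \<le> card {x \<in> carrier G. d \<one> x \<le> R}"
proof (cases "A = {}")
  case False
  then obtain g where g: "g \<in> A" by blast
  then have gc: "g \<in> carrier G" using assms by blast
  show ?thesis
  proof (rule card_inj_on_le[of "\<lambda>x. inv g \<otimes> x"])
    show "inj_on (\<lambda>x. inv g \<otimes> x) A"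
      using gc assms(1) by (intro inj_onI) (auto simp: subset_iff)
    have "d \<one> (inv g \<otimes> h) \<le> R" if "h \<in> A" for h
      using d_left[of "inv g" g h] close[OF g that] gc that assms(1) by auto
    then show "(\<lambda>x. inv g \<otimes> x) ` A \<subseteq> {x \<in> carrier G. d \<one> x \<le> R}"
      using gc assms(1) by auto
  qed (rule finite_ball)
qed simp

text \<open>The last clause puts \<open>\<one>\<close> coarsely between any point of one support and
  any point of the other, so a nonzero \<open>wedge\<close> detects pairs whose segment passes near
  \<open>\<one>\<close>.\<close>

definition bump_pair :: "('g \<Rightarrow> real) \<Rightarrow> ('g \<Rightarrow> real) \<Rightarrow> real \<Rightarrow> real \<Rightarrow> bool" where
  "bump_pair f k C D \<longleftrightarrow> (\<forall>x. 0 \<le> f x \<and> f x \<le> 1 \<and> 0 \<le> k x \<and> k x \<le> 1)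
     \<and> (\<forall>x y. \<bar>f x - f y\<bar> \<le> C * closeness \<one> x y \<and> \<bar>k x - k y\<bar> \<le> C * closeness \<one> x y)
     \<and> (\<forall>x y. f x \<noteq> 0 \<longrightarrow> k y \<noteq> 0 \<longrightarrow> gp \<one> x y \<le> D)"

context
  fixes f k :: "'g \<Rightarrow> real" and C D :: real
  assumes fk: "bump_pair f k C D"
begin

lemma bump_f: "0 \<le> f x" "f x \<le> 1" "\<bar>f x - f y\<bar> \<le> C * closeness \<one> x y"
  and bump_k: "0 \<le> k x" "k x \<le> 1" "\<bar>k x - k y\<bar> \<le> C * closeness \<one> x y"
  and bump_sep: "f x \<noteq> 0 \<Longrightarrow> k y \<noteq> 0 \<Longrightarrow> gp \<one> x y \<le> D"
  using fk by (simp_all add: bump_pair_def)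

lemma wedge_nonzeroD: "wedge f k x y \<noteq> 0 \<Longrightarrow> gp \<one> x y \<le> D"
  using bump_sep[of x y] bump_sep[of y x] gp_commute[of \<one> x y] by (fastforce simp: wedge_def)

text \<open>\<open>d_wedge\<close> is a determinant of differences of \<open>f\<close> and
  \<open>k\<close>, each of whose two terms contains a difference between \<open>x\<close> and
  \<open>z\<close>.\<close>

lemma d_wedge_bound: "\<bar>d_wedge f k x y z\<bar> \<le> 2 * C * closeness \<one> x z"
proof -
  define p q where "p = (f x - f z) * (k y - k z)" and "q = (f y - f z) * (k x - k z)"
  define e where "e = C * closeness \<one> x z"
  have "\<bar>p\<bar> \<le> \<bar>f x - f z\<bar> * 1"
    unfolding p_def abs_mult using bump_k(1,2)[of y] bump_k(1,2)[of z] by (intro mult_left_mono) auto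
  then have p: "\<bar>p\<bar> \<le> e"
    using bump_f(3)[of x z] by (simp add: e_def)
  have "\<bar>q\<bar> \<le> 1 * \<bar>k x - k z\<bar>"
    unfolding q_def abs_mult using bump_f(1,2)[of y] bump_f(1,2)[of z] by (intro mult_right_mono) auto
  then have q: "\<bar>q\<bar> \<le> e"
    using bump_k(3)[of x z] by (simp add: e_def)
  have "d_wedge f k x y z = p - q"
    by (simp add: d_wedge_def wedge_def p_def q_def algebra_simps)
  then have "\<bar>d_wedge f k x y z\<bar> \<le> 2 * e"
    using p q by simp
  then show ?thesis
    by (simp add: e_def)
qed

text \<open>The contribution of \<open>g\<close> when it is near the side \<open>u v\<close>, on the
  half next to \<open>v\<close>. There \<open>gp g u w\<close> measures the distance from
  \<open>g\<close> to the centre of the triangle, in which the value decays exponentially.\<close>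

definition near_side :: "'g \<Rightarrow> 'g \<Rightarrow> 'g \<Rightarrow> 'g \<Rightarrow> real" where
  "near_side u v w g = (if gp g u v \<le> D \<and> gp g v w \<le> gp g u w then (closeness g u w)\<^sup>2 else 0)"

lemma near_side_nonneg: "0 \<le> near_side u v w g"
  by (simp add: near_side_def)

text \<open>If the coboundary is not zero, one of the three wedges is not, and \<open>\<one>\<close>
  lies near that side. The six terms are the two halves of the three sides; since the absolute value
  is symmetric in the vertices, \<open>d_wedge_bound\<close> can be applied to the pair with the
  larger product.\<close>

lemma d_wedge_le_near_side:
  "(d_wedge f k x y z)\<^sup>2 \<le> 4 * C\<^sup>2 * (near_side x y z \<one> + near_side y x z \<one> + near_side y z x \<one>
     + near_side z y x \<one> + near_side x z y \<one> + near_side z x y \<one>)"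
proof (cases "d_wedge f k x y z = 0")
  case False
  have swap: "\<bar>d_wedge f k u v w\<bar> = \<bar>d_wedge f k v u w\<bar>" "\<bar>d_wedge f k u v w\<bar> = \<bar>d_wedge f k u w v\<bar>" for u v w
    by (simp_all add: d_wedge_def wedge_def)
  have sq: "(d_wedge f k u v w)\<^sup>2 \<le> 4 * C\<^sup>2 * (closeness \<one> u w)\<^sup>2" for u v w
    using power_mono[OF d_wedge_bound[of u v w] abs_ge_zero, of 2] by (simp add: power_mult_distrib)
  have pair: "(d_wedge f k u v w)\<^sup>2 \<le> 4 * C\<^sup>2 * (near_side u v w \<one> + near_side v u w \<one>)"
    if "gp \<one> u v \<le> D" for u v w
  proof (cases "gp \<one> v w \<le> gp \<one> u w")
    case True
    then have "(closeness \<one> u w)\<^sup>2 \<le> near_side u v w \<one> + near_side v u w \<one>"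
      using that near_side_nonneg[of v u w \<one>] by (simp add: near_side_def[of u v w])
    then show ?thesis
      using sq[of u v w] mult_left_mono[of "(closeness \<one> u w)\<^sup>2" _ "4 * C\<^sup>2"] by fastforce
  next
    case False
    then have "(closeness \<one> v w)\<^sup>2 \<le> near_side u v w \<one> + near_side v u w \<one>"
      using that near_side_nonneg[of u v w \<one>] by (simp add: near_side_def[of v u w] gp_commute)
    moreover have "(d_wedge f k u v w)\<^sup>2 = (d_wedge f k v u w)\<^sup>2"
      using swap(1)[of u v w] by (simp add: power2_eq_iff abs_eq_iff)
    ultimately show ?thesis
      using sq[of v u w] mult_left_mono[of "(closeness \<one> v w)\<^sup>2" _ "4 * C\<^sup>2"] by fastforce
  qed
  have mono: "4 * C\<^sup>2 * s \<le> 4 * C\<^sup>2 * t" if "s \<le> t" for s t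
    using that by (intro mult_left_mono) auto
  note nn = near_side_nonneg[of _ _ _ \<one>]
  consider "gp \<one> x y \<le> D" | "gp \<one> y z \<le> D" | "gp \<one> x z \<le> D"
    using False wedge_nonzeroD[of x y] wedge_nonzeroD[of y z] wedge_nonzeroD[of x z]
    unfolding d_wedge_def by (metis add_0 diff_0_right)
  then show ?thesis
  proof cases
    case 1
    show ?thesis
      by (rule order_trans[OF pair[OF 1, of z] mono])
        (use nn[of y z x] nn[of z y x] nn[of x z y] nn[of z x y] in linarith)
  next
    case 2
    have "(d_wedge f k x y z)\<^sup>2 = (d_wedge f k y z x)\<^sup>2"
      by (simp add: d_wedge_def wedge_def algebra_simps)
    then show ?thesis
      using order_trans[OF pair[OF 2, of x] mono] nn[of x y z] nn[of y x z] nn[of x z y] nn[of z x y]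
      by simp
  next
    case 3
    have "(d_wedge f k x y z)\<^sup>2 = (d_wedge f k x z y)\<^sup>2"
      using swap(2)[of x y z] by (simp add: power2_eq_iff abs_eq_iff)
    then show ?thesis
      using order_trans[OF pair[OF 3, of y] mono] nn[of x y z] nn[of y x z] nn[of y z x] nn[of z y x]
      by simp
  qed
qed (simp add: near_side_nonneg)

text \<open>Sorted by the integer part of \<open>gp g u w\<close>, the elements near half a side
  fall into levels of bounded diameter, by \<open>side_point_unique_centre\<close>. Each level has
  at most \<open>K\<close> elements, and the weights of the levels form a geometric series.\<close>

lemma near_side_sum:
  obtains S where "\<And>E u v w. finite E \<Longrightarrow> E \<subseteq> carrier G \<Longrightarrow> (\<Sum>g\<in>E. near_side u v w g) \<le> S"
proof -
  \<comment> \<open>\<open>side_point_unique_centre\<close> asks for a nonnegative bound, while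
    \<open>D\<close> may be negative.\<close>
  define D' where "D' = max 0 D"
  define K where "K = real (card {x \<in> carrier G. d \<one> x \<le> 2 * D' + 10 * \<delta> + 2})"
  define r :: real where "r = 2 powr (- 1 / \<delta>)"
  have r: "0 < r" "r < 1"
    using delta_pos powr_less_cancel_iff[of 2 "- 1 / \<delta>" 0] by (simp_all add: r_def)
  have "(\<Sum>g\<in>E. near_side u v w g) \<le> (\<Sum>n. K * r ^ n)"
    if E: "finite E" "E \<subseteq> carrier G" for E u v w
  proof -
    define E' where "E' = {g \<in> E. gp g u v \<le> D \<and> gp g v w \<le> gp g u w}"
    define n where "n g = nat \<lfloor>gp g u w\<rfloor>" for g
    have n: "real (n g) \<le> gp g u w" "gp g u w \<le> real (n g) + 1" for g
      using gp_nonneg[of g u w] real_of_int_floor_add_one_ge[of "gp g u w"] by (simp_all add: n_def)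
    have "(\<Sum>g\<in>E. near_side u v w g) = (\<Sum>g\<in>E'. (closeness g u w)\<^sup>2)"
      unfolding E'_def near_side_def using E by (subst sum.inter_filter) simp_all
    also have "\<dots> \<le> (\<Sum>g\<in>E'. r ^ n g)"
    proof (rule sum_mono)
      fix g
      have "(closeness g u w)\<^sup>2 = 2 powr (- gp g u w / \<delta>)"
        using delta_pos by (simp add: closeness_def powr_power field_simps)
      also have "\<dots> \<le> 2 powr (- real (n g) / \<delta>)"
        using n[of g] delta_pos by (intro powr_mono divide_right_mono) auto
      also have "\<dots> = r ^ n g"
        by (simp add: r_def powr_power)
      finally show "(closeness g u w)\<^sup>2 \<le> r ^ n g" .
    qed
    also have "\<dots> = (\<Sum>m\<in>n ` E'. \<Sum>g\<in>{g \<in> E'. n g = m}. r ^ n g)"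
      using E by (intro sum.image_gen) (simp add: E'_def)
    also have "\<dots> \<le> (\<Sum>m\<in>n ` E'. K * r ^ m)"
    proof (rule sum_mono)
      fix m
      have "card {g \<in> E'. n g = m} \<le> card {x \<in> carrier G. d \<one> x \<le> 2 * D' + 10 * \<delta> + 2}"
      proof (rule card_bounded_set)
        fix g h assume "g \<in> {g \<in> E'. n g = m}" "h \<in> {g \<in> E'. n g = m}"
        then show "d g h \<le> 2 * D' + 10 * \<delta> + 2"
          using n[of g] n[of h]
          by (intro side_point_unique_centre[of g u v D' m w h]) (auto simp: E'_def D'_def)
      qed (use E in \<open>auto simp: E'_def\<close>)
      then have "real (card {g \<in> E'. n g = m}) * r ^ m \<le> K * r ^ m"
        using r by (intro mult_right_mono) (simp_all add: K_def)
      then show "(\<Sum>g\<in>{g \<in> E'. n g = m}. r ^ n g) \<le> K * r ^ m"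
        by simp
    qed
    also have "\<dots> \<le> (\<Sum>m. K * r ^ m)"
      using E r by (intro sum_le_suminf summable_mult summable_geometric) (auto simp: E'_def K_def)
    finally show ?thesis .
  qed
  then show thesis by (rule that)
qed

lemma d_wedge_square_sum:
  obtains S where "\<And>E x y z. \<lbrakk>finite E; E \<subseteq> carrier G; x \<in> carrier G; y \<in> carrier G; z \<in> carrier G\<rbrakk>
    \<Longrightarrow> (\<Sum>g\<in>E. (d_wedge f k (inv g \<otimes> x) (inv g \<otimes> y) (inv g \<otimes> z))\<^sup>2) \<le> S"
proof -
  obtain S where S: "\<And>E u v w. finite E \<Longrightarrow> E \<subseteq> carrier G \<Longrightarrow> (\<Sum>g\<in>E. near_side u v w g) \<le> S"
    using near_side_sum by blast
  have "(\<Sum>g\<in>E. (d_wedge f k (inv g \<otimes> x) (inv g \<otimes> y) (inv g \<otimes> z))\<^sup>2) \<le> 4 * C\<^sup>2 * (6 * S)"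
    if E: "finite E" "E \<subseteq> carrier G" and xyz: "x \<in> carrier G" "y \<in> carrier G" "z \<in> carrier G" for E x y z
  proof -
    \<comment> \<open>Looking from \<open>\<one>\<close> at the triangle translated by
      \<open>inv g\<close> is the same as looking at the triangle from \<open>g\<close>.\<close>
    have move: "near_side (inv g \<otimes> u) (inv g \<otimes> v) (inv g \<otimes> w) \<one> = near_side u v w g"
      if "g \<in> carrier G" "u \<in> carrier G" "v \<in> carrier G" "w \<in> carrier G" for g u v w
      using that by (simp add: near_side_def closeness_def gp_one[of g])
    have "(\<Sum>g\<in>E. (d_wedge f k (inv g \<otimes> x) (inv g \<otimes> y) (inv g \<otimes> z))\<^sup>2)
      \<le> (\<Sum>g\<in>E. 4 * C\<^sup>2 * (near_side x y z g + near_side y x z g + near_side y z x g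
          + near_side z y x g + near_side x z y g + near_side z x y g))"
    proof (rule sum_mono)
      fix g assume "g \<in> E"
      then have "g \<in> carrier G" using E by blast
      then show "(d_wedge f k (inv g \<otimes> x) (inv g \<otimes> y) (inv g \<otimes> z))\<^sup>2
        \<le> 4 * C\<^sup>2 * (near_side x y z g + near_side y x z g + near_side y z x g
          + near_side z y x g + near_side x z y g + near_side z x y g)"
        using d_wedge_le_near_side[of "inv g \<otimes> x" "inv g \<otimes> y" "inv g \<otimes> z"] xyz by (simp add: move)
    qed
    also have "\<dots> = 4 * C\<^sup>2 * ((\<Sum>g\<in>E. near_side x y z g) + (\<Sum>g\<in>E. near_side y x z g)
        + (\<Sum>g\<in>E. near_side y z x g) + (\<Sum>g\<in>E. near_side z y x g)
        + (\<Sum>g\<in>E. near_side x z y g) + (\<Sum>g\<in>E. near_side z x y g))"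
      by (simp add: sum_distrib_left[symmetric] sum.distrib)
    also have "\<dots> \<le> 4 * C\<^sup>2 * (6 * S)"
      using S[OF E, of x y z] S[OF E, of y x z] S[OF E, of y z x] S[OF E, of z y x]
        S[OF E, of x z y] S[OF E, of z x y]
      by (intro mult_left_mono) simp_all
    finally show ?thesis .
  qed
  then show thesis by (rule that)
qed

end

end

section \<open>Limits along loxodromic elements\<close>

text \<open>For a fixed shift the differences are square summable and so tend to 0; hence the limit
  \<open>l\<close> of a subsequence is also the limit of its shifts. Passing to the limit along that
  subsequence in the given bound makes \<open>s - l\<close> square summable.\<close>

lemma convergent_of_shift_square_sums:
  fixes s :: "nat \<Rightarrow> complex"
  assumes C: "\<And>n J. finite J \<Longrightarrow> (\<Sum>j\<in>J. (cmod (s j - s (j + n)))\<^sup>2) \<le> C"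
  shows "convergent s"
proof -
  have tail: "(\<lambda>i. h i) \<longlonglongrightarrow> 0"
    if "\<And>J. finite J \<Longrightarrow> (\<Sum>j\<in>J. (cmod (h j))\<^sup>2) \<le> C" for h :: "nat \<Rightarrow> complex"
  proof -
    have "summable (\<lambda>i. (cmod (h i))\<^sup>2)"
      using that by (intro bounded_imp_summable[where B = C]) auto
    then have "(\<lambda>i. sqrt ((cmod (h i))\<^sup>2)) \<longlonglongrightarrow> sqrt 0"
      by (intro tendsto_real_sqrt summable_LIMSEQ_zero)
    then show ?thesis
      by (simp add: tendsto_norm_zero_iff)
  qed
  have "cmod (s n) \<le> cmod (s 0) + sqrt C" for n
  proof -
    have "cmod (s 0 - s n) \<le> sqrt C"
      using C[of "{0}" n] by (simp add: real_le_rsqrt)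
    then show ?thesis
      using norm_triangle_ineq2[of "s n" "s 0"] by (simp add: norm_minus_commute)
  qed
  then have "bounded (range s)"
    by (auto simp: bounded_iff)
  then obtain l r where r: "strict_mono r" "(s \<circ> r) \<longlonglongrightarrow> l"
    using bounded_imp_convergent_subsequence[of s] by blast
  have shifted: "(\<lambda>k. s (j + r k)) \<longlonglongrightarrow> l" for j
  proof -
    have "(\<lambda>i. s i - s (i + j)) \<longlonglongrightarrow> 0"
      using C by (intro tail)
    then have "(\<lambda>k. s (r k) - s (r k + j)) \<longlonglongrightarrow> 0"
      using LIMSEQ_subseq_LIMSEQ[OF _ r(1), of "\<lambda>i. s i - s (i + j)" 0] by (simp add: o_def)
    from tendsto_diff[OF r(2) this] show ?thesis
      by (simp add: o_def add.commute)
  qed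
  have "(\<Sum>j\<in>J. (cmod (s j - l))\<^sup>2) \<le> C" if "finite J" for J
  proof (rule LIMSEQ_le_const2)
    show "(\<lambda>k. \<Sum>j\<in>J. (cmod (s j - s (j + r k)))\<^sup>2) \<longlonglongrightarrow> (\<Sum>j\<in>J. (cmod (s j - l))\<^sup>2)"
      by (intro tendsto_sum tendsto_power tendsto_norm tendsto_diff tendsto_const shifted)
  qed (use C[OF that] in blast)
  from tail[OF this] have "s \<longlonglongrightarrow> l"
    by (simp add: LIM_zero_iff)
  then show ?thesis
    by (rule convergentI)
qed

context hyperbolic_group
begin

text \<open>The class \<open>c_0\<close> of functions vanishing at infinity on the discrete
  carrier.\<close>

definition vanishing :: "('g \<Rightarrow> complex) \<Rightarrow> bool" where
  "vanishing h \<longleftrightarrow> (\<forall>\<epsilon>>0. finite {x \<in> carrier G. \<epsilon> \<le> cmod (h x)})"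

lemma vanishing_of_square_sums:
  assumes C: "\<And>E. finite E \<Longrightarrow> E \<subseteq> carrier G \<Longrightarrow> (\<Sum>x\<in>E. (cmod (h x))\<^sup>2) \<le> C"
  shows "vanishing h"
  unfolding vanishing_def
proof (intro allI impI)
  fix \<epsilon> :: real assume \<epsilon>: "0 < \<epsilon>"
  have "card E \<le> nat \<lfloor>C / \<epsilon>\<^sup>2\<rfloor>" if E: "E \<subseteq> {x \<in> carrier G. \<epsilon> \<le> cmod (h x)}" "finite E" for E
  proof -
    have "card E * \<epsilon>\<^sup>2 \<le> (\<Sum>x\<in>E. (cmod (h x))\<^sup>2)"
      using E \<epsilon> by (intro sum_bounded_below power_mono) auto
    also have "\<dots> \<le> C"
      using E by (intro C) auto
    finally have "real (card E) \<le> C / \<epsilon>\<^sup>2"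
      using \<epsilon> by (simp add: field_simps)
    then show ?thesis
      by (simp add: le_nat_floor)
  qed
  then show "finite {x \<in> carrier G. \<epsilon> \<le> cmod (h x)}"
    using finite_if_finite_subsets_card_bdd by blast
qed

lemma vanishing_add:
  assumes "vanishing h" "vanishing h'"
  shows "vanishing (\<lambda>x. h x + h' x)"
  unfolding vanishing_def
proof (intro allI impI)
  fix \<epsilon> :: real assume "0 < \<epsilon>"
  then have "finite ({x \<in> carrier G. \<epsilon> / 2 \<le> cmod (h x)} \<union> {x \<in> carrier G. \<epsilon> / 2 \<le> cmod (h' x)})"
    using assms unfolding vanishing_def by (meson finite_UnI half_gt_zero)
  then show "finite {x \<in> carrier G. \<epsilon> \<le> cmod (h x + h' x)}"
  proof (rule finite_subset[rotated], safe)
    fix x assume "\<epsilon> \<le> cmod (h x + h' x)" "\<not> \<epsilon> / 2 \<le> cmod (h' x)"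
    then show "\<epsilon> / 2 \<le> cmod (h x)"
      using norm_triangle_ineq[of "h x" "h' x"] by simp
  qed
qed

lemma vanishing_right:
  assumes "vanishing h" "y \<in> carrier G"
  shows "vanishing (\<lambda>x. h (x \<otimes> y))"
  unfolding vanishing_def
proof (intro allI impI)
  fix \<epsilon> :: real assume "0 < \<epsilon>"
  then have "finite ((\<lambda>x. x \<otimes> inv y) ` {x \<in> carrier G. \<epsilon> \<le> cmod (h x)})"
    using assms unfolding vanishing_def by simp
  then show "finite {x \<in> carrier G. \<epsilon> \<le> cmod (h (x \<otimes> y))}"
  proof (rule finite_subset[rotated], safe)
    fix x assume "x \<in> carrier G" "\<epsilon> \<le> cmod (h (x \<otimes> y))"
    then show "x \<in> (\<lambda>x. x \<otimes> inv y) ` {x \<in> carrier G. \<epsilon> \<le> cmod (h x)}"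
      using assms(2) by (intro image_eqI[of _ _ "x \<otimes> y"]) (simp_all add: m_assoc)
  qed
qed

lemma vanishing_tendsto:
  assumes h: "vanishing h" and z: "\<And>n :: nat. z n \<in> carrier G"
    and far: "filterlim (\<lambda>n. d \<one> (z n)) at_top sequentially"
  shows "(\<lambda>n. h (z n)) \<longlonglongrightarrow> 0"
proof (rule tendstoI)
  fix \<epsilon> :: real assume "0 < \<epsilon>"
  then have fin: "finite (d \<one> ` {x \<in> carrier G. \<epsilon> \<le> cmod (h x)})"
    using h by (simp add: vanishing_def)
  have "\<forall>\<^sub>F n in sequentially. (\<Sum>t\<in>d \<one> ` {x \<in> carrier G. \<epsilon> \<le> cmod (h x)}. \<bar>t\<bar>) < d \<one> (z n)"
    using far by (simp add: filterlim_at_top_dense)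
  then show "\<forall>\<^sub>F n in sequentially. dist (h (z n)) 0 < \<epsilon>"
  proof (rule eventually_mono)
    fix n assume n: "(\<Sum>t\<in>d \<one> ` {x \<in> carrier G. \<epsilon> \<le> cmod (h x)}. \<bar>t\<bar>) < d \<one> (z n)"
    show "dist (h (z n)) 0 < \<epsilon>"
    proof (rule ccontr)
      assume "\<not> ?thesis"
      then have "d \<one> (z n) \<in> d \<one> ` {x \<in> carrier G. \<epsilon> \<le> cmod (h x)}"
        using z[of n] by simp
      from member_le_sum[OF this _ fin, of abs] n show False
        by simp
    qed
  qed
qed

lemma loxodromic_pow_inj:
  assumes a: "loxodromic a"
  shows "inj (\<lambda>n :: nat. a [^] n)"
proof (rule injI, rule ccontr)
  have [simp]: "a \<in> carrier G" using a by simp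
  have *: "a [^] i \<noteq> a [^] j" if "i < j" for i j :: nat
  proof
    assume "a [^] i = a [^] j"
    then have one: "a [^] (j - i) = \<one>"
      using inv_pow_mult_pow[of a i j] that by simp
    obtain N where "\<And>n :: nat. n \<ge> N \<Longrightarrow> 1 \<le> d \<one> (a [^] n)"
      using loxodromic_far[OF a] by meson
    moreover have "a [^] ((j - i) * N) = \<one>"
      using one by (simp add: nat_pow_pow[symmetric])
    ultimately show False
      using that by (metis d_self mult_le_mono1 mult_1 not_one_le_zero zero_less_diff One_nat_def Suc_leI)
  qed
  fix i j :: nat assume "a [^] i = a [^] j" "i \<noteq> j"
  then show False
    using *[of i j] *[of j i] by (cases "i < j") auto
qed

text \<open>\<open>L x\<close> is the limit of \<open>F\<close> along
  \<open>x \<otimes> a [^] n\<close>, hence invariant under right multiplication by powers of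
  \<open>a\<close>. Letting \<open>n\<close> tend to infinity in the bound makes
  \<open>F - L\<close> square summable, so \<open>F\<close> has the limit \<open>L x\<close> at the
  backward end as well.\<close>

lemma limit_along_loxodromic:
  assumes a: "loxodromic a"
    and C: "\<And>n E. \<lbrakk>finite E; E \<subseteq> carrier G\<rbrakk> \<Longrightarrow> (\<Sum>x\<in>E. (cmod (F x - F (x \<otimes> a [^] (n :: nat))))\<^sup>2) \<le> C"
  shows "\<exists>L. (\<forall>x\<in>carrier G. \<forall>n :: nat. L (x \<otimes> a [^] n) = L x \<and> L (x \<otimes> inv a [^] n) = L x)
    \<and> vanishing (\<lambda>x. F x - L x)"
proof -
  have [simp]: "a \<in> carrier G" using a by simp
  define L where "L x = lim (\<lambda>n :: nat. F (x \<otimes> a [^] n))" for x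
  have lim: "(\<lambda>n. F (x \<otimes> a [^] n)) \<longlonglongrightarrow> L x" if x: "x \<in> carrier G" for x
    unfolding L_def convergent_LIMSEQ_iff[symmetric]
  proof (rule convergent_of_shift_square_sums)
    fix n :: nat and J :: "nat set" assume J: "finite J"
    have inj: "inj_on (\<lambda>j :: nat. x \<otimes> a [^] j) J"
      using loxodromic_pow_inj[OF a] x by (auto simp: inj_on_def)
    have "(\<Sum>y\<in>(\<lambda>j. x \<otimes> a [^] j) ` J. (cmod (F y - F (y \<otimes> a [^] n)))\<^sup>2) \<le> C"
      using J x by (intro C) auto
    then show "(\<Sum>j\<in>J. (cmod (F (x \<otimes> a [^] j) - F (x \<otimes> a [^] (j + n))))\<^sup>2) \<le> C"
      using x by (simp add: sum.reindex[OF inj] m_assoc nat_pow_mult)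
  qed
  have L1: "L (x \<otimes> a [^] n) = L x" if x: "x \<in> carrier G" for x and n :: nat
    proof (rule LIMSEQ_unique)
      show "(\<lambda>m. F (x \<otimes> a [^] n \<otimes> a [^] m)) \<longlonglongrightarrow> L (x \<otimes> a [^] n)"
        using x by (intro lim) simp
      show "(\<lambda>m. F (x \<otimes> a [^] n \<otimes> a [^] m)) \<longlonglongrightarrow> L x"
        using LIMSEQ_ignore_initial_segment[OF lim[OF x], of n] x
        by (simp add: m_assoc nat_pow_mult add.commute)
    qed
  have L2: "L (x \<otimes> inv a [^] n) = L x" if x: "x \<in> carrier G" for x and n :: nat
      using L1[of "x \<otimes> inv a [^] n" n] x by (simp add: m_assoc nat_pow_inv)
  have "vanishing (\<lambda>x. F x - L x)"
    proof (rule vanishing_of_square_sums)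
      fix E assume E: "finite E" "E \<subseteq> carrier G"
      show "(\<Sum>x\<in>E. (cmod (F x - L x))\<^sup>2) \<le> C"
      proof (rule LIMSEQ_le_const2)
        show "(\<lambda>n. \<Sum>x\<in>E. (cmod (F x - F (x \<otimes> a [^] n)))\<^sup>2) \<longlonglongrightarrow> (\<Sum>x\<in>E. (cmod (F x - L x))\<^sup>2)"
          using E by (intro tendsto_sum tendsto_power tendsto_norm tendsto_diff tendsto_const lim) auto
      qed (use C[OF E] in blast)
    qed
  with L1 L2 show ?thesis
    by blast
qed

text \<open>Appending \<open>P n\<close> preserves \<open>L\<close> and appending \<open>Q n\<close>
  preserves \<open>L'\<close>, while at far points \<open>F\<close> is close to both. So every
  letter after the first changes \<open>F\<close> by an amount tending to 0, and the first leads to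
  a point where \<open>F\<close> is close to \<open>L \<one>\<close>.\<close>

lemma tendsto_along_alternating:
  assumes PQ: "\<And>n :: nat. P n \<in> carrier G" "\<And>n. Q n \<in> carrier G"
    and L: "\<And>x n. x \<in> carrier G \<Longrightarrow> L (x \<otimes> P n) = L x" "vanishing (\<lambda>x. F x - L x)"
    and L': "\<And>x n. x \<in> carrier G \<Longrightarrow> L' (x \<otimes> Q n) = L' x" "vanishing (\<lambda>x. F x - L' x)"
    and far: "\<And>j. 0 < j \<Longrightarrow> filterlim (\<lambda>n. d \<one> (alternating (P n) (Q n) j)) at_top sequentially"
  shows "(\<lambda>n. F (alternating (P n) (Q n) (Suc j))) \<longlonglongrightarrow> L \<one>"
proof (induction j)
  case 0
  have "(\<lambda>n. F (P n) - L (P n)) \<longlonglongrightarrow> 0"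
    using far[of 1] PQ by (intro vanishing_tendsto[OF L(2)]) simp_all
  moreover have "L (P n) = L \<one>" for n
    using L(1)[of \<one> n] PQ by simp
  ultimately show ?case
    using PQ by (simp add: LIM_zero_iff)
next
  case (Suc j)
  let ?z = "\<lambda>j n. alternating (P n) (Q n) j"
  define M where "M = (if even (Suc j) then L else L')"
  have M: "M (?z (Suc (Suc j)) n) = M (?z (Suc j) n)" for n
    using L(1)[of "?z (Suc j) n" n] L'(1)[of "?z (Suc j) n" n] PQ by (auto simp: M_def simp del: alternating.simps(2) simp: alternating.simps(2)[of _ _ "Suc j"])
  have "vanishing (\<lambda>x. F x - M x)"
    using L(2) L'(2) by (simp add: M_def)
  then have "(\<lambda>n. F (?z (Suc i) n) - M (?z (Suc i) n)) \<longlonglongrightarrow> 0" for i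
    using far[of "Suc i"] PQ by (intro vanishing_tendsto) simp_all
  from tendsto_diff[OF this[of "Suc j"] this[of j]]
  have "(\<lambda>n. F (?z (Suc (Suc j)) n) - F (?z (Suc j) n)) \<longlonglongrightarrow> 0"
    unfolding M by simp
  from tendsto_add[OF this Suc.IH] show ?case
    by simp
qed

section \<open>Alternating words with letters growing to infinity\<close>

context
  fixes P Q :: "nat \<Rightarrow> 'g" and C :: real
  assumes PQ: "\<And>n. P n \<in> carrier G" "\<And>n. Q n \<in> carrier G"
    and turn: "\<And>n. gp \<one> (inv (P n)) (Q n) \<le> C" "\<And>n. gp \<one> (inv (Q n)) (P n) \<le> C"
    and long: "filterlim (\<lambda>n. d \<one> (P n)) at_top sequentially" "filterlim (\<lambda>n. d \<one> (Q n)) at_top sequentially"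
begin

lemma eventually_long: "\<forall>\<^sub>F n in sequentially. l \<le> d \<one> (P n) \<and> l \<le> d \<one> (Q n)"
  using long by (simp add: filterlim_at_top eventually_conj)

lemma alternating_seq_far:
  assumes "0 < j"
  shows "filterlim (\<lambda>n. d \<one> (alternating (P n) (Q n) j)) at_top sequentially"
  unfolding filterlim_at_top
proof
  fix R
  \<comment> \<open>Large enough for the condition \<open>large\<close>, and at least
    \<open>R\<close> remains after the loss of \<open>2 * C + 2 * \<delta>\<close> in
    \<open>alternating_far\<close>.\<close>
  define l where "l = \<bar>R\<bar> + 2 * C + 4 * \<delta>"
  show "\<forall>\<^sub>F n in sequentially. R \<le> d \<one> (alternating (P n) (Q n) j)"
    using eventually_long[of l]
  proof (rule eventually_mono)
    fix n assume n: "l \<le> d \<one> (P n) \<and> l \<le> d \<one> (Q n)"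
    have "2 * C + 3 * \<delta> < l"
      using delta_pos by (simp add: l_def)
    then have "l - 2 * C - 2 * \<delta> \<le> d \<one> (alternating (P n) (Q n) j)"
      using n assms by (intro alternating_far[OF PQ turn]) auto
    then show "R \<le> d \<one> (alternating (P n) (Q n) j)"
      using delta_pos by (simp add: l_def)
  qed
qed

lemma alternating_seq_direction:
  "\<forall>\<^sub>F n in sequentially. \<forall>j>0. M \<le> gp \<one> (P n) (alternating (P n) (Q n) j)"
proof -
  define l where "l = \<bar>M\<bar> + 2 * \<bar>C\<bar> + 4 * \<delta>"
  show ?thesis
    using eventually_long[of l]
  proof (rule eventually_mono, intro allI impI)
    fix n j :: nat assume n: "l \<le> d \<one> (P n) \<and> l \<le> d \<one> (Q n)" and "0 < j"
    have "2 * C + 3 * \<delta> < l"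
      using delta_pos by (simp add: l_def)
    then have "l - C - 2 * \<delta> \<le> gp \<one> (P n) (alternating (P n) (Q n) j)"
      using n \<open>0 < j\<close> by (intro alternating_direction[OF PQ turn]) auto
    then show "M \<le> gp \<one> (P n) (alternating (P n) (Q n) j)"
      using delta_pos by (simp add: l_def)
  qed
qed

lemma alternating_seq_inj: "\<forall>\<^sub>F n in sequentially. inj (alternating (P n) (Q n))"
  using eventually_long[of "2 * C + 4 * \<delta>"]
  by (rule eventually_mono) (rule alternating_inj[OF PQ turn], use delta_pos in auto)

end

lemma loxodromic_filterlim:
  assumes "loxodromic a"
  shows "filterlim (\<lambda>n :: nat. d \<one> (a [^] n)) at_top sequentially"
  unfolding filterlim_at_top eventually_sequentially using loxodromic_far[OF assms] by blast

text \<open>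
  The points are \<open>p i = (A^-n b^-n)^i A^-n\<close> and \<open>q i = b^n (A^n b^n)^(k-i-1)\<close>; all the quotients
  \<open>inv (p i) \<otimes> q i\<close> equal \<open>(A^n b^n)^k\<close>, which gives the bound on the sum.
\<close>

lemma equidistant_pairs:
  fixes F :: "'g \<Rightarrow> complex" and \<beta> :: "'g \<Rightarrow> 'g \<Rightarrow> complex" and k n0 :: nat
  assumes A: "loxodromic A" and b: "loxodromic b"
    and B: "\<And>(m :: nat) (n :: nat). gp \<one> (A [^] m) (inv b [^] n) \<le> B"
      "\<And>(m :: nat) (n :: nat). gp \<one> (inv A [^] m) (b [^] n) \<le> B"
    and L: "\<And>x n. x \<in> carrier G \<Longrightarrow> L (x \<otimes> A [^] (n :: nat)) = L x"
      "\<And>x n. x \<in> carrier G \<Longrightarrow> L (x \<otimes> inv A [^] (n :: nat)) = L x"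
      "vanishing (\<lambda>x. F x - L x)"
    and L': "\<And>x n. x \<in> carrier G \<Longrightarrow> L' (x \<otimes> b [^] (n :: nat)) = L' x"
      "\<And>x n. x \<in> carrier G \<Longrightarrow> L' (x \<otimes> inv b [^] (n :: nat)) = L' x"
      "vanishing (\<lambda>x. F x - L' x)"
    and C: "\<And>h E. \<lbrakk>finite E; E \<subseteq> carrier G; h \<in> carrier G\<rbrakk> \<Longrightarrow> (\<Sum>x\<in>E. (cmod (\<beta> x (x \<otimes> h)))\<^sup>2) \<le> C"
    and \<epsilon>: "0 < \<epsilon>"
  shows "\<exists>n\<ge>n0. \<exists>p q. (\<forall>i<k. M \<le> gp \<one> (p i) (inv A [^] n) \<and> M \<le> gp \<one> (q i) (b [^] n)
        \<and> cmod (F (q i) - F (p i) - (L' \<one> - L \<one>)) < \<epsilon>)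
      \<and> (\<Sum>i<k. (cmod (\<beta> (p i) (q i)))\<^sup>2) \<le> C"
proof -
  have [simp]: "A \<in> carrier G" "b \<in> carrier G" using A b by simp_all
  \<comment> \<open>The \<open>p i\<close> are words in \<open>w\<close> and the \<open>q i\<close>
    words in \<open>v\<close>, all of odd length. The first letter of such a word,
    \<open>inv A [^] n\<close> or \<open>b [^] n\<close>, determines its direction and the limit of
    \<open>F\<close>.\<close>
  define w where "w n j = alternating (inv A [^] n) (inv b [^] n) j" for n j :: nat
  define v where "v n j = alternating (b [^] n) (A [^] n) j" for n j :: nat
  have far: "filterlim (\<lambda>n :: nat. d \<one> (x [^] n)) at_top sequentially"
    if "x \<in> {A, b, inv A, inv b}" for x
    using that loxodromic_filterlim A b loxodromic_inv by blast
  have turnw: "gp \<one> (inv (inv A [^] n)) (inv b [^] n) \<le> B" "gp \<one> (inv (inv b [^] n)) (inv A [^] n) \<le> B"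
    for n :: nat
    using B(1)[of n n] B(2)[of n n] by (simp_all add: nat_pow_inv gp_commute)
  have turnv: "gp \<one> (inv (b [^] n)) (A [^] n) \<le> B" "gp \<one> (inv (A [^] n)) (b [^] n) \<le> B" for n :: nat
    using B(1)[of n n] B(2)[of n n] by (simp_all add: nat_pow_inv gp_commute)
  note seqw = alternating_seq_far[where P = "\<lambda>n. inv A [^] n" and Q = "\<lambda>n. inv b [^] n", OF _ _ turnw]
    alternating_seq_direction[where P = "\<lambda>n. inv A [^] n" and Q = "\<lambda>n. inv b [^] n", OF _ _ turnw, of M]
    alternating_seq_inj[where P = "\<lambda>n. inv A [^] n" and Q = "\<lambda>n. inv b [^] n", OF _ _ turnw]
  note seqv = alternating_seq_far[where P = "\<lambda>n. b [^] n" and Q = "\<lambda>n. A [^] n", OF _ _ turnv]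
    alternating_seq_direction[where P = "\<lambda>n. b [^] n" and Q = "\<lambda>n. A [^] n", OF _ _ turnv, of M]
  have limw: "(\<lambda>n. F (w n (Suc j))) \<longlonglongrightarrow> L \<one>" for j
    unfolding w_def using far L(2,3) L'(2,3)
    by (intro tendsto_along_alternating[where L' = L'] seqw(1)) simp_all
  have limv: "(\<lambda>n. F (v n (Suc j))) \<longlonglongrightarrow> L' \<one>" for j
    unfolding v_def using far L(1,3) L'(1,3)
    by (intro tendsto_along_alternating[where L' = L] seqv(1)) simp_all
  have "\<forall>\<^sub>F n in sequentially. cmod (F (v n (Suc j)) - F (w n (Suc i)) - (L' \<one> - L \<one>)) < \<epsilon>" for i j
    using tendstoD[OF tendsto_diff[OF limv[of j] limw[of i]] \<epsilon>] by (simp add: dist_norm)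
  then have close: "\<forall>\<^sub>F n in sequentially. \<forall>i\<in>{..<k}.
      cmod (F (v n (Suc (2 * (k - i - 1)))) - F (w n (Suc (2 * i))) - (L' \<one> - L \<one>)) < \<epsilon>"
    by (intro eventually_ball_finite) auto
  have "\<forall>\<^sub>F n in sequentially. \<forall>j>0. M \<le> gp \<one> (inv A [^] n) (w n j)"
    unfolding w_def using far by (intro seqw(2)) simp_all
  moreover have "\<forall>\<^sub>F n in sequentially. \<forall>j>0. M \<le> gp \<one> (b [^] n) (v n j)"
    unfolding v_def using far by (intro seqv(2)) simp_all
  moreover have "\<forall>\<^sub>F n in sequentially. inj (w n)"
    unfolding w_def[abs_def] using far by (intro seqw(3)) simp_all
  ultimately have "\<forall>\<^sub>F n in sequentially. n0 \<le> n \<and> inj (w n)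
      \<and> (\<forall>j>0. M \<le> gp \<one> (inv A [^] n) (w n j)) \<and> (\<forall>j>0. M \<le> gp \<one> (b [^] n) (v n j))
      \<and> (\<forall>i\<in>{..<k}. cmod (F (v n (Suc (2 * (k - i - 1)))) - F (w n (Suc (2 * i))) - (L' \<one> - L \<one>)) < \<epsilon>)"
    (is "eventually ?good _")
    using close by (intro eventually_conj eventually_ge_at_top)
  then obtain n where "?good n"
    using eventually_happens'[OF sequentially_bot] by blast
  then have n: "n0 \<le> n" "inj (w n)" "\<And>j. j > 0 \<Longrightarrow> M \<le> gp \<one> (inv A [^] n) (w n j)"
    "\<And>j. j > 0 \<Longrightarrow> M \<le> gp \<one> (b [^] n) (v n j)"
    "\<And>i. i < k \<Longrightarrow> cmod (F (v n (Suc (2 * (k - i - 1)))) - F (w n (Suc (2 * i))) - (L' \<one> - L \<one>)) < \<epsilon>"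
    by (elim conjE, (assumption | blast))+
  define p where "p i = w n (Suc (2 * i))" for i
  define q where "q i = v n (Suc (2 * (k - i - 1)))" for i
  have pq: "p i \<in> carrier G" "q i \<in> carrier G" for i
    by (simp_all add: p_def q_def w_def v_def)
  define h where "h = alternating (A [^] n) (b [^] n) (2 * k)"
  have h: "p i \<otimes> h = q i" if "i < k" for i
  proof -
    \<comment> \<open>The inverse of \<open>p i\<close> is the prefix of length
      \<open>2 * i + 1\<close> of the word \<open>h\<close>, and \<open>q i\<close> is the rest of
      that word.\<close>
    have k: "2 * k = Suc (2 * i) + Suc (2 * (k - i - 1))" using that by simp
    have "p i = inv (alternating (A [^] n) (b [^] n) (Suc (2 * i)))"
      unfolding p_def w_def by (subst inv_alternating) (simp_all add: nat_pow_inv)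
    moreover have "h = alternating (A [^] n) (b [^] n) (Suc (2 * i)) \<otimes> q i"
      unfolding h_def k by (subst alternating_add) (simp_all add: q_def v_def)
    ultimately show ?thesis
      using pq[of i] by (simp add: m_assoc[symmetric] del: alternating.simps)
  qed
  \<comment> \<open>Distinctness of the \<open>p i\<close> turns the sum over \<open>i\<close> into
    a sum over a subset of the group, where \<open>C\<close> applies.\<close>
  have inj: "inj_on p {..<k}"
    using n(2) by (intro inj_onI) (auto simp: p_def dest: injD)
  have "(\<Sum>i<k. (cmod (\<beta> (p i) (q i)))\<^sup>2) = (\<Sum>x\<in>p ` {..<k}. (cmod (\<beta> x (x \<otimes> h)))\<^sup>2)"
    by (simp add: sum.reindex[OF inj] h)
  also have "\<dots> \<le> C"
    using pq by (intro C) (auto simp: h_def)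
  finally have sum: "(\<Sum>i<k. (cmod (\<beta> (p i) (q i)))\<^sup>2) \<le> C" .
  have "M \<le> gp \<one> (p i) (inv A [^] n)" "M \<le> gp \<one> (q i) (b [^] n)" for i
    using n(3)[of "Suc (2 * i)"] n(4)[of "Suc (2 * (k - i - 1))"] by (simp_all add: p_def q_def gp_commute)
  then show ?thesis
    using n(1,5) sum by (intro exI[of _ n] conjI exI[of _ p] exI[of _ q]) (simp_all add: p_def q_def)
qed

text \<open>\<open>f\<close> is a bump around the repelling end of \<open>a\<close>, and
  \<open>k\<close> one around the attracting end of \<open>b\<close>. By \<open>z\<close> no
  translate of the axis of \<open>a\<close> joins these two ends; only finitely many points near
  \<open>\<one>\<close> have to be considered, so deep enough shadows avoid all the translates at
  once.\<close>

lemma wedge_separating_ends: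
  assumes a: "loxodromic a" and b: "loxodromic b"
    and ab: "\<not> coterminal \<one> (\<lambda>n. a [^] n) (\<lambda>n. b [^] n)" "\<not> coterminal \<one> (\<lambda>n. inv a [^] n) (\<lambda>n. b [^] n)"
    and z: "\<forall>z\<in>carrier G.
      \<not> (coterminal \<one> (\<lambda>n. z \<otimes> inv a [^] n) (\<lambda>n. inv a [^] n) \<and> coterminal \<one> (\<lambda>n. z \<otimes> a [^] n) (\<lambda>n. b [^] n))
      \<and> \<not> (coterminal \<one> (\<lambda>n. z \<otimes> a [^] n) (\<lambda>n. inv a [^] n) \<and> coterminal \<one> (\<lambda>n. z \<otimes> inv a [^] n) (\<lambda>n. b [^] n))"
  shows "\<exists>f k C D M n0. bump_pair f k C D \<and> (\<forall>z\<in>carrier G. \<forall>n :: nat. wedge f k z (z \<otimes> a [^] n) = 0)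
    \<and> (\<forall>n\<ge>n0 :: nat. \<forall>w w'. M \<le> gp \<one> w' (b [^] n) \<longrightarrow>
        (M \<le> gp \<one> w (inv a [^] n) \<longrightarrow> 1 / 4 \<le> wedge f k w w') \<and> (M \<le> gp \<one> w (a [^] n) \<longrightarrow> wedge f k w w' = 0))"
proof -
  have [simp]: "a \<in> carrier G" "b \<in> carrier G" using a b by simp_all
  note rays = loxodromic_coterminal[OF a] loxodromic_coterminal[OF b] loxodromic_coterminal[OF loxodromic_inv[OF a]]
  have zrays: "coterminal \<one> (\<lambda>n. z \<otimes> a [^] n) (\<lambda>n. z \<otimes> a [^] n)"
    "coterminal \<one> (\<lambda>n. z \<otimes> inv a [^] n) (\<lambda>n. z \<otimes> inv a [^] n)" if "z \<in> carrier G" for z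
    using rays that by (auto simp: coterminal_left_iff image_subset_iff)
  obtain Da where Da: "\<And>(m :: nat) (n :: nat). gp \<one> (inv a [^] m) (a [^] n) \<le> Da"
    using loxodromic_bound[OF a] by blast
  then have Da': "gp \<one> (inv (inv a) [^] m) (inv a [^] n) \<le> Da" for m n :: nat
    by (simp add: gp_commute[of \<one> "a [^] m"])
  obtain Db where Db: "\<And>(m :: nat) (n :: nat). gp \<one> (inv b [^] m) (b [^] n) \<le> Db"
    using loxodromic_bound[OF b] by blast
  obtain B1 B2 where B12: "\<And>(i :: nat) (j :: nat). gp \<one> (a [^] i) (b [^] j) \<le> B1"
      "\<And>(i :: nat) (j :: nat). gp \<one> (inv a [^] i) (b [^] j) \<le> B2"
    using not_coterminal_bound[OF rays(1,2) ab(1)] not_coterminal_bound[OF rays(3,2) ab(2)] by metis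
  define B where "B = max Da (max B1 B2)"
  have B: "gp \<one> (a [^] i) (b [^] j) \<le> B" "gp \<one> (inv a [^] i) (b [^] j) \<le> B"
    "gp \<one> (a [^] i) (inv a [^] j) \<le> B" for i j :: nat
    using B12(1)[of i j] B12(2)[of i j] Da[of j i] gp_commute[of \<one> "a [^] i" "inv a [^] j"]
    by (auto simp: B_def)
  have "0 \<le> B"
    using B(1)[of 0 0] gp_nonneg order_trans by blast
  define D where "D = B + 2 * \<delta>"
  define R where "R = d \<one> a + 2 * max Da D + 2 * \<delta>"
  define Z where "Z = {z \<in> carrier G. d \<one> z \<le> R}"
  \<comment> \<open>A translated axis running from one support to the other must pass through
    \<open>Z\<close>. At each point of \<open>Z\<close>, in either orientation, one of the two ends
    stays away from its target by a bounded product.\<close>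
  have "\<exists>b'. ((\<forall>(i :: nat) (n :: nat). gp \<one> (z \<otimes> inv a [^] i) (inv a [^] n) \<le> b')
          \<or> (\<forall>(i :: nat) (n :: nat). gp \<one> (z \<otimes> a [^] i) (b [^] n) \<le> b'))
      \<and> ((\<forall>(i :: nat) (n :: nat). gp \<one> (z \<otimes> a [^] i) (inv a [^] n) \<le> b')
          \<or> (\<forall>(i :: nat) (n :: nat). gp \<one> (z \<otimes> inv a [^] i) (b [^] n) \<le> b'))" if "z \<in> Z" for z
  proof -
    have zG: "z \<in> carrier G" using that by (simp add: Z_def)
    have "\<exists>b'. (\<forall>(i :: nat) (n :: nat). gp \<one> (z \<otimes> inv a [^] i) (inv a [^] n) \<le> b')
          \<or> (\<forall>(i :: nat) (n :: nat). gp \<one> (z \<otimes> a [^] i) (b [^] n) \<le> b')"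
      using bspec[OF z zG] not_coterminal_bound[OF zrays(2)[OF zG] rays(3)] not_coterminal_bound[OF zrays(1)[OF zG] rays(2)]
      by metis
    moreover have "\<exists>b'. (\<forall>(i :: nat) (n :: nat). gp \<one> (z \<otimes> a [^] i) (inv a [^] n) \<le> b')
          \<or> (\<forall>(i :: nat) (n :: nat). gp \<one> (z \<otimes> inv a [^] i) (b [^] n) \<le> b')"
      using bspec[OF z zG] not_coterminal_bound[OF zrays(1)[OF zG] rays(3)] not_coterminal_bound[OF zrays(2)[OF zG] rays(2)]
      by metis
    ultimately obtain b1 b2 where
      "(\<forall>(i :: nat) (n :: nat). gp \<one> (z \<otimes> inv a [^] i) (inv a [^] n) \<le> b1)
          \<or> (\<forall>(i :: nat) (n :: nat). gp \<one> (z \<otimes> a [^] i) (b [^] n) \<le> b1)"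
      "(\<forall>(i :: nat) (n :: nat). gp \<one> (z \<otimes> a [^] i) (inv a [^] n) \<le> b2)
          \<or> (\<forall>(i :: nat) (n :: nat). gp \<one> (z \<otimes> inv a [^] i) (b [^] n) \<le> b2)"
      by blast
    then show ?thesis
      by (intro exI[of _ "max b1 b2"]) (meson max.coboundedI1 max.coboundedI2)
  qed
  then obtain b' where b': "\<And>z. z \<in> Z \<Longrightarrow>
      ((\<forall>(i :: nat) (n :: nat). gp \<one> (z \<otimes> inv a [^] i) (inv a [^] n) \<le> b' z)
          \<or> (\<forall>(i :: nat) (n :: nat). gp \<one> (z \<otimes> a [^] i) (b [^] n) \<le> b' z))
      \<and> ((\<forall>(i :: nat) (n :: nat). gp \<one> (z \<otimes> a [^] i) (inv a [^] n) \<le> b' z)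
          \<or> (\<forall>(i :: nat) (n :: nat). gp \<one> (z \<otimes> inv a [^] i) (b [^] n) \<le> b' z))"
    by metis
  define S where "S = (\<Sum>z\<in>Z. \<bar>b' z\<bar>)"
  have "finite Z"
    by (simp add: Z_def finite_ball)
  then have S: "b' z \<le> S" if "z \<in> Z" for z
    using member_le_sum[of z Z "\<lambda>z. \<bar>b' z\<bar>"] that by (auto simp: S_def)
  have "0 \<le> S"
    by (simp add: S_def sum_nonneg)
  \<comment> \<open>\<open>S\<close> keeps the supports off the axes through \<open>Z\<close>,
    \<open>B\<close> separates them from each other and from the remaining ends, and the copies of
    \<open>\<delta>\<close> absorb the loss in \<open>shadow_bump\<close> and the uses of
    hyperbolicity.\<close>
  define T where "T = B + S + 10 * \<delta>"
  obtain N1 N2 where N12: "\<And>n :: nat. n \<ge> N1 \<Longrightarrow> T + \<delta> + Da \<le> d \<one> (inv a [^] n)"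
    "\<And>n :: nat. n \<ge> N2 \<Longrightarrow> T + \<delta> + Db \<le> d \<one> (b [^] n)"
    using loxodromic_far[OF loxodromic_inv[OF a]] loxodromic_far[OF b] by meson
  define N where "N = max N1 N2"
  define u where "u = inv a [^] N"
  define v where "v = b [^] N"
  have u: "T + \<delta> \<le> gp \<one> (inv a [^] n) u" if "N \<le> n" for n
    using loxodromic_gp_ge[OF _ Da' that] N12(1)[of N] by (simp add: u_def N_def gp_commute)
  have v: "T + \<delta> \<le> gp \<one> (b [^] n) v" if "N \<le> n" for n
    using loxodromic_gp_ge[OF _ Db that] N12(2)[of N] by (simp add: v_def N_def gp_commute)
  obtain f Cf where f: "\<And>x. 0 \<le> f x" "\<And>x. f x \<le> 1" "\<And>x y. \<bar>f x - f y\<bar> \<le> Cf * closeness \<one> x y"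
    "\<And>x. T \<le> gp \<one> x u \<Longrightarrow> 1 / 2 \<le> f x" "\<And>x. f x \<noteq> 0 \<Longrightarrow> T - 4 * \<delta> < gp \<one> x u" "0 \<le> Cf"
    using shadow_bump[of \<one> T u] by blast
  obtain k Ck where k: "\<And>x. 0 \<le> k x" "\<And>x. k x \<le> 1" "\<And>x y. \<bar>k x - k y\<bar> \<le> Ck * closeness \<one> x y"
    "\<And>x. T \<le> gp \<one> x v \<Longrightarrow> 1 / 2 \<le> k x" "\<And>x. k x \<noteq> 0 \<Longrightarrow> T - 4 * \<delta> < gp \<one> x v" "0 \<le> Ck"
    using shadow_bump[of \<one> T v] by blast
  define C where "C = max Cf Ck"
  have C: "Cf * closeness \<one> x y \<le> C * closeness \<one> x y" "Ck * closeness \<one> x y \<le> C * closeness \<one> x y" for x y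
    by (intro mult_right_mono; simp add: C_def closeness_def)+
  have sep: "gp \<one> x y \<le> D" if "f x \<noteq> 0" "k y \<noteq> 0" for x y
    using f(5)[OF that(1)] k(5)[OF that(2)] B(2)[of N N] gp_hypD[of \<one> u x v] gp_hypD[of \<one> x y v]
      gp_commute[of \<one> u x] delta_pos \<open>0 \<le> S\<close>
    by (simp add: D_def T_def u_def v_def)
  have fB: "f w = 0" if "T + \<delta> \<le> gp \<one> w x" "gp \<one> x u \<le> B" for w x
    using f(5)[of w] that gp_hypD[of \<one> x w u] gp_commute[of \<one> x w] delta_pos \<open>0 \<le> S\<close>
    by (auto simp: T_def)
  \<comment> \<open>Some point \<open>z'\<close> of the path from \<open>z\<close> to
    \<open>z \<otimes> a [^] n\<close> lies in \<open>Z\<close>. Both endpoints are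
    \<open>z'\<close> times powers of \<open>a\<close>, so if both factors were nonzero, two
    products would exceed \<open>S\<close>, against \<open>b'\<close>.\<close>
  have on: "z \<in> carrier G \<Longrightarrow> gp \<one> z (z \<otimes> a [^] n) \<le> D \<Longrightarrow>
      (f z = 0 \<or> k (z \<otimes> a [^] n) = 0) \<and> (k z = 0 \<or> f (z \<otimes> a [^] n) = 0)" for z and n :: nat
  proof -
    assume z: "z \<in> carrier G" and "gp \<one> z (z \<otimes> a [^] n) \<le> D"
    moreover have "d (z \<otimes> a [^] m) (z \<otimes> a [^] Suc m) \<le> d \<one> a" for m :: nat
      using z by (simp add: d_left d_mult)
    moreover have "gp (z \<otimes> a [^] m) (z \<otimes> a [^] (0 :: nat)) (z \<otimes> a [^] n) \<le> max Da D" if "m \<le> n" for m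
      using loxodromic_middle[OF _ Da, of 0 m n] gp_left[of z "a [^] m" "a [^] (0 :: nat)" "a [^] n"] z that
      by simp
    ultimately obtain j where j: "j \<le> n" "d \<one> (z \<otimes> a [^] j) \<le> R"
      using quasigeodesic_passes_near[of "\<lambda>m. z \<otimes> a [^] m" "d \<one> a" n "max Da D" \<one>]
      unfolding R_def by fastforce
    define z' where "z' = z \<otimes> a [^] j"
    have z': "z' \<in> Z"
      using j z by (simp add: z'_def Z_def)
    have "z = z' \<otimes> inv a [^] j" "z \<otimes> a [^] n = z' \<otimes> a [^] (n - j)"
      using z j by (simp_all add: z'_def m_assoc nat_pow_mult nat_pow_inv)
    then show ?thesis
      using b'[OF z'] S[OF z'] f(5) k(5) delta_pos \<open>0 \<le> B\<close> unfolding T_def u_def v_def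
      by (smt (verit))
  qed
  have axis: "wedge f k z (z \<otimes> a [^] n) = 0" if "z \<in> carrier G" for z and n :: nat
      using on[OF that, of n] sep[of z "z \<otimes> a [^] n"] sep[of "z \<otimes> a [^] n" z]
      by (fastforce simp: wedge_def gp_commute)
  have large: "1 / 4 \<le> wedge f k w w'"
      if "N \<le> n" "T + \<delta> \<le> gp \<one> w (inv a [^] n)" "T + \<delta> \<le> gp \<one> w' (b [^] n)" for n w w'
    proof -
      have "T \<le> gp \<one> w u"
        using gp_hypD[of \<one> w "inv a [^] n" u] u[OF that(1)] that(2) by linarith
      moreover have "T \<le> gp \<one> w' v"
        using gp_hypD[of \<one> w' "b [^] n" v] v[OF that(1)] that(3) by linarith
      moreover have "f w' = 0"
        using fB[OF that(3)] B(2)[of N n] by (simp add: u_def gp_commute)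
      moreover have "1 / 2 * (1 / 2) \<le> f w * k w'"
        using calculation by (intro mult_mono f k) auto
      ultimately show ?thesis by (simp add: wedge_def)
    qed
  have zero: "wedge f k w w' = 0"
      if "N \<le> n" "T + \<delta> \<le> gp \<one> w (a [^] n)" "T + \<delta> \<le> gp \<one> w' (b [^] n)" for n w w'
      using fB[OF that(2)] fB[OF that(3)] B(2)[of N n] B(3)[of n N] by (simp add: wedge_def u_def gp_commute)
  have "\<bar>f x - f y\<bar> \<le> C * closeness \<one> x y" "\<bar>k x - k y\<bar> \<le> C * closeness \<one> x y" for x y
      using f(3)[of x y] k(3)[of x y] C[of x y] by linarith+
  then have bump: "bump_pair f k C D"
    using f k sep by (auto simp: bump_pair_def)
  show ?thesis
    by (intro exI[of _ f] exI[of _ k] exI[of _ C] exI[of _ D] exI[of _ "T + \<delta>"] exI[of _ N] conjI ballI allI impI)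
      (rule bump axis large zero; assumption)+
qed

section \<open>The wedge has no bounded primitive\<close>

lemma coterminal_conj_iff:
  assumes "a \<in> carrier G" "z \<in> carrier G"
  shows "coterminal \<one> (\<lambda>n :: nat. (z \<otimes> a \<otimes> inv z) [^] n) v \<longleftrightarrow> coterminal \<one> (\<lambda>n. z \<otimes> a [^] n) v"
proof
  assume "coterminal \<one> (\<lambda>n :: nat. (z \<otimes> a \<otimes> inv z) [^] n) v"
  moreover have "(z \<otimes> a \<otimes> inv z) [^] n \<otimes> z = z \<otimes> a [^] n" for n :: nat
    using assms by (subst conj_pow) (simp_all add: m_assoc)
  ultimately show "coterminal \<one> (\<lambda>n. z \<otimes> a [^] n) v"
    using coterminal_right[of "\<lambda>n :: nat. (z \<otimes> a \<otimes> inv z) [^] n" v z] assms by (simp add: image_subset_iff)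
next
  assume "coterminal \<one> (\<lambda>n. z \<otimes> a [^] n) v"
  from coterminal_right[OF this, of "inv z"] show "coterminal \<one> (\<lambda>n :: nat. (z \<otimes> a \<otimes> inv z) [^] n) v"
    using assms by (simp add: conj_pow image_subset_iff)
qed

lemma loxodromic_shared_endpoint_translate:
  assumes a: "loxodromic a" and c: "loxodromic c" and z: "z \<in> carrier G"
    and "coterminal \<one> (\<lambda>n. z \<otimes> a [^] n) (\<lambda>n. c [^] n)"
  shows "coterminal \<one> (\<lambda>n. z \<otimes> inv a [^] n) (\<lambda>n. inv c [^] n)"
proof -
  have ac: "a \<in> carrier G" using a by simp
  have "inv (z \<otimes> a \<otimes> inv z) = z \<otimes> inv a \<otimes> inv z"
    using ac z by (simp add: inv_mult_group m_assoc)
  then show ?thesis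
    using loxodromic_shared_endpoint[OF loxodromic_conj[OF a z] c] assms(4) ac z
    by (simp add: coterminal_conj_iff)
qed

lemma separating_wedge_not_bounded_primitive:
  assumes a: "loxodromic a" and y: "y \<in> carrier G"
    and ends: "\<not> coterminal \<one> (\<lambda>n. y \<otimes> a [^] n) (\<lambda>n. a [^] n)"
      "\<not> coterminal \<one> (\<lambda>n. y \<otimes> a [^] n) (\<lambda>n. inv a [^] n)"
      "\<not> coterminal \<one> (\<lambda>n. y \<otimes> inv a [^] n) (\<lambda>n. a [^] n)"
      "\<not> coterminal \<one> (\<lambda>n. y \<otimes> inv a [^] n) (\<lambda>n. inv a [^] n)"
  obtains f k :: "'g \<Rightarrow> real" and C D where
    "bump_pair f k C D"
    "\<And>F c. (\<And>h E. \<lbrakk>finite E; E \<subseteq> carrier G; h \<in> carrier G\<rbrakk> \<Longrightarrow>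
        (\<Sum>x\<in>E. (cmod (of_real (wedge f k x (x \<otimes> h)) - F x + F (x \<otimes> h)))\<^sup>2) \<le> c) \<Longrightarrow> False"
proof -
  define b where "b = y \<otimes> a \<otimes> inv y"
  have [simp]: "a \<in> carrier G" using a by simp
  have b: "loxodromic b" unfolding b_def using a y by (rule loxodromic_conj)
  then have [simp]: "b \<in> carrier G" by simp
  have invb: "inv b = y \<otimes> inv a \<otimes> inv y"
    using y by (simp add: b_def inv_mult_group m_assoc)
  have ab: "\<not> coterminal \<one> (\<lambda>n. a [^] n) (\<lambda>n. b [^] n)" "\<not> coterminal \<one> (\<lambda>n. inv a [^] n) (\<lambda>n. b [^] n)"
    "\<not> coterminal \<one> (\<lambda>n. a [^] n) (\<lambda>n. inv b [^] n)" "\<not> coterminal \<one> (\<lambda>n. inv a [^] n) (\<lambda>n. inv b [^] n)"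
    using ends y coterminal_conj_iff[of a y] coterminal_conj_iff[of "inv a" y] coterminal_sym
    unfolding invb unfolding b_def by (metis \<open>a \<in> carrier G\<close> inv_closed)+
  note lox = a b loxodromic_inv[OF a] loxodromic_inv[OF b]
  have "\<exists>B. \<forall>(m :: nat) (n :: nat). gp \<one> (a [^] m) (inv b [^] n) \<le> B \<and> gp \<one> (inv a [^] m) (b [^] n) \<le> B
      \<and> gp \<one> (inv a [^] m) (inv b [^] n) \<le> B \<and> gp \<one> (inv (inv a) [^] m) (b [^] n) \<le> B"
  proof -
    obtain B1 B2 B3 B4 where "\<And>(m :: nat) (n :: nat). gp \<one> (a [^] m) (inv b [^] n) \<le> B1"
      "\<And>(m :: nat) (n :: nat). gp \<one> (inv a [^] m) (b [^] n) \<le> B2"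
      "\<And>(m :: nat) (n :: nat). gp \<one> (inv a [^] m) (inv b [^] n) \<le> B3"
      "\<And>(m :: nat) (n :: nat). gp \<one> (a [^] m) (b [^] n) \<le> B4"
      using not_coterminal_bound[OF lox(1,4)[THEN loxodromic_coterminal] ab(3)]
        not_coterminal_bound[OF lox(3,2)[THEN loxodromic_coterminal] ab(2)]
        not_coterminal_bound[OF lox(3,4)[THEN loxodromic_coterminal] ab(4)]
        not_coterminal_bound[OF lox(1,2)[THEN loxodromic_coterminal] ab(1)]
      by metis
    then show ?thesis
      by (intro exI[of _ "max (max B1 B2) (max B3 B4)"]) (simp add: le_max_iff_disj)
  qed
  then obtain B where B: "\<And>(m :: nat) (n :: nat). gp \<one> (a [^] m) (inv b [^] n) \<le> B"
    "\<And>(m :: nat) (n :: nat). gp \<one> (inv a [^] m) (b [^] n) \<le> B"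
    "\<And>(m :: nat) (n :: nat). gp \<one> (inv a [^] m) (inv b [^] n) \<le> B"
    "\<And>(m :: nat) (n :: nat). gp \<one> (inv (inv a) [^] m) (b [^] n) \<le> B"
    by blast
  \<comment> \<open>An element taking one end of \<open>a\<close> to the repelling end takes the
    other one to the attracting end, by \<open>loxodromic_shared_endpoint_translate\<close>, and
    this is not the attracting end of \<open>b\<close>.\<close>
  have z: "\<forall>z\<in>carrier G. \<not> (coterminal \<one> (\<lambda>n. z \<otimes> inv a [^] n) (\<lambda>n. inv a [^] n) \<and> coterminal \<one> (\<lambda>n. z \<otimes> a [^] n) (\<lambda>n. b [^] n))
      \<and> \<not> (coterminal \<one> (\<lambda>n. z \<otimes> a [^] n) (\<lambda>n. inv a [^] n) \<and> coterminal \<one> (\<lambda>n. z \<otimes> inv a [^] n) (\<lambda>n. b [^] n))"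
  proof
    fix z assume z: "z \<in> carrier G"
    show "\<not> (coterminal \<one> (\<lambda>n. z \<otimes> inv a [^] n) (\<lambda>n. inv a [^] n) \<and> coterminal \<one> (\<lambda>n. z \<otimes> a [^] n) (\<lambda>n. b [^] n))
      \<and> \<not> (coterminal \<one> (\<lambda>n. z \<otimes> a [^] n) (\<lambda>n. inv a [^] n) \<and> coterminal \<one> (\<lambda>n. z \<otimes> inv a [^] n) (\<lambda>n. b [^] n))"
      using loxodromic_shared_endpoint_translate[OF lox(3,3) z] loxodromic_shared_endpoint_translate[OF lox(1,3) z]
        ab(1) coterminal_trans[of \<one> "\<lambda>n. a [^] n"] coterminal_sym[of \<one> _ "\<lambda>n. a [^] n"] by auto
  qed
  obtain f k C D M n0 where fk: "bump_pair f k C D"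
    and axis: "\<forall>z\<in>carrier G. \<forall>n :: nat. wedge f k z (z \<otimes> a [^] n) = 0"
    and ends: "\<forall>n\<ge>n0 :: nat. \<forall>w w'. M \<le> gp \<one> w' (b [^] n) \<longrightarrow>
        (M \<le> gp \<one> w (inv a [^] n) \<longrightarrow> 1 / 4 \<le> wedge f k w w') \<and> (M \<le> gp \<one> w (a [^] n) \<longrightarrow> wedge f k w w' = 0)"
    using wedge_separating_ends[OF a b ab(1,2) z] by (elim exE conjE) (rule that)
  have False
    if c: "\<And>h E. \<lbrakk>finite E; E \<subseteq> carrier G; h \<in> carrier G\<rbrakk> \<Longrightarrow>
        (\<Sum>x\<in>E. (cmod (of_real (wedge f k x (x \<otimes> h)) - F x + F (x \<otimes> h)))\<^sup>2) \<le> c" for F c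
  proof -
    define \<beta> where "\<beta> x x' = of_real (wedge f k x x') - F x + F x'" for x x'
    have \<beta>: "(\<Sum>x\<in>E. (cmod (\<beta> x (x \<otimes> h)))\<^sup>2) \<le> c" if "finite E" "E \<subseteq> carrier G" "h \<in> carrier G" for h E
      unfolding \<beta>_def using that by (rule c)
    have "(\<Sum>x\<in>E. (cmod (F x - F (x \<otimes> a [^] n)))\<^sup>2) \<le> c" if E: "finite E" "E \<subseteq> carrier G" for n :: nat and E
    proof -
      have "(\<Sum>x\<in>E. (cmod (F x - F (x \<otimes> a [^] n)))\<^sup>2) = (\<Sum>x\<in>E. (cmod (\<beta> x (x \<otimes> a [^] n)))\<^sup>2)"
        using E axis by (intro sum.cong) (auto simp: \<beta>_def norm_minus_commute)
      then show ?thesis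
        using \<beta>[OF E, of "a [^] n"] by simp
    qed
    then have "\<exists>L. (\<forall>x\<in>carrier G. \<forall>n :: nat. L (x \<otimes> a [^] n) = L x \<and> L (x \<otimes> inv a [^] n) = L x)
        \<and> vanishing (\<lambda>x. F x - L x)"
      by (rule limit_along_loxodromic[OF a])
    then obtain L where L0: "\<forall>x\<in>carrier G. \<forall>n :: nat. L (x \<otimes> a [^] n) = L x \<and> L (x \<otimes> inv a [^] n) = L x"
      and Lvan: "vanishing (\<lambda>x. F x - L x)"
      by (elim exE conjE)
    have L: "L (x \<otimes> a [^] n) = L x" "L (x \<otimes> inv a [^] n) = L x" if "x \<in> carrier G" for x and n :: nat
      using L0 that by blast+
    \<comment> \<open>\<open>b\<close> is the conjugate of \<open>a\<close> by \<open>y\<close>, so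
      \<open>x \<otimes> b [^] n \<otimes> y = x \<otimes> y \<otimes> a [^] n\<close> turns
      invariance of \<open>L\<close> under \<open>a\<close> into invariance of \<open>L'\<close>
      under \<open>b\<close>.\<close>
    define L' where "L' x = L (x \<otimes> y)" for x
    have L': "L' (x \<otimes> b [^] n) = L' x" "L' (x \<otimes> inv b [^] n) = L' x" if "x \<in> carrier G" for x and n :: nat
    proof -
      have "x \<otimes> b [^] n \<otimes> y = x \<otimes> y \<otimes> a [^] n" "x \<otimes> inv b [^] n \<otimes> y = x \<otimes> y \<otimes> inv a [^] n"
        unfolding invb unfolding b_def using that y by (simp_all only: conj_pow inv_closed \<open>a \<in> carrier G\<close>) (simp_all add: m_assoc)
      then show "L' (x \<otimes> b [^] n) = L' x" "L' (x \<otimes> inv b [^] n) = L' x"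
        using L[of "x \<otimes> y" n] that y by (simp_all add: L'_def)
    qed
    \<comment> \<open>A nonzero wedge bounds \<open>gp \<one> x (x \<otimes> y)\<close>, which is at
      least \<open>d \<one> x - d \<one> y\<close>; so this function has finite support. Hence
      \<open>F x\<close> and \<open>F (x \<otimes> y)\<close> have a vanishing difference.\<close>
    have "vanishing (\<lambda>x. of_real (wedge f k x (x \<otimes> y)))"
      unfolding vanishing_def
    proof (intro allI impI)
      fix \<epsilon> :: real assume "0 < \<epsilon>"
      have "d \<one> x \<le> D + d \<one> y" if "x \<in> carrier G" "wedge f k x (x \<otimes> y) \<noteq> 0" for x
        using wedge_nonzeroD[OF fk that(2)] gp_lipschitz2[of \<one> x x "x \<otimes> y"] d_mult[OF that(1) y]
          gp_def[of \<one> x x]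
        by simp
      with \<open>0 < \<epsilon>\<close> show "finite {x \<in> carrier G. \<epsilon> \<le> cmod (of_real (wedge f k x (x \<otimes> y)))}"
        by (intro finite_subset[OF _ finite_ball[of "D + d \<one> y"]]) auto
    qed
    moreover have "vanishing (\<lambda>x. - \<beta> x (x \<otimes> y))"
      using \<beta>[OF _ _ y] by (intro vanishing_of_square_sums) simp
    ultimately have "vanishing (\<lambda>x. (of_real (wedge f k x (x \<otimes> y)) + - \<beta> x (x \<otimes> y)) + (F (x \<otimes> y) - L (x \<otimes> y)))"
      by (intro vanishing_add vanishing_right[OF Lvan y])
    then have L'van: "vanishing (\<lambda>x. F x - L' x)"
      by (simp add: \<beta>_def L'_def)
    have Linv: "L (x \<otimes> inv (inv a) [^] n) = L x" if "x \<in> carrier G" for x and n :: nat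
      using L(1)[OF that] by simp
    define t where "t = L' \<one> - L \<one>"
    have pairs: "\<exists>n\<ge>n0. \<exists>p q. (\<forall>i<j. M \<le> gp \<one> (p i) (inv A [^] n) \<and> M \<le> gp \<one> (q i) (b [^] n)
          \<and> cmod (F (q i) - F (p i) - (L' \<one> - L \<one>)) < \<epsilon>) \<and> (\<Sum>i<j. (cmod (\<beta> (p i) (q i)))\<^sup>2) \<le> c"
      if "loxodromic A" "\<And>(m :: nat) (n :: nat). gp \<one> (A [^] m) (inv b [^] n) \<le> B"
        "\<And>(m :: nat) (n :: nat). gp \<one> (inv A [^] m) (b [^] n) \<le> B"
        "\<And>x n. x \<in> carrier G \<Longrightarrow> L (x \<otimes> A [^] (n :: nat)) = L x"
        "\<And>x n. x \<in> carrier G \<Longrightarrow> L (x \<otimes> inv A [^] (n :: nat)) = L x" "0 < \<epsilon>"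
      for A \<epsilon> and j :: nat
      by (rule equidistant_pairs[where L = L and L' = L' and F = F and \<beta> = \<beta> and B = B]; fact)
    \<comment> \<open>The bound \<open>c\<close> does not depend on the number of pairs, so the
      terms cannot all stay above a fixed positive \<open>\<eta>\<close>.\<close>
    have unbounded: False
      if \<eta>: "0 < \<eta>" and pairs: "\<And>k :: nat. \<exists>p q. (\<forall>i<k. \<eta> \<le> cmod (\<beta> (p i) (q i))) \<and> (\<Sum>i<k. (cmod (\<beta> (p i) (q i)))\<^sup>2) \<le> c" for \<eta>
    proof -
      obtain m :: nat where m: "c < m * \<eta>\<^sup>2"
        using reals_Archimedean3[of "\<eta>\<^sup>2"] \<eta> by auto
      obtain p q where pq: "\<And>i. i < m \<Longrightarrow> \<eta> \<le> cmod (\<beta> (p i) (q i))" "(\<Sum>i<m. (cmod (\<beta> (p i) (q i)))\<^sup>2) \<le> c"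
        using pairs by blast
      have "(\<Sum>i<m. \<eta>\<^sup>2) \<le> (\<Sum>i<m. (cmod (\<beta> (p i) (q i)))\<^sup>2)"
        using pq(1) \<eta> by (intro sum_mono power_mono) auto
      then show False
        using m pq(2) by simp
    qed
    \<comment> \<open>With \<open>A = inv a\<close> the \<open>p i\<close> point to the attracting
      end of \<open>a\<close>, where the wedge vanishes, so all the \<open>\<beta>\<close> are close
      to \<open>t\<close>.\<close>
    have "t = 0"
    proof (rule ccontr)
      assume "t \<noteq> 0"
      show False
      proof (rule unbounded[of "cmod t / 2"])
        fix j :: nat
        obtain n p q where "n0 \<le> n"
          and pq: "\<forall>i<j. M \<le> gp \<one> (p i) (inv (inv a) [^] n) \<and> M \<le> gp \<one> (q i) (b [^] n)
            \<and> cmod (F (q i) - F (p i) - (L' \<one> - L \<one>)) < cmod t / 2"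
          and sum: "(\<Sum>i<j. (cmod (\<beta> (p i) (q i)))\<^sup>2) \<le> c"
          using pairs[OF lox(3) B(3,4) L(2) Linv, of "cmod t / 2" j] \<open>t \<noteq> 0\<close>
          by auto
        have "cmod t / 2 \<le> cmod (\<beta> (p i) (q i))" if "i < j" for i
        proof -
          have "wedge f k (p i) (q i) = 0"
            using ends \<open>n0 \<le> n\<close> pq[rule_format, OF that] by simp
          then have "\<beta> (p i) (q i) = F (q i) - F (p i)"
            by (simp add: \<beta>_def)
          then show ?thesis
            using pq[rule_format, OF that] norm_triangle_ineq2[of t "t - \<beta> (p i) (q i)"]
            by (simp add: t_def norm_minus_commute)
        qed
        then show "\<exists>p q. (\<forall>i<j. cmod t / 2 \<le> cmod (\<beta> (p i) (q i))) \<and> (\<Sum>i<j. (cmod (\<beta> (p i) (q i)))\<^sup>2) \<le> c"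
          using sum by blast
      qed (use \<open>t \<noteq> 0\<close> in simp)
    qed
    show False
    \<comment> \<open>With \<open>A = a\<close> the wedge is at least \<open>1 / 4\<close>, while by
      \<open>t = 0\<close> the values of \<open>F\<close> differ by less than
      \<open>1 / 8\<close>.\<close>
    proof (rule unbounded[of "1 / 8"])
      fix j :: nat
      obtain n p q where "n0 \<le> n"
        and pq: "\<forall>i<j. M \<le> gp \<one> (p i) (inv a [^] n) \<and> M \<le> gp \<one> (q i) (b [^] n)
          \<and> cmod (F (q i) - F (p i) - (L' \<one> - L \<one>)) < 1 / 8"
        and sum: "(\<Sum>i<j. (cmod (\<beta> (p i) (q i)))\<^sup>2) \<le> c"
        using pairs[OF lox(1) B(1,2) L, of "1 / 8" j]
        by auto
      have "1 / 8 \<le> cmod (\<beta> (p i) (q i))" if "i < j" for i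
      proof -
        have "1 / 4 \<le> cmod (of_real (wedge f k (p i) (q i)))"
          using ends \<open>n0 \<le> n\<close> pq[rule_format, OF that] by fastforce
        moreover have "cmod (F (q i) - F (p i)) < 1 / 8"
          using pq[rule_format, OF that] \<open>t = 0\<close> by (simp add: t_def)
        ultimately show ?thesis
          using norm_triangle_ineq2[of "of_real (wedge f k (p i) (q i))" "F (p i) - F (q i)"]
          by (simp add: \<beta>_def norm_minus_commute algebra_simps)
      qed
      then show "\<exists>p q. (\<forall>i<j. 1 / 8 \<le> cmod (\<beta> (p i) (q i))) \<and> (\<Sum>i<j. (cmod (\<beta> (p i) (q i)))\<^sup>2) \<le> c"
        using sum by blast
    qed simp
  qed
  with fk show thesis by (rule that)
qed

end

section \<open>Bounded cohomology\<close>

text \<open>The neutral element of the quotient is \<open>B\<close> itself, and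
  \<open>0 \<in> B\<close> puts \<open>z\<close> into its own coset.\<close>

lemma trivial_Mod_imp_subset:
  assumes "carrier (\<lparr>carrier = Z, mult = (+), one = (0 :: 'v :: ab_group_add)\<rparr> Mod B)
      = {\<one>\<^bsub>\<lparr>carrier = Z, mult = (+), one = 0\<rparr> Mod B\<^esub>}"
    and "0 \<in> B"
  shows "Z \<subseteq> B"
proof
  fix z assume "z \<in> Z"
  then have "(\<Union>b\<in>B. {b + z}) \<in> carrier (\<lparr>carrier = Z, mult = (+), one = 0\<rparr> Mod B)"
    by (auto simp: FactGroup_def RCOSETS_def r_coset_def)
  then have "(\<Union>b\<in>B. {b + z}) = B"
    using assms(1) by (simp add: FactGroup_def)
  moreover have "0 + z \<in> (\<Union>b\<in>B. {b + z})"
    using assms(2) by blast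
  ultimately show "z \<in> B" by simp
qed

lemma tuples_one_iff: "t \<in> tuples G (Suc 0) \<longleftrightarrow> (\<exists>x\<in>carrier G. \<exists>y\<in>carrier G. t = [x, y])"
  by (auto simp: tuples_def length_Suc_conv)

lemma tuples_two_iff:
  "t \<in> tuples G (Suc (Suc 0)) \<longleftrightarrow> (\<exists>x\<in>carrier G. \<exists>y\<in>carrier G. \<exists>z\<in>carrier G. t = [x, y, z])"
  by (auto simp: tuples_def length_Suc_conv)

lemma tuples_three_iff:
  "t \<in> tuples G (Suc (Suc (Suc 0))) \<longleftrightarrow>
    (\<exists>x\<in>carrier G. \<exists>y\<in>carrier G. \<exists>z\<in>carrier G. \<exists>w\<in>carrier G. t = [x, y, z, w])"
  by (auto simp: tuples_def length_Suc_conv)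

lemma coboundary_one:
  fixes f :: "'g list \<Rightarrow> 'v :: ab_group_add"
  assumes "x \<in> carrier G" "y \<in> carrier G" "z \<in> carrier G"
  shows "coboundary G (Suc 0) f [x, y, z] = f [y, z] - f [x, z] + f [x, y]"
  using assms by (simp add: coboundary_def tuples_two_iff atMost_Suc add.commute)

lemma coboundary_coboundary_one:
  fixes f :: "'g list \<Rightarrow> 'v :: ab_group_add"
  shows "coboundary G (Suc (Suc 0)) (coboundary G (Suc 0) f) = 0"
proof
  fix t
  show "coboundary G (Suc (Suc 0)) (coboundary G (Suc 0) f) t = 0 t"
  proof (cases "t \<in> tuples G (Suc (Suc (Suc 0)))")
    case True
    then obtain x y z w where "x \<in> carrier G" "y \<in> carrier G" "z \<in> carrier G" "w \<in> carrier G"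
      "t = [x, y, z, w]"
      by (auto simp: tuples_three_iff)
    then show ?thesis
      using True by (simp add: coboundary_def[of G "Suc (Suc 0)"] atMost_Suc coboundary_one)
  qed (simp add: coboundary_def)
qed

lemma ell2_of_square_sums:
  assumes supp: "\<And>x. x \<notin> carrier G \<Longrightarrow> v x = 0"
    and bound: "\<And>E. finite E \<Longrightarrow> E \<subseteq> carrier G \<Longrightarrow> (\<Sum>x\<in>E. (cmod (v x))\<^sup>2) \<le> S"
  shows "v \<in> ell2 G" "ell2_norm G v \<le> sqrt S"
proof -
  have "(\<lambda>x. (cmod (v x))\<^sup>2) summable_on carrier G"
    using bound by (intro nonneg_bdd_above_summable_on bdd_aboveI[of _ S]) auto
  then show "v \<in> ell2 G" "ell2_norm G v \<le> sqrt S"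
    using supp bound by (auto simp: ell2_def ell2_norm_def intro!: infsum_le_finite_sums)
qed

lemma square_sum_le_ell2_norm:
  assumes "v \<in> ell2 G" "finite E" "E \<subseteq> carrier G"
  shows "(\<Sum>x\<in>E. (cmod (v x))\<^sup>2) \<le> (ell2_norm G v)\<^sup>2"
  using assms unfolding ell2_def ell2_norm_def
  by (simp add: infsum_nonneg finite_sum_le_infsum)

context hyperbolic_group
begin

text \<open>Boundedness is claimed only for the coboundary \<open>\<omega>\<close> of
  \<open>\<alpha>\<close>. A bounded primitive \<open>\<beta>\<close> would differ from
  \<open>\<alpha>\<close> by a cocycle, which is a difference of values of one function
  \<open>F\<close>, against \<open>primitive\<close>.\<close>

lemma class_C_reg_of_wedge:
  assumes countable: "countable (carrier G)" and fk: "bump_pair f k C D"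
    and primitive: "\<And>F c. (\<And>h E. \<lbrakk>finite E; E \<subseteq> carrier G; h \<in> carrier G\<rbrakk> \<Longrightarrow>
        (\<Sum>x\<in>E. (cmod (of_real (wedge f k x (x \<otimes> h)) - F x + F (x \<otimes> h)))\<^sup>2) \<le> c) \<Longrightarrow> False"
  shows "class_C_reg G"
proof -
  let ?V = "ell2 G" and ?N = "ell2_norm G" and ?\<pi> = "left_regular G"
  \<comment> \<open>\<open>\<alpha>\<close> is not cut off outside pairs; \<open>coboundary\<close>
    makes \<open>\<omega>\<close> vanish off the triples.\<close>
  define \<alpha> :: "'g list \<Rightarrow> 'g \<Rightarrow> complex" where
    "\<alpha> t g = (if g \<in> carrier G then of_real (wedge f k (inv g \<otimes> t ! 0) (inv g \<otimes> t ! 1)) else 0)" for t g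
  define \<omega> where "\<omega> = coboundary G (Suc 0) \<alpha>"
  have \<omega>: "\<omega> [x, y, z] g = (if g \<in> carrier G
      then of_real (d_wedge f k (inv g \<otimes> x) (inv g \<otimes> y) (inv g \<otimes> z)) else 0)"
    if "x \<in> carrier G" "y \<in> carrier G" "z \<in> carrier G" for x y z g
    using that by (simp add: \<omega>_def coboundary_one \<alpha>_def d_wedge_def)
  obtain S where S: "\<And>E x y z. \<lbrakk>finite E; E \<subseteq> carrier G; x \<in> carrier G; y \<in> carrier G; z \<in> carrier G\<rbrakk>
    \<Longrightarrow> (\<Sum>g\<in>E. (d_wedge f k (inv g \<otimes> x) (inv g \<otimes> y) (inv g \<otimes> z))\<^sup>2) \<le> S"
    using d_wedge_square_sum[OF fk] by blast
  have sq: "(\<Sum>g\<in>E. (cmod (\<omega> [x, y, z] g))\<^sup>2) \<le> S"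
    if "finite E" "E \<subseteq> carrier G" "x \<in> carrier G" "y \<in> carrier G" "z \<in> carrier G" for E x y z
  proof -
    have "(\<Sum>g\<in>E. (cmod (\<omega> [x, y, z] g))\<^sup>2) = (\<Sum>g\<in>E. (d_wedge f k (inv g \<otimes> x) (inv g \<otimes> y) (inv g \<otimes> z))\<^sup>2)"
      using that by (intro sum.cong) (auto simp: \<omega>)
    then show ?thesis
      using S[OF that] by simp
  qed
  have "\<omega> t \<in> ?V" "?N (\<omega> t) \<le> sqrt S" if t: "t \<in> tuples G 2" for t
  proof -
    obtain x y z where xyz: "x \<in> carrier G" "y \<in> carrier G" "z \<in> carrier G" "t = [x, y, z]"
      using t unfolding numeral_2_eq_2 tuples_two_iff by blast
    show "\<omega> t \<in> ?V" "?N (\<omega> t) \<le> sqrt S"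
      using ell2_of_square_sums[of G "\<omega> t" S] sq xyz by (auto simp: \<omega>)
  qed
  moreover have "\<omega> (map (\<lambda>x. g \<otimes> x) t) = ?\<pi> g (\<omega> t)" if g: "g \<in> carrier G" and "t \<in> tuples G 2" for g t
  proof
    fix h
    obtain x y z where xyz: "x \<in> carrier G" "y \<in> carrier G" "z \<in> carrier G" "t = [x, y, z]"
      using \<open>t \<in> tuples G 2\<close> unfolding numeral_2_eq_2 tuples_two_iff by blast
    then show "\<omega> (map (\<lambda>x. g \<otimes> x) t) h = ?\<pi> g (\<omega> t) h"
      using g by (simp add: \<omega> left_regular_def inv_mult_group m_assoc)
  qed
  moreover have "\<omega> t = 0" if "t \<notin> tuples G 2" for t
    using that by (simp add: \<omega>_def coboundary_def numeral_2_eq_2)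
  moreover have "coboundary G 2 \<omega> = 0"
    by (simp add: \<omega>_def coboundary_coboundary_one numeral_2_eq_2)
  ultimately have cocycle: "\<omega> \<in> bounded_cocycles G ?V ?N ?\<pi> 2"
    unfolding bounded_cocycles_def bounded_cochains_def by blast
  have B: "bounded_coboundaries G ?V ?N ?\<pi> 2 = coboundary G (Suc 0) ` bounded_cochains G ?V ?N ?\<pi> (Suc 0)"
    by (simp add: bounded_coboundaries_def numeral_2_eq_2)
  have "\<omega> \<notin> bounded_coboundaries G ?V ?N ?\<pi> 2"
  proof
    assume "\<omega> \<in> bounded_coboundaries G ?V ?N ?\<pi> 2"
    then obtain \<beta> where \<beta>: "\<beta> \<in> bounded_cochains G ?V ?N ?\<pi> (Suc 0)" "\<omega> = coboundary G (Suc 0) \<beta>"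
      unfolding B by blast
    then have c: "\<And>t. t \<in> tuples G (Suc 0) \<Longrightarrow> \<beta> t \<in> ?V"
      "\<exists>c. \<forall>t\<in>tuples G (Suc 0). ?N (\<beta> t) \<le> c"
      "\<And>g t. g \<in> carrier G \<Longrightarrow> t \<in> tuples G (Suc 0) \<Longrightarrow> \<beta> (map (\<lambda>x. g \<otimes> x) t) = ?\<pi> g (\<beta> t)"
      unfolding bounded_cochains_def by auto
    from c(2) obtain c' where c': "\<forall>t\<in>tuples G (Suc 0). ?N (\<beta> t) \<le> c'" by blast
    \<comment> \<open>\<open>\<alpha>\<close> minus \<open>\<beta>\<close> has zero coboundary, so
      its value on \<open>[x, x \<otimes> h]\<close> is determined by its values on pairs ending in
      \<open>\<one>\<close>. These are evaluated at the point \<open>\<one>\<close> of the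
      group.\<close>
    define F where "F x = \<alpha> [x, \<one>] \<one> - \<beta> [x, \<one>] \<one>" for x
    show False
    proof (rule primitive)
      fix h E assume E: "finite E" "E \<subseteq> carrier G" and h: "h \<in> carrier G"
      have "of_real (wedge f k x (x \<otimes> h)) - F x + F (x \<otimes> h) = \<beta> [\<one>, h] (inv x)" if "x \<in> E" for x
      proof -
        have x: "x \<in> carrier G" using that E by blast
        have "coboundary G (Suc 0) \<alpha> [x, x \<otimes> h, \<one>] = coboundary G (Suc 0) \<beta> [x, x \<otimes> h, \<one>]"
          using \<beta>(2) by (simp add: \<omega>_def)
        then have "\<alpha> [x, x \<otimes> h] - \<alpha> [x, \<one>] + \<alpha> [x \<otimes> h, \<one>] = \<beta> [x, x \<otimes> h] - \<beta> [x, \<one>] + \<beta> [x \<otimes> h, \<one>]"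
          using x h by (simp add: coboundary_one algebra_simps)
        then have "\<alpha> [x, x \<otimes> h] \<one> - \<alpha> [x, \<one>] \<one> + \<alpha> [x \<otimes> h, \<one>] \<one>
            = \<beta> [x, x \<otimes> h] \<one> - \<beta> [x, \<one>] \<one> + \<beta> [x \<otimes> h, \<one>] \<one>"
          by (auto dest: fun_cong[of _ _ "\<one>"])
        then have "\<alpha> [x, x \<otimes> h] \<one> - F x + F (x \<otimes> h) = \<beta> [x, x \<otimes> h] \<one>"
          by (simp add: F_def algebra_simps)
        moreover have "\<alpha> [x, x \<otimes> h] \<one> = of_real (wedge f k x (x \<otimes> h))"
          using x h by (simp add: \<alpha>_def)
        \<comment> \<open>By equivariance the sum over \<open>x\<close> involves only the vector
          \<open>\<beta> [\<one>, h]\<close>, whose norm is at most \<open>c'\<close> for every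
          \<open>h\<close>.\<close>
        moreover have "\<beta> [x, x \<otimes> h] = ?\<pi> x (\<beta> [\<one>, h])"
          using c(3)[of x "[\<one>, h]"] x h by (simp add: tuples_one_iff)
        ultimately show ?thesis
          using x by (simp add: left_regular_def)
      qed
      then have "(\<Sum>x\<in>E. (cmod (of_real (wedge f k x (x \<otimes> h)) - F x + F (x \<otimes> h)))\<^sup>2)
          = (\<Sum>x\<in>E. (cmod (\<beta> [\<one>, h] (inv x)))\<^sup>2)"
        by simp
      also have "\<dots> = (\<Sum>x\<in>(\<lambda>x. inv x) ` E. (cmod (\<beta> [\<one>, h] x))\<^sup>2)"
        using E by (subst sum.reindex) (auto intro: inj_on_subset[OF inv_inj])
      also have "\<dots> \<le> (?N (\<beta> [\<one>, h]))\<^sup>2"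
        using E h by (intro square_sum_le_ell2_norm c(1)) (auto simp: tuples_one_iff)
      also have "\<dots> \<le> c'\<^sup>2"
        using c' h by (intro power_mono) (auto simp: tuples_one_iff ell2_norm_def infsum_nonneg)
      finally show "(\<Sum>x\<in>E. (cmod (of_real (wedge f k x (x \<otimes> h)) - F x + F (x \<otimes> h)))\<^sup>2) \<le> c'\<^sup>2" .
    qed
  qed
  moreover have "0 \<in> bounded_coboundaries G ?V ?N ?\<pi> 2"
  proof -
    have "0 \<in> bounded_cochains G ?V ?N ?\<pi> (Suc 0)"
      by (auto simp: bounded_cochains_def ell2_def ell2_norm_def left_regular_def fun_eq_iff intro: exI[of _ 0])
    moreover have "coboundary G (Suc 0) 0 = (0 :: 'g list \<Rightarrow> 'g \<Rightarrow> complex)"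
      by (auto simp: coboundary_def fun_eq_iff intro!: sum.neutral)
    ultimately show ?thesis
      unfolding B by (metis imageI)
  qed
  ultimately have "carrier (bounded_cohomology G ?V ?N ?\<pi> 2) \<noteq> {\<one>\<^bsub>bounded_cohomology G ?V ?N ?\<pi> 2\<^esub>}"
    using trivial_Mod_imp_subset[of "bounded_cocycles G ?V ?N ?\<pi> 2" "bounded_coboundaries G ?V ?N ?\<pi> 2"] cocycle
    unfolding bounded_cohomology_def by blast
  then show ?thesis
    using countable by (simp add: class_C_reg_def Let_def is_group)
qed

end

section \<open>Proper actions have finite balls\<close>

lemma compact_open_nhd_id:
  fixes U :: "('x :: metric_space \<Rightarrow> 'x) set"
  assumes "openin compact_open_topology U" "id \<in> U"
  shows "\<exists>E \<epsilon>. finite E \<and> 0 < \<epsilon> \<and> (\<forall>h\<in>isometries. (\<forall>e\<in>E. dist (h e) e < \<epsilon>) \<longrightarrow> h \<in> U)"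
proof -
  have "generate_topology_on {{f :: 'x \<Rightarrow> 'x. f ` K \<subseteq> U} | K U. compact K \<and> open U} U"
    using assms(1) by (simp add: compact_open_topology_def openin_topology_generated_by_iff)
  then show ?thesis
    using assms(2)
  proof (induction rule: generate_topology_on.induct)
    case (Int a b)
    then obtain E1 \<epsilon>1 E2 \<epsilon>2 where
      "finite E1" "0 < \<epsilon>1" "\<forall>h\<in>isometries. (\<forall>e\<in>E1. dist (h e) e < \<epsilon>1) \<longrightarrow> h \<in> a"
      "finite E2" "0 < \<epsilon>2" "\<forall>h\<in>isometries. (\<forall>e\<in>E2. dist (h e) e < \<epsilon>2) \<longrightarrow> h \<in> b"
      by auto
    then show ?case
      by (intro exI[of _ "E1 \<union> E2"] exI[of _ "min \<epsilon>1 \<epsilon>2"]) auto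
  next
    case (UN K)
    then obtain k where "k \<in> K" "id \<in> k" by blast
    with UN.IH[of k] show ?case by blast
  next
    case (Basis s)
    then obtain K V where K: "s = {f. f ` K \<subseteq> V}" "compact K" "open V" "K \<subseteq> V"
      by auto
    \<comment> \<open>Isometries are equicontinuous: moving the centres of a cover of
      \<open>K\<close> by balls of radius \<open>r / 3\<close> by less than \<open>r / 3\<close>
      moves every point of \<open>K\<close> by less than \<open>r\<close>.\<close>
    obtain r where r: "0 < r" "(\<Union>x\<in>K. ball x r) \<subseteq> V"
      using compact_subset_open_imp_ball_epsilon_subset[OF K(2-4)] by blast
    have "\<exists>E. finite E \<and> K \<subseteq> (\<Union>x\<in>E. ball x (r / 3))"
      using K(2) r(1) compact_eq_totally_bounded[of K] by simp
    then obtain E where E: "finite E" "K \<subseteq> (\<Union>x\<in>E. ball x (r / 3))"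
      by blast
    have "h x \<in> V" if h: "h \<in> isometries" "\<forall>e\<in>E. dist (h e) e < r / 3" and "x \<in> K" for h x
    proof -
      obtain e where e: "e \<in> E" "dist e x < r / 3"
        using E(2) \<open>x \<in> K\<close> by auto
      have "dist (h e) (h x) = dist e x"
        using h(1) by (simp add: isometries_def)
      moreover have "dist (h e) e < r / 3"
        using h(2) e(1) by blast
      ultimately have "dist x (h x) < r"
        using e(2) dist_triangle[of x "h x" e] dist_triangle[of e "h x" "h e"]
          dist_commute[of x e] dist_commute[of e "h e"] by linarith
      then show ?thesis
        using r(2) \<open>x \<in> K\<close> by (auto simp: subset_iff)
    qed
    then show ?case
      using E(1) r(1) by (intro exI[of _ E] exI[of _ "r / 3"]) (auto simp: K(1))
  qed auto
qed

context
  fixes G :: "('g, 'm) monoid_scheme" (structure) and \<rho> :: "'g \<Rightarrow> 'x :: metric_space \<Rightarrow> 'x"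
  assumes G: "group G" and \<rho>: "isometric_action G \<rho>"
begin

interpretation group G by (rule G)

lemma isometric_action_group_hom: "group_hom G Isom \<rho>"
  using G \<rho> group_Isom by (simp add: group_hom_def group_hom_axioms_def isometric_action_def)

lemma action_isometry: "g \<in> carrier G \<Longrightarrow> \<rho> g \<in> isometries"
  using \<rho> by (auto simp: isometric_action_def hom_def Isom_def)

lemma action_dist: "g \<in> carrier G \<Longrightarrow> dist (\<rho> g x) (\<rho> g y) = dist x y"
  using action_isometry by (auto simp: isometries_def)

lemma action_mult: "g \<in> carrier G \<Longrightarrow> h \<in> carrier G \<Longrightarrow> \<rho> (g \<otimes> h) x = \<rho> g (\<rho> h x)"
  using \<rho> by (auto simp: isometric_action_def hom_def Isom_def)

lemma action_one: "\<rho> \<one> = id"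
  using group_hom.hom_one[OF isometric_action_group_hom] by (simp add: Isom_def)

lemma action_inv: "g \<in> carrier G \<Longrightarrow> \<rho> g (\<rho> (inv g) x) = x" "g \<in> carrier G \<Longrightarrow> \<rho> (inv g) (\<rho> g x) = x"
  using action_mult[of g "inv g" x] action_mult[of "inv g" g x] action_one by simp_all

text \<open>By discreteness, an element moving the finite set \<open>E\<close> by less than
  \<open>\<epsilon>\<close> lies in the kernel. Elements of bounded displacement send
  \<open>E\<close> into compact balls, so up to \<open>\<epsilon> / 2\<close> their values on
  \<open>E\<close> are among finitely many; two elements with the same choice differ by the finite
  kernel.\<close>

lemma proper_action_finite_ball:
  assumes proper: "proper_space TYPE('x)" and action: "proper_action G \<rho>"
  shows "finite {g \<in> carrier G. dist p (\<rho> g p) \<le> R}"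
proof -
  let ?A = "{g \<in> carrier G. dist p (\<rho> g p) \<le> R}"
  have "openin (subtopology Isom_topology (\<rho> ` carrier G)) {id}"
    using action one_closed action_one by (auto simp: proper_action_def intro!: image_eqI[of _ _ "\<one>"])
  then obtain U where U: "openin compact_open_topology U" "{id} = U \<inter> isometries \<inter> \<rho> ` carrier G"
    unfolding Isom_topology_def openin_subtopology by blast
  then have "id \<in> U" by blast
  from compact_open_nhd_id[OF U(1) this] obtain E \<epsilon> where E: "finite E" "0 < \<epsilon>"
    "\<forall>h\<in>isometries. (\<forall>e\<in>E. dist (h e) e < \<epsilon>) \<longrightarrow> h \<in> U"
    by (elim exE conjE)
  have trivial: "\<rho> g = id" if "g \<in> carrier G" "\<And>e. e \<in> E \<Longrightarrow> dist (\<rho> g e) e < \<epsilon>" for g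
  proof -
    have "\<rho> g \<in> U"
      using E(3) action_isometry[OF that(1)] that(2) by blast
    then show ?thesis
      using action_isometry[OF that(1)] that(1) U(2) by blast
  qed
  have "\<exists>N. finite N \<and> cball p (R + dist p e) \<subseteq> (\<Union>x\<in>N. ball x (\<epsilon> / 2))" for e
    using proper E(2) compact_eq_totally_bounded[of "cball p (R + dist p e)"]
    by (simp add: proper_space_def)
  then obtain N where "\<forall>e. finite (N e) \<and> cball p (R + dist p e) \<subseteq> (\<Union>x\<in>N e. ball x (\<epsilon> / 2))"
    using choice[of "\<lambda>e N. finite N \<and> cball p (R + dist p e) \<subseteq> (\<Union>x\<in>N. ball x (\<epsilon> / 2))"] by blast
  then have N: "finite (N e)" "cball p (R + dist p e) \<subseteq> (\<Union>x\<in>N e. ball x (\<epsilon> / 2))" for e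
    by blast+
  have "\<exists>c\<in>N e. dist c (\<rho> g e) < \<epsilon> / 2" if "g \<in> ?A" for g e
  proof -
    have "dist p (\<rho> g e) \<le> R + dist p e"
      using that dist_triangle[of p "\<rho> g e" "\<rho> g p"] action_dist[of g p e] by simp
    then have "\<rho> g e \<in> cball p (R + dist p e)"
      by simp
    then have "\<rho> g e \<in> (\<Union>x\<in>N e. ball x (\<epsilon> / 2))"
      using N(2)[of e] by blast
    then show ?thesis by auto
  qed
  then obtain c where c: "\<And>g e. g \<in> ?A \<Longrightarrow> c g e \<in> N e \<and> dist (c g e) (\<rho> g e) < \<epsilon> / 2"
    by metis
  \<comment> \<open>Restricting to \<open>E\<close> places the choices of centres in a finite
    product; the fibres lie in cosets of the kernel.\<close>
  have "finite ((\<lambda>g. restrict (c g) E) ` ?A)"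
  proof (rule finite_subset)
    show "(\<lambda>g. restrict (c g) E) ` ?A \<subseteq> (\<Pi>\<^sub>E e\<in>E. N e)"
      using c by auto
    show "finite (\<Pi>\<^sub>E e\<in>E. N e)"
      using E(1) N(1) by (intro finite_PiE) auto
  qed
  moreover have "finite ((\<lambda>g. restrict (c g) E) -` {r} \<inter> ?A)" for r
  proof (cases "(\<lambda>g. restrict (c g) E) -` {r} \<inter> ?A = {}")
    case False
    then obtain g0 where g0: "g0 \<in> ?A" "restrict (c g0) E = r" by blast
    have "g \<in> (\<lambda>k. g0 \<otimes> k) ` kernel G Isom \<rho>" if g: "g \<in> ?A" "restrict (c g) E = r" for g
    proof -
      have "dist (\<rho> (inv g0 \<otimes> g) e) e < \<epsilon>" if "e \<in> E" for e
      proof -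
        have "c g e = c g0 e"
          using g(2) g0(2) that by (metis restrict_apply')
        then have "dist (\<rho> g e) (\<rho> g0 e) < \<epsilon>"
          using c[OF g(1), of e] c[OF g0(1), of e] dist_triangle_half_r[of "c g e" "\<rho> g e" \<epsilon> "\<rho> g0 e"] by simp
        then show ?thesis
          using action_dist[of "inv g0" "\<rho> g e" "\<rho> g0 e"] g(1) g0(1) by (simp add: action_mult action_inv)
      qed
      then have "\<rho> (inv g0 \<otimes> g) = id"
        using g(1) g0(1) by (intro trivial) auto
      then have "inv g0 \<otimes> g \<in> kernel G Isom \<rho>"
        using g(1) g0(1) by (simp add: kernel_def Isom_def)
      then show ?thesis
        using g(1) g0(1) by (intro image_eqI[of _ _ "inv g0 \<otimes> g"]) (simp_all add: m_assoc[symmetric])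
    qed
    moreover have "finite ((\<lambda>k. g0 \<otimes> k) ` kernel G Isom \<rho>)"
      using action by (simp add: proper_action_def)
    ultimately show ?thesis
      by (elim finite_subset[rotated]) auto
  qed simp
  ultimately show ?thesis
    using inf_img_fin_dom'[of "\<lambda>g. restrict (c g) E" ?A] by blast
qed

end

section \<open>Isometric actions\<close>

lemma Gromov_product_isometry:
  assumes "h \<in> isometries"
  shows "Gromov_product (h p) (h x) (h y) = Gromov_product p x y"
  using assms by (simp add: isometries_def Gromov_product_def)

lemma asymptotic_isometry:
  assumes h: "h \<in> isometries" and uv: "asymptotic u v"
  shows "asymptotic (h \<circ> u) (h \<circ> v)"
  unfolding asymptotic_def
proof
  fix p
  obtain q where "p = h q"
    using h by (metis (no_types, lifting) bij_pointE isometries_def mem_Collect_eq)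
  then show "filterlim (\<lambda>(i, j). Gromov_product p ((h \<circ> u) i) ((h \<circ> v) j)) at_top
      (sequentially \<times>\<^sub>F sequentially)"
    using uv h by (simp add: asymptotic_def Gromov_product_isometry)
qed

lemma inv_isometry:
  assumes "h \<in> isometries"
  shows "inv_into UNIV h \<in> isometries" "h (inv_into UNIV h x) = x" "inv_into UNIV h (h x) = x"
proof -
  have h: "bij h" "\<And>x y. dist (h x) (h y) = dist x y"
    using assms by (auto simp: isometries_def)
  then show "h (inv_into UNIV h x) = x" "inv_into UNIV h (h x) = x" for x
    by (simp_all add: bij_is_surj surj_f_inv_f bij_is_inj)
  with h show "inv_into UNIV h \<in> isometries"
    by (simp add: isometries_def bij_imp_bij_inv) metis
qed

section \<open>The Gromov boundary in terms of \<open>coterminal\<close>\<close>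

context
  fixes \<delta> :: real
  assumes X: "hyperbolic_pseudometric (dist :: 'x::metric_space \<Rightarrow> 'x \<Rightarrow> real) \<delta>"
begin

interpretation X: hyperbolic_pseudometric "dist :: 'x \<Rightarrow> 'x \<Rightarrow> real" \<delta>
  by (rule X)

text \<open>Changing the base point alters Gromov products by at most the distance moved, so a
  single base point decides.\<close>

lemma asymptotic_iff: "asymptotic u v \<longleftrightarrow> X.coterminal p u v" for u v :: "nat \<Rightarrow> 'x"
proof -
  have gp: "Gromov_product q x y = X.gp q x y" for q x y :: 'x
    by (simp add: Gromov_product_def X.gp_def)
  have iff: "X.coterminal q u v \<longleftrightarrow> filterlim (\<lambda>(i, j). Gromov_product q (u i) (v j)) at_top
      (sequentially \<times>\<^sub>F sequentially)" for q
    unfolding X.coterminal_def filterlim_at_top eventually_prod_sequentially by (simp add: gp) blast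
  have base: "X.coterminal q' u v" if "X.coterminal q u v" for q q'
    unfolding X.coterminal_def
  proof
    fix R
    obtain N where N: "\<forall>i\<ge>N. \<forall>j\<ge>N. R + dist q q' \<le> X.gp q (u i) (v j)"
      using \<open>X.coterminal q u v\<close> unfolding X.coterminal_def by blast
    have "R \<le> X.gp q' (u i) (v j)" if "N \<le> i" "N \<le> j" for i j
      using N[rule_format, OF that] X.gp_base[of q "u i" "v j" q'] by linarith
    then show "\<exists>N. \<forall>i\<ge>N. \<forall>j\<ge>N. R \<le> X.gp q' (u i) (v j)"
      by blast
  qed
  show ?thesis
    using base unfolding asymptotic_def iff[symmetric] by blast
qed

definition boundary_class :: "(nat \<Rightarrow> 'x) \<Rightarrow> (nat \<Rightarrow> 'x) set" where
  "boundary_class u = boundary_rel `` {u}"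

lemma boundary_class_mem: "asymptotic u u \<Longrightarrow> boundary_class u \<in> Gromov_boundary"
  by (simp add: boundary_class_def Gromov_boundary_def quotientI sequences_to_infinity_def)

lemma mem_boundary_class_iff:
  "w \<in> boundary_class u \<longleftrightarrow> asymptotic u u \<and> asymptotic w w \<and> asymptotic u w"
  by (auto simp: boundary_class_def boundary_rel_def sequences_to_infinity_def)

lemma boundary_class_eq_iff:
  assumes "asymptotic u u" "asymptotic v v"
  shows "boundary_class u = boundary_class v \<longleftrightarrow> asymptotic u v"
proof
  assume "boundary_class u = boundary_class v"
  then show "asymptotic u v"
    using assms mem_boundary_class_iff by blast
next
  assume "asymptotic u v"
  then show "boundary_class u = boundary_class v"
    using assms X.coterminal_trans X.coterminal_sym
    \<comment> \<open>\<open>undefined\<close> serves as an arbitrary base point.\<close>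
    unfolding asymptotic_iff[of _ _ undefined] set_eq_iff mem_boundary_class_iff by blast
qed

text \<open>Applying the inverse isometry shows that the image of a class is a whole class.\<close>

lemma boundary_map_class:
  assumes h: "h \<in> isometries"
  shows "boundary_map h (boundary_class u) = boundary_class (h \<circ> u)"
proof -
  let ?k = "inv_into UNIV h"
  have k: "?k \<in> isometries" "h \<circ> (?k \<circ> w) = w" "?k \<circ> (h \<circ> w) = w" for w :: "nat \<Rightarrow> 'x"
    using inv_isometry[OF h] by (auto simp: fun_eq_iff)
  have "?k \<circ> w \<in> boundary_class u" if "w \<in> boundary_class (h \<circ> u)" for w
    using that asymptotic_isometry[OF k(1), of "h \<circ> u" "h \<circ> u"]
      asymptotic_isometry[OF k(1), of w w] asymptotic_isometry[OF k(1), of "h \<circ> u" w]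
    by (simp add: mem_boundary_class_iff k(3))
  then have "w \<in> (\<lambda>v. h \<circ> v) ` boundary_class u" if "w \<in> boundary_class (h \<circ> u)" for w
    using that k(2)[of w] by (metis imageI)
  moreover have "h \<circ> v \<in> boundary_class (h \<circ> u)" if "v \<in> boundary_class u" for v
    using that asymptotic_isometry[OF h] by (simp add: mem_boundary_class_iff)
  ultimately show ?thesis
    unfolding boundary_map_def by blast
qed

end

lemma isometries_preserving_closure:
  fixes S :: "'x::metric_space set"
  assumes "h \<in> isometries" "h ` S = S"
  shows "h ` closure S = closure S"
proof -
  have sub: "f ` closure S \<subseteq> closure S" if "f \<in> isometries" "f ` S \<subseteq> S" for f :: "'x \<Rightarrow> 'x"
  proof
    fix y assume "y \<in> f ` closure S"
    then obtain x where x: "x \<in> closure S" "y = f x" by blast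
    show "y \<in> closure S"
      unfolding closure_approachable
    proof (intro allI impI)
      fix e :: real assume "0 < e"
      then obtain s where "s \<in> S" "dist s x < e"
        using x(1) unfolding closure_approachable by blast
      then show "\<exists>z\<in>S. dist z y < e"
        using that x(2) by (intro bexI[of _ "f s"]) (auto simp: isometries_def)
    qed
  qed
  have inv: "inv_into UNIV h ` S \<subseteq> S"
    using assms inv_isometry(3)[OF assms(1)] by (metis image_subsetI imageE)
  show ?thesis
  proof
    show "closure S \<subseteq> h ` closure S"
      using sub[OF inv_isometry(1)[OF assms(1)] inv] inv_isometry(2)[OF assms(1)]
      by (metis image_eqI image_subset_iff subsetI)
  qed (use sub assms in blast)
qed

context hyperbolic_group
begin

lemma loxodromic_not_coterminal_inv:
  assumes "loxodromic a"
  shows "\<not> coterminal \<one> (\<lambda>n. a [^] n) (\<lambda>n. inv a [^] n)"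
proof
  assume *: "coterminal \<one> (\<lambda>n. a [^] n) (\<lambda>n. inv a [^] n)"
  obtain D where D: "\<And>(m :: nat) (n :: nat). gp \<one> (inv a [^] m) (a [^] n) \<le> D"
    using loxodromic_bound[OF assms] by blast
  obtain N :: nat where "\<forall>i\<ge>N. \<forall>j\<ge>N. D + 1 \<le> gp \<one> (a [^] i) (inv a [^] j)"
    using * unfolding coterminal_def by blast
  then have "D + 1 \<le> gp \<one> (a [^] N) (inv a [^] N)"
    by blast
  then show False
    using D[of N N] gp_commute[of \<one> "a [^] N" "inv a [^] N"] by linarith
qed

end

section \<open>From a non-elementary action to nontrivial cohomology\<close>

lemma elementary_imageI_compact:
  "\<lbrakk>K \<noteq> {}; compact K; \<And>g. g \<in> A \<Longrightarrow> \<rho> g ` K = K\<rbrakk> \<Longrightarrow> elementary (\<rho> ` A)"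
  unfolding elementary_def by (intro disjI1 exI[of _ K] conjI) simp_all

lemma elementary_imageI_point:
  "\<lbrakk>\<xi> \<in> Gromov_boundary; \<And>g. g \<in> A \<Longrightarrow> boundary_map (\<rho> g) \<xi> = \<xi>\<rbrakk> \<Longrightarrow> elementary (\<rho> ` A)"
  unfolding elementary_def by (intro disjI2 disjI1 bexI[of _ \<xi>]) simp_all

lemma elementary_imageI_pair:
  assumes "\<xi> \<in> Gromov_boundary" "\<eta> \<in> Gromov_boundary" "\<xi> \<noteq> \<eta>"
    and "\<And>g. g \<in> A \<Longrightarrow> boundary_map (\<rho> g) ` {\<xi>, \<eta>} = {\<xi>, \<eta>}"
  shows "elementary (\<rho> ` A)"
proof -
  have "\<forall>h\<in>\<rho> ` A. boundary_map h ` {\<xi>, \<eta>} = {\<xi>, \<eta>}"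
    using assms(4) by blast
  with assms(1-3) show ?thesis
    unfolding elementary_def by (intro disjI2 bexI[of _ \<xi>] bexI[of _ \<eta>] conjI)
qed

text \<open>
  The pseudometric is the one of the orbit of a base point; a finite kernel and discreteness of
  the image together say that its balls are finite.
\<close>

lemma nonelementary_proper_action_in_class_C_reg:
  fixes G :: "('g, 'm) monoid_scheme" (structure)
    and \<rho> :: "'g \<Rightarrow> 'x::metric_space \<Rightarrow> 'x"
  assumes hyp: "Gromov_hyperbolic TYPE('x)"
    and proper: "proper_space TYPE('x)"
    and G: "group G"
    and countable: "countable (carrier G)"
    and \<rho>: "isometric_action G \<rho>"
    and pa: "proper_action G \<rho>"
    and nonelem: "\<not> elementary (\<rho> ` carrier G)"
  shows "class_C_reg G"
proof -
  interpret group G by (rule G)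
  note act = action_isometry[OF G \<rho>] action_dist[OF G \<rho>] action_mult[OF G \<rho>]
    action_one[OF G \<rho>] action_inv[OF G \<rho>]
  obtain \<delta>0 where \<delta>0: "\<And>p x y z :: 'x. Gromov_product p x z \<ge> min (Gromov_product p x y) (Gromov_product p y z) - \<delta>0"
    using hyp unfolding Gromov_hyperbolic_def by blast
  \<comment> \<open>The maximum with 1 supplies the positive constant that the locale
    demands.\<close>
  define \<delta> where "\<delta> = max \<delta>0 1"
  have "min (Gromov_product p x y) (Gromov_product p y z) \<le> Gromov_product p x z + \<delta>" for p x y z :: 'x
    using \<delta>0[of p x y z] by (simp add: \<delta>_def)
  then have "hyperbolic_pseudometric (dist :: 'x \<Rightarrow> 'x \<Rightarrow> real) \<delta>"
    unfolding Gromov_product_def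
    by (intro hyperbolic_pseudometric.intro dist_self dist_commute dist_triangle) (simp_all add: \<delta>_def)
  note X = this
  from X interpret X: hyperbolic_pseudometric "dist :: 'x \<Rightarrow> 'x \<Rightarrow> real" \<delta> .
  obtain p :: 'x where True by simp
  define d where "d x y = dist (\<rho> x p) (\<rho> y p)" for x y
  interpret hyperbolic_group G d \<delta>
  proof
    show "finite {x \<in> carrier G. d \<one> x \<le> R}" for R
      using proper_action_finite_ball[OF G \<rho> proper pa, of p R] by (simp add: d_def act)
    show "min ((d q x + d q y - d x y) / 2) ((d q y + d q z - d y z) / 2) \<le> (d q x + d q z - d x z) / 2 + \<delta>"
      for q x y z
      unfolding d_def by (rule X.hyperbolic)
    show "d x z \<le> d x y + d y z" for x y z
      unfolding d_def by (rule dist_triangle)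
  qed (auto simp: d_def act dist_commute \<delta>_def)
  define orb where "orb u = (\<lambda>n :: nat. \<rho> (u n) p)" for u
  have gp_orb: "gp g x y = X.gp (\<rho> g p) (\<rho> x p) (\<rho> y p)" for g x y
    by (simp add: gp_def X.gp_def d_def)
  have coterminal_orb: "asymptotic (orb u) (orb v) \<longleftrightarrow> coterminal \<one> u v" for u v
    unfolding asymptotic_iff[OF X, of _ _ p] by (simp add: X.coterminal_def coterminal_def orb_def gp_orb act)
  have orb_mult: "\<rho> g \<circ> orb u = orb (\<lambda>n. g \<otimes> u n)" if "g \<in> carrier G" "range u \<subseteq> carrier G" for g u
    using that by (auto simp: orb_def fun_eq_iff act image_subset_iff)
  let ?cl = "\<lambda>u. boundary_class (orb u)"
  have cl_mem: "?cl u \<in> Gromov_boundary" if "coterminal \<one> u u" for u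
    using that by (intro boundary_class_mem[OF X]) (simp add: coterminal_orb)
  have cl_eq: "?cl u = ?cl v \<longleftrightarrow> coterminal \<one> u v" if "coterminal \<one> u u" "coterminal \<one> v v" for u v
    using that boundary_class_eq_iff[OF X, of "orb u" "orb v"] by (simp add: coterminal_orb)
  have cl_map: "boundary_map (\<rho> g) (?cl u) = ?cl (\<lambda>n. g \<otimes> u n)"
    if "g \<in> carrier G" "range u \<subseteq> carrier G" for g u
    using that by (simp add: boundary_map_class[OF X] act orb_mult)
  \<comment> \<open>Otherwise the closure of the orbit is a compact invariant set.\<close>
  have unbounded: "\<exists>g\<in>carrier G. R \<le> d \<one> g" for R
  proof (rule ccontr)
    assume "\<not> ?thesis"
    then have R: "dist p (\<rho> g p) \<le> R" if "g \<in> carrier G" for g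
      using that by (force simp: d_def act)
    define S where "S = (\<lambda>g. \<rho> g p) ` carrier G"
    have "closure S \<subseteq> cball p R"
      using R by (intro closure_minimal) (auto simp: S_def)
    then have "compact (closure S)"
      using proper closed_Int_compact[OF closed_closure, of "cball p R" S]
      by (simp add: proper_space_def Int_absorb2)
    moreover have "\<rho> h ` closure S = closure S" if h: "h \<in> carrier G" for h
    proof (rule isometries_preserving_closure)
      have "\<rho> h (\<rho> g p) \<in> S" if "g \<in> carrier G" for g
        using h that by (auto simp: S_def act(3)[symmetric])
      moreover have "\<rho> g p \<in> \<rho> h ` S" if "g \<in> carrier G" for g
      proof (rule image_eqI)
        show "\<rho> g p = \<rho> h (\<rho> (inv h \<otimes> g) p)"
          using h that by (simp add: act)
        show "\<rho> (inv h \<otimes> g) p \<in> S"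
          unfolding S_def using h that by (intro imageI) simp
      qed
      ultimately show "\<rho> h ` S = S"
        by (auto simp: S_def)
    qed (use h act in blast)
    moreover have "closure S \<noteq> {}"
      by (auto simp: S_def)
    ultimately have "elementary (\<rho> ` carrier G)"
      by (intro elementary_imageI_compact[of "closure S"])
    with nonelem show False ..
  qed
  have "\<exists>a. loxodromic a"
  proof (rule ccontr)
    assume "\<not> ?thesis"
    then have par: "min (d \<one> g) (d \<one> h) / 2 - 3 * \<delta> \<le> gp \<one> g h" if "g \<in> carrier G" "h \<in> carrier G" for g h
      using loxodromic_or_parabolic that by blast
    \<comment> \<open>Without loxodromics this sequence and all its translates converge to the same
      boundary point, which the group therefore fixes.\<close>
    obtain u where u: "\<And>n :: nat. u n \<in> carrier G" "\<And>n. real n \<le> d \<one> (u n)"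
      using unbounded[of "real _"] by metis
    have shift: "coterminal \<one> (\<lambda>n. h \<otimes> u n) u" if h: "h \<in> carrier G" for h
      unfolding coterminal_def
    proof
      fix R
      \<comment> \<open>\<open>d \<one> h\<close> pays for passing from \<open>u i\<close> to
        \<open>h \<otimes> u i\<close>, the rest for the loss in \<open>par\<close>.\<close>
      obtain N :: nat where N: "2 * (R + 3 * \<delta>) + d \<one> h \<le> real N"
        using real_arch_simple by blast
      have "R \<le> gp \<one> (h \<otimes> u i) (u j)" if "i \<ge> N" "j \<ge> N" for i j
      proof -
        have "d \<one> (u i) \<le> d \<one> (h \<otimes> u i) + d \<one> h"
          using d_left[of h \<one> "u i"] d_triangle[of h "h \<otimes> u i" \<one>] d_sym[of h \<one>] h u(1)[of i] by simp
        moreover define m where "m = min (d \<one> (h \<otimes> u i)) (d \<one> (u j))"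
        ultimately have "2 * (R + 3 * \<delta>) \<le> m"
          using N that u(2)[of i] u(2)[of j] d_nonneg[of \<one> h] by (simp add: m_def)
        moreover have "m / 2 - 3 * \<delta> \<le> gp \<one> (h \<otimes> u i) (u j)"
          unfolding m_def using h u(1) by (intro par) auto
        ultimately show ?thesis
          by (simp add: field_simps)
      qed
      then show "\<exists>N. \<forall>i\<ge>N. \<forall>j\<ge>N. R \<le> gp \<one> (h \<otimes> u i) (u j)"
        by blast
    qed
    then have uu: "coterminal \<one> u u"
      using u(1) shift[of \<one>] by simp
    have "boundary_map (\<rho> h) (?cl u) = ?cl u" if h: "h \<in> carrier G" for h
    proof -
      have "coterminal \<one> (\<lambda>n. h \<otimes> u n) (\<lambda>n. h \<otimes> u n)"
        using coterminal_trans[OF shift[OF h] coterminal_sym[OF shift[OF h]]] .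
      then show ?thesis
        using cl_map[OF h, of u] cl_eq[OF _ uu] shift[OF h] u(1) by (simp add: image_subset_iff)
    qed
    then have "elementary (\<rho> ` carrier G)"
      by (rule elementary_imageI_point[OF cl_mem[OF uu]])
    with nonelem show False ..
  qed
  then obtain a where a: "loxodromic a" by blast
  have [simp]: "a \<in> carrier G" using a by simp
  \<comment> \<open>An element sending one end of \<open>a\<close> to an end of \<open>a\<close>
    does so with the other end too. If all elements did, the pair of ends would be
    preserved.\<close>
  have "\<exists>y\<in>carrier G. \<not> coterminal \<one> (\<lambda>n. y \<otimes> a [^] n) (\<lambda>n. a [^] n)
      \<and> \<not> coterminal \<one> (\<lambda>n. y \<otimes> a [^] n) (\<lambda>n. inv a [^] n)
      \<and> \<not> coterminal \<one> (\<lambda>n. y \<otimes> inv a [^] n) (\<lambda>n. a [^] n)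
      \<and> \<not> coterminal \<one> (\<lambda>n. y \<otimes> inv a [^] n) (\<lambda>n. inv a [^] n)"
  proof (rule ccontr)
    assume meet: "\<not> ?thesis"
    let ?\<xi> = "?cl (\<lambda>n. a [^] n)" and ?\<eta> = "?cl (\<lambda>n. inv a [^] n)"
    note ends = loxodromic_coterminal[OF a] loxodromic_coterminal[OF loxodromic_inv[OF a]]
    have "boundary_map (\<rho> h) ` {?\<xi>, ?\<eta>} = {?\<xi>, ?\<eta>}" if h: "h \<in> carrier G" for h
    proof -
      have hends: "coterminal \<one> (\<lambda>n. h \<otimes> a [^] n) (\<lambda>n. h \<otimes> a [^] n)"
        "coterminal \<one> (\<lambda>n. h \<otimes> inv a [^] n) (\<lambda>n. h \<otimes> inv a [^] n)"
        using ends h by (simp_all add: coterminal_left_iff image_subset_iff)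
      have img: "boundary_map (\<rho> h) ?\<xi> = ?cl (\<lambda>n. h \<otimes> a [^] n)"
        "boundary_map (\<rho> h) ?\<eta> = ?cl (\<lambda>n. h \<otimes> inv a [^] n)"
        using h by (simp_all add: cl_map image_subset_iff)
      have "coterminal \<one> (\<lambda>n. h \<otimes> a [^] n) (\<lambda>n. a [^] n) \<and> coterminal \<one> (\<lambda>n. h \<otimes> inv a [^] n) (\<lambda>n. inv a [^] n)
          \<or> coterminal \<one> (\<lambda>n. h \<otimes> a [^] n) (\<lambda>n. inv a [^] n) \<and> coterminal \<one> (\<lambda>n. h \<otimes> inv a [^] n) (\<lambda>n. a [^] n)"
        using meet h loxodromic_shared_endpoint_translate[OF a a h]
          loxodromic_shared_endpoint_translate[OF a loxodromic_inv[OF a] h]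
          loxodromic_shared_endpoint_translate[OF loxodromic_inv[OF a] a h]
          loxodromic_shared_endpoint_translate[OF loxodromic_inv[OF a] loxodromic_inv[OF a] h]
        by auto
      then show ?thesis
        using img cl_eq[OF hends(1) ends(1)] cl_eq[OF hends(1) ends(2)]
          cl_eq[OF hends(2) ends(1)] cl_eq[OF hends(2) ends(2)]
        by auto
    qed
    moreover have "?\<xi> \<noteq> ?\<eta>"
      using cl_eq[OF ends] loxodromic_not_coterminal_inv[OF a] by blast
    ultimately have "elementary (\<rho> ` carrier G)"
      by (intro elementary_imageI_pair[OF cl_mem[OF ends(1)] cl_mem[OF ends(2)]])
    with nonelem show False ..
  qed
  then obtain y where y: "y \<in> carrier G" "\<not> coterminal \<one> (\<lambda>n. y \<otimes> a [^] n) (\<lambda>n. a [^] n)"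
    "\<not> coterminal \<one> (\<lambda>n. y \<otimes> a [^] n) (\<lambda>n. inv a [^] n)"
    "\<not> coterminal \<one> (\<lambda>n. y \<otimes> inv a [^] n) (\<lambda>n. a [^] n)"
    "\<not> coterminal \<one> (\<lambda>n. y \<otimes> inv a [^] n) (\<lambda>n. inv a [^] n)"
    by blast
  show ?thesis
  proof (rule separating_wedge_not_bounded_primitive[OF a y])
    fix f k :: "'g \<Rightarrow> real" and C D
    assume fk: "bump_pair f k C D"
      and prim: "\<And>F c. (\<And>h E. \<lbrakk>finite E; E \<subseteq> carrier G; h \<in> carrier G\<rbrakk> \<Longrightarrow>
        (\<Sum>x\<in>E. (cmod (of_real (wedge f k x (x \<otimes> h)) - F x + F (x \<otimes> h)))\<^sup>2) \<le> c) \<Longrightarrow> False"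
    show "class_C_reg G"
      using countable fk prim by (rule class_C_reg_of_wedge)
  qed
qed

theorem corollary4:
  fixes G :: "('g, 'm) monoid_scheme"
    and \<rho> :: "'g \<Rightarrow> 'x::metric_space \<Rightarrow> 'x"
  assumes "Gromov_hyperbolic TYPE('x)"
    and "proper_space TYPE('x)"
    and "geodesic_space TYPE('x)"
    and "Isom_cocompact TYPE('x)"
    and "group G"
    and "countable (carrier G)"
    and "isometric_action G \<rho>"
    and "proper_action G \<rho>"
    and "nonelementary_action G \<rho>"
  shows "class_C_reg G"
  using nonelementary_proper_action_in_class_C_reg[OF assms(1,2,5-8)] assms(9)
  by (simp add: nonelementary_action_def)

end
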